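(* Let $\Omega\subset\mathbb{R}^{2}$ be non-empty, open and convex (bounded or unbounded), and suppose that $\overline{\Omega}$ is not a polyhedron, i.e. $\overline{\Omega}$ is not an intersection of finitely many closed half-planes. Then the Nehari theorem fails for $\Omega$ (i.e. it is not the case that the Nehari theorem is true for $\Omega$).
   Context: Here $n=2$. Fourier transform: $\widehat{f}(x)=\int_{\mathbb{R}^{n}}f(y)e^{-2\pi i x\cdot y}\,dy$, extended as usual to $L^{2}(\mathbb{R}^{n})$ and to the tempered distributions $S'(\mathbb{R}^{n})$. For $\Omega\subset\mathbb{R}^{n}$ non-empty, open and convex, the Paley-Wiener space $\mathrm{PW}(\Omega)$ is the closed subspace of $L^{2}(\mathbb{R}^{n})$ of functions $f$ whose Fourier transform is supported in $\Omega$, i.e. $\widehat{f}=0$ almost everywhere outside $\Omega$. For $\phi\in S'(\mathbb{R}^{n})$ the Hankel operator $\mathrm{H}_{\phi}$ on $\mathrm{PW}(\Omega)$ is given by $$\widehat{\mathrm{H}_{\phi}f}(x)=\int_{\Omega}\widehat{f}(y)\,\widehat{\phi}(x+y)\,dy,\qquad x\in\Omega,$$ densely defined on those $f$ with $\widehat{f}$ smooth and compactly supported in $\Omega$ (the integral being understood as a distributional pairing); it depends only on the restriction of $\widehat\phi$ to $2\Omega=\{2x:x\in\Omega\}$. One says $\phi$ generates a bounded Hankel operator if $\mathrm{H}_{\phi}$ extends to a bounded operator on $\mathrm{PW}(\Omega)$. The Nehari theorem is true for $\Omega$ if for every $\phi\in S'(\mathbb{R}^{n})$ that generates a bounded Hankel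 operator on $\mathrm{PW}(\Omega)$ there exists $\psi\in L^{\infty}(\mathbb{R}^{n})$ such that $\widehat{\phi}=\widehat{\psi}$ in $2\Omega$ (as distributions on $2\Omega$). The whole plane counts as a polyhedron (the empty intersection of half-planes). *)

theory Defs
  imports "HOL-Analysis.Analysis"
begin

section \<open>Smooth functions, Schwartz functions, test functions\<close>

definition dir_deriv :: "'a::euclidean_space \<Rightarrow> ('a \<Rightarrow> complex) \<Rightarrow> 'a \<Rightarrow> complex" where
  "dir_deriv v f = (\<lambda>x. frechet_derivative f (at x) v)"

definition iter_deriv :: "'a::euclidean_space list \<Rightarrow> ('a \<Rightarrow> complex) \<Rightarrow> 'a \<Rightarrow> complex" where
  "iter_deriv vs f = foldr dir_deriv vs f"

definition smooth :: "('a::euclidean_space \<Rightarrow> complex) \<Rightarrow> bool" where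
  "smooth f \<longleftrightarrow> (\<forall>vs. set vs \<subseteq> Basis \<longrightarrow> (\<forall>x. iter_deriv vs f differentiable (at x)))"

definition schwartz :: "('a::euclidean_space \<Rightarrow> complex) set" where
  "schwartz = {f. smooth f \<and>
     (\<forall>k vs. set vs \<subseteq> Basis \<longrightarrow> bounded (range (\<lambda>x. (1 + norm x) ^ k * norm (iter_deriv vs f x))))}"

definition schwartz_seminorm ::
    "nat \<Rightarrow> 'a::euclidean_space list \<Rightarrow> ('a \<Rightarrow> complex) \<Rightarrow> real" where
  "schwartz_seminorm k vs f = (SUP x. (1 + norm x) ^ k * norm (iter_deriv vs f x))"

definition test_functions :: "'a::euclidean_space set \<Rightarrow> ('a \<Rightarrow> complex) set" where
  "test_functions U =
     {f. smooth f \<and> compact (closure {x. f x \<noteq> 0}) \<and> closure {x. f x \<noteq> 0} \<subseteq> U}"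


section \<open>Tempered distributions\<close>

text \<open>A distribution is a functional on all functions of which only the values on
  Schwartz functions matter; its values elsewhere are irrelevant.\<close>

type_synonym 'a distr = "('a \<Rightarrow> complex) \<Rightarrow> complex"

text \<open>The last conjunct is continuity for the topology given by the
  seminorms above: domination by finitely many of them.\<close>

definition tempered_distribution :: "'a::euclidean_space distr \<Rightarrow> bool" where
  "tempered_distribution T \<longleftrightarrow>
     (\<forall>f\<in>schwartz. \<forall>g\<in>schwartz. T (\<lambda>x. f x + g x) = T f + T g) \<and>
     (\<forall>c. \<forall>f\<in>schwartz. T (\<lambda>x. c * f x) = c * T f) \<and>
     (\<exists>C N. \<forall>f\<in>schwartz. norm (T f) \<le>
        C * (\<Sum>k\<le>N. \<Sum>vs | set vs \<subseteq> Basis \<and> length vs \<le> N. schwartz_seminorm k vs f))"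

definition distr_of :: "('a::euclidean_space \<Rightarrow> complex) \<Rightarrow> 'a distr" where
  "distr_of f = (\<lambda>u. \<integral>x. f x * u x \<partial>lborel)"

definition distr_eq_on :: "'a::euclidean_space set \<Rightarrow> 'a distr \<Rightarrow> 'a distr \<Rightarrow> bool" where
  "distr_eq_on U S T \<longleftrightarrow> (\<forall>u\<in>test_functions U. S u = T u)"


section \<open>Fourier transform\<close>

definition fourier :: "('a::euclidean_space \<Rightarrow> complex) \<Rightarrow> 'a \<Rightarrow> complex" where
  "fourier f x = (\<integral>y. f y * exp (- 2 * of_real pi * \<i> * of_real (x \<bullet> y)) \<partial>lborel)"

definition fourier_distr :: "'a::euclidean_space distr \<Rightarrow> 'a distr" where
  "fourier_distr T = (\<lambda>u. T (fourier u))"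


section \<open>Lebesgue spaces and Paley-Wiener spaces\<close>

text \<open>Elements of \<open>L\<^sup>2\<close> and \<open>L\<^sup>\<infinity>\<close> are represented by Borel measurable functions; equality in
  these spaces is equality almost everywhere.\<close>

definition L2 :: "('a::euclidean_space \<Rightarrow> complex) set" where
  "L2 = {f. f \<in> borel_measurable lborel \<and> integrable lborel (\<lambda>x. (norm (f x))\<^sup>2)}"

definition L2_norm :: "('a::euclidean_space \<Rightarrow> complex) \<Rightarrow> real" where
  "L2_norm f = sqrt (\<integral>x. (norm (f x))\<^sup>2 \<partial>lborel)"

definition Linf :: "('a::euclidean_space \<Rightarrow> complex) set" where
  "Linf = {f. f \<in> borel_measurable lborel \<and> (\<exists>C. AE x in lborel. norm (f x) \<le> C)}"

text \<open>\<open>L2_fourier f g\<close>: the function \<open>g\<close> represents the Fourier transform of \<open>f \<in> L\<^sup>2\<close>.  The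
  transform on \<open>L\<^sup>2\<close> is the restriction of the one on tempered distributions.\<close>

definition L2_fourier :: "('a::euclidean_space \<Rightarrow> complex) \<Rightarrow> ('a \<Rightarrow> complex) \<Rightarrow> bool" where
  "L2_fourier f g \<longleftrightarrow> f \<in> L2 \<and> g \<in> L2 \<and>
     (\<forall>u\<in>schwartz. fourier_distr (distr_of f) u = distr_of g u)"

definition PW :: "'a::euclidean_space set \<Rightarrow> ('a \<Rightarrow> complex) set" where
  "PW \<Omega> = {f \<in> L2. \<exists>g. L2_fourier f g \<and> (AE x in lborel. x \<notin> \<Omega> \<longrightarrow> g x = 0)}"

definition bounded_operator_on ::
    "('a::euclidean_space \<Rightarrow> complex) set \<Rightarrow> (('a \<Rightarrow> complex) \<Rightarrow> ('a \<Rightarrow> complex)) \<Rightarrow> bool" where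
  "bounded_operator_on V A \<longleftrightarrow>
     (\<forall>f\<in>V. A f \<in> V) \<and>
     (\<forall>f\<in>V. \<forall>g\<in>V. AE x in lborel. A (\<lambda>y. f y + g y) x = A f x + A g x) \<and>
     (\<forall>c. \<forall>f\<in>V. AE x in lborel. A (\<lambda>y. c * f y) x = c * A f x) \<and>
     (\<exists>C. \<forall>f\<in>V. L2_norm (A f) \<le> C * L2_norm f)"


section \<open>Hankel operators and the Nehari theorem\<close>

text \<open>The pairing \<open>\<integral> F(y) \<Phi>(x + y) dy\<close> of a distribution \<open>\<Phi>\<close> with a test function \<open>F\<close>:
  substituting \<open>z = x + y\<close>, it is \<open>\<Phi>\<close> applied to \<open>z \<mapsto> F(z - x)\<close>.  If \<open>x \<in> \<Omega>\<close> and \<open>F\<close> is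
  supported in the convex set \<open>\<Omega>\<close>, this translate is supported in \<open>\<Omega> + \<Omega> = 2\<Omega>\<close>.\<close>

definition shift_pairing :: "'a::euclidean_space distr \<Rightarrow> ('a \<Rightarrow> complex) \<Rightarrow> 'a \<Rightarrow> complex" where
  "shift_pairing \<Phi> F x = \<Phi> (\<lambda>z. F (z - x))"

definition hankel_domain :: "'a::euclidean_space set \<Rightarrow> ('a \<Rightarrow> complex) set" where
  "hankel_domain \<Omega> = {f \<in> PW \<Omega>. \<exists>F\<in>test_functions \<Omega>. L2_fourier f F}"

text \<open>\<open>hankel \<phi> \<Omega> f h\<close>: \<open>f\<close> lies in the domain of the Hankel operator, and \<open>h\<close> is its image
  in the Paley-Wiener space.  No such \<open>h\<close> exists if the right-hand side of the defining
  formula is not square integrable over \<open>\<Omega>\<close>.\<close>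

definition hankel ::
    "'a::euclidean_space distr \<Rightarrow> 'a set \<Rightarrow> ('a \<Rightarrow> complex) \<Rightarrow> ('a \<Rightarrow> complex) \<Rightarrow> bool" where
  "hankel \<phi> \<Omega> f h \<longleftrightarrow> f \<in> PW \<Omega> \<and> h \<in> PW \<Omega> \<and>
     (\<exists>F\<in>test_functions \<Omega>. \<exists>G. L2_fourier f F \<and> L2_fourier h G \<and>
        (AE x in lborel. x \<in> \<Omega> \<longrightarrow> G x = shift_pairing (fourier_distr \<phi>) F x))"

definition generates_bounded_hankel :: "'a::euclidean_space distr \<Rightarrow> 'a set \<Rightarrow> bool" where
  "generates_bounded_hankel \<phi> \<Omega> \<longleftrightarrow>
     (\<exists>A. bounded_operator_on (PW \<Omega>) A \<and> (\<forall>f\<in>hankel_domain \<Omega>. hankel \<phi> \<Omega> f (A f)))"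

definition nehari_theorem_true :: "'a::euclidean_space set \<Rightarrow> bool" where
  "nehari_theorem_true \<Omega> \<longleftrightarrow>
     (\<forall>\<phi>. tempered_distribution \<phi> \<longrightarrow> generates_bounded_hankel \<phi> \<Omega> \<longrightarrow>
        (\<exists>\<psi>\<in>Linf. distr_eq_on ((\<lambda>x. 2 *\<^sub>R x) ` \<Omega>)
           (fourier_distr \<phi>) (fourier_distr (distr_of \<psi>))))"

end

theory Submission
  imports Defs "HOL-Probability.Probability"
begin

text \<open>Let \<open>K\<close> be the closure of \<open>\<Omega>\<close>.  In the plane, \<open>K\<close> has infinitely many extreme points unless it is a
  polyhedron.  If \<open>e\<close> is extreme, \<open>x, y \<in> \<Omega>\<close> and \<open>x + y\<close> is close to \<open>2 e\<close>, then \<open>x\<close> is close to \<open>e\<close>.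
  Hence for points \<open>p\<^sub>k \<in> \<Omega>\<close> chosen very close to distinct extreme points, the sets
  \<open>W\<^sub>k = \<Omega> \<inter> (2 p\<^sub>k - \<Omega>)\<close> are pairwise disjoint.  A symbol whose Fourier transform is the sum of the point
  masses at \<open>2 p\<^sub>k\<close> acts on the Fourier side by \<open>g \<mapsto> g(2 p\<^sub>k - x)\<close> on each \<open>W\<^sub>k\<close>, which is a contraction.

  Suppose a bounded \<open>\<psi>\<close> has the same Fourier transform on \<open>2\<Omega>\<close>.  Take an even bump \<open>v\<close> of small support,
  let \<open>V\<close> be the sum of its translates by \<open>2 p\<^sub>k\<close>, \<open>k < n\<close>, and let \<open>u\<close> be the convolution of \<open>v\<close> and \<open>V\<close>.
  Pairing with \<open>u\<close> gives \<open>n \<parallel>v\<parallel>\<^sup>2\<close> for the point masses.  By Plancherel the \<open>L\<^sup>1\<close> norm of the Fourier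
  transform of \<open>u\<close> is at most \<open>\<parallel>v\<parallel> \<parallel>V\<parallel> = \<surd>n \<parallel>v\<parallel>\<^sup>2\<close>, so \<open>\<surd>n\<close> is bounded by the supremum of \<open>\<psi>\<close> for all \<open>n\<close>.\<close>

section \<open>Smooth functions and bumps\<close>

text \<open>One symbol carries all the point masses at once, so a single \<open>\<psi>\<close> is
  tested against every \<open>n\<close>; this replaces a uniform boundedness argument over finite
  sums. The price is that the infinite sum has to be tempered. On a Schwartz function
  \<open>u\<close> the k-th term is the integral of \<open>u\<close> against an exponential of
  frequency \<open>2 *\<^sub>R p k\<close>, and it is made O(2^-k) in two different ways. If the
  extreme points are bounded, the \<open>p k\<close> converge to an accumulation point
  \<open>z\<close>, and the exponential of frequency \<open>2 *\<^sub>R z\<close> is subtracted;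
  \<open>z\<close> is outside \<open>\<Omega>\<close>, so \<open>2\<Omega>\<close> does not see it.
  If they are unbounded, the \<open>p k\<close> grow like \<open>2 ^ k\<close> and the oscillation
  alone makes the terms small. The balls that contain the sets \<open>W k\<close> get radii at most
  \<open>(1/2) ^ k\<close>. Their union then has finite measure, so the reflected function is
  integrable and its inverse transform is an absolutely convergent integral rather than an L2 limit.
  Since the transform on L2 is given only by pairings with Schwartz functions, norm bounds and
  uniqueness for it are obtained by duality, from the inequality in Plancherel's theorem and an
  approximation by test functions.\<close>

lemma iter_deriv_Nil [simp]: "iter_deriv [] f = f"
  and iter_deriv_snoc: "iter_deriv (vs @ [b]) f = iter_deriv vs (dir_deriv b f)"
  and iter_deriv_Cons: "iter_deriv (b # vs) f = dir_deriv b (iter_deriv vs f)"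
  by (simp_all add: iter_deriv_def)

text \<open>\<open>smooth\<close> quantifies over all lists of directions; an invariant
  \<open>P\<close> reduces this to a single differentiation. It serves scalar multiples,
  \<open>flat_algebra\<close>, and convolutions with a fixed integrable function.\<close>

lemma smooth_coinduct:
  assumes "P f"
    and "\<And>f x. P f \<Longrightarrow> f differentiable (at x)"
    and "\<And>f b. P f \<Longrightarrow> b \<in> Basis \<Longrightarrow> P (dir_deriv b f)"
  shows "smooth f"
proof -
  have "P (iter_deriv vs f)" if "set vs \<subseteq> Basis" for vs
    using that by (induction vs) (auto simp: iter_deriv_Cons assms)
  then show ?thesis using assms unfolding smooth_def by blast
qed

lemma smooth_differentiable: "smooth f \<Longrightarrow> f differentiable (at x)"
  unfolding smooth_def by (metis empty_set empty_subsetI iter_deriv_Nil)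

lemma smooth_dir_deriv: "smooth f \<Longrightarrow> b \<in> Basis \<Longrightarrow> smooth (dir_deriv b f)"
  unfolding smooth_def iter_deriv_snoc[symmetric] by simp

lemma smooth_iter_deriv: "smooth f \<Longrightarrow> set vs \<subseteq> Basis \<Longrightarrow> smooth (iter_deriv vs f)"
  by (induction vs) (auto simp: iter_deriv_Cons smooth_dir_deriv)

lemma smooth_has_derivative: "smooth f \<Longrightarrow> (f has_derivative frechet_derivative f (at x)) (at x)"
  using smooth_differentiable frechet_derivative_works by blast

lemma smooth_continuous_on: "smooth f \<Longrightarrow> continuous_on S f"
  by (meson continuous_at_imp_continuous_on differentiable_imp_continuous_within smooth_differentiable)

lemma smooth_borel_measurable: "smooth f \<Longrightarrow> f \<in> borel_measurable borel"
  by (intro borel_measurable_continuous_onI smooth_continuous_on)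

lemma dir_deriv_eqI: "(\<And>x. (f has_derivative D x) (at x)) \<Longrightarrow> dir_deriv b f = (\<lambda>x. D x b)"
  unfolding dir_deriv_def by (metis frechet_derivative_at)

lemma smooth_cmult: "smooth f \<Longrightarrow> smooth (\<lambda>x. c * f x)"
proof (rule smooth_coinduct[where P="\<lambda>g. \<exists>f. smooth f \<and> g = (\<lambda>x. c * f x)"])
  fix g :: "'a \<Rightarrow> complex" and b x :: 'a
  assume "\<exists>f. smooth f \<and> g = (\<lambda>x. c * f x)"
  then obtain f where f: "smooth f" and g: "g = (\<lambda>x. c * f x)" by blast
  have D: "(g has_derivative (\<lambda>h. c * frechet_derivative f (at x) h)) (at x)" for x
    unfolding g using f by (intro has_derivative_mult_right smooth_has_derivative)
  then show "g differentiable (at x)" by (auto simp: differentiable_def)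
  assume "b \<in> Basis"
  moreover have "dir_deriv b g = (\<lambda>x. c * dir_deriv b f x)"
    by (subst dir_deriv_eqI[OF D]) (simp add: dir_deriv_def)
  ultimately show "\<exists>f. smooth f \<and> dir_deriv b g = (\<lambda>x. c * f x)"
    using f smooth_dir_deriv by blast
qed blast

section \<open>Supports and test functions\<close>

lemma iter_deriv_eq_0:
  assumes "open U" "\<And>x. x \<in> U \<Longrightarrow> f x = 0" "x \<in> U"
  shows "iter_deriv vs f x = 0"
  using \<open>x \<in> U\<close>
proof (induction vs arbitrary: x)
  case (Cons v vs)
  have "(iter_deriv vs f has_derivative (\<lambda>h. 0)) (at x)"
    using has_derivative_transform_within_open[OF has_derivative_const[of 0 "at x"] \<open>open U\<close> Cons.prems] Cons.IH by metis
  then show ?case by (metis dir_deriv_def frechet_derivative_at iter_deriv_Cons)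
qed (use assms in auto)

lemma bounded_range_compact_support:
  fixes f :: "'a::euclidean_space \<Rightarrow> real"
  assumes "continuous_on UNIV f" "compact S" "\<And>x. x \<notin> S \<Longrightarrow> f x = 0"
  shows "bounded (range f)"
proof -
  have "bounded (f ` S)"
    using assms by (meson compact_continuous_image compact_imp_bounded continuous_on_subset top_greatest)
  moreover have "range f \<subseteq> insert 0 (f ` S)" using assms by force
  ultimately show ?thesis by (meson bounded_insert bounded_subset)
qed

lemma test_functionsD:
  assumes "f \<in> test_functions U"
  shows "smooth f" "compact (closure {x. f x \<noteq> 0})" "closure {x. f x \<noteq> 0} \<subseteq> U"
    "continuous_on S f" "f \<in> borel_measurable borel" "x \<notin> U \<Longrightarrow> f x = 0"
  using assms closure_subset[of "{x. f x \<noteq> 0}"]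
  by (auto simp: test_functions_def smooth_continuous_on smooth_borel_measurable)

lemma test_functionsI:
  assumes "smooth f" "compact S" "S \<subseteq> U" "\<And>x. x \<notin> S \<Longrightarrow> f x = 0"
  shows "f \<in> test_functions U"
proof -
  have "closure {x. f x \<noteq> 0} \<subseteq> S"
    using assms by (intro closure_minimal compact_imp_closed) auto
  moreover from this have "compact (closure {x. f x \<noteq> 0})"
    using \<open>compact S\<close> by (meson closed_closure compact_Int_closed compact_closure compact_imp_bounded bounded_subset closure_subset)
  ultimately show ?thesis using assms by (auto simp: test_functions_def)
qed

lemma test_functions_mono: "U \<subseteq> V \<Longrightarrow> test_functions U \<subseteq> test_functions V"
  by (auto simp: test_functions_def)

lemma test_functions_bounded_iter_deriv:
  assumes "f \<in> test_functions U" "set vs \<subseteq> Basis"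
  shows "bounded (range (\<lambda>x. (1 + norm x) ^ k * norm (iter_deriv vs f x)))"
proof (rule bounded_range_compact_support)
  show "compact (closure {x. f x \<noteq> 0})" using assms test_functionsD by blast
  show "continuous_on UNIV (\<lambda>x. (1 + norm x) ^ k * norm (iter_deriv vs f x))"
    using assms by (intro continuous_intros smooth_continuous_on smooth_iter_deriv test_functionsD)
  fix x assume "x \<notin> closure {x. f x \<noteq> 0}"
  then have "iter_deriv vs f x = 0"
    using closure_subset[of "{x. f x \<noteq> 0}"] by (intro iter_deriv_eq_0[of "- closure {x. f x \<noteq> 0}"]) auto
  then show "(1 + norm x) ^ k * norm (iter_deriv vs f x) = 0" by simp
qed

lemma test_functions_subset_schwartz: "test_functions U \<subseteq> schwartz"
  unfolding schwartz_def using test_functionsD(1) test_functions_bounded_iter_deriv by blast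

text \<open>All derivatives of the flat function \<open>flat 0\<close> are linear combinations of these.\<close>

definition flat :: "nat \<Rightarrow> real \<Rightarrow> real" where
  "flat n s = (if s > 0 then exp (- 1 / s) / s ^ n else 0)"

lemma flat_tendsto_0: "((\<lambda>s::real. exp (- 1 / s) / s ^ n) \<longlongrightarrow> 0) (at_right 0)"
proof -
  have "((\<lambda>t::real. t ^ n / exp t) \<longlongrightarrow> 0) at_top" by (rule tendsto_power_div_exp_0)
  then have "((\<lambda>s::real. inverse s ^ n / exp (inverse s)) \<longlongrightarrow> 0) (at_right 0)"
    using filterlim_compose filterlim_inverse_at_top_right by blast
  then show ?thesis by (simp add: exp_minus field_simps)
qed

lemma flat_has_derivative:
  "(flat n has_field_derivative flat (n + 2) s - n * flat (n + 1) s) (at s)"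
proof (cases "s = 0")
  case True
  have "((\<lambda>h. (flat n h - flat n 0) / h) \<longlongrightarrow> 0) (at_right 0)"
  proof (rule Lim_transform_eventually[OF flat_tendsto_0[of "n + 1"]])
    show "\<forall>\<^sub>F h in at_right 0. exp (- 1 / h) / h ^ (n + 1) = (flat n h - flat n 0) / h"
      unfolding eventually_at_right_field by (intro exI[of _ 1]) (auto simp: flat_def)
  qed
  moreover have "((\<lambda>h. (flat n h - flat n 0) / h) \<longlongrightarrow> 0) (at_left 0)"
  proof (rule Lim_transform_eventually[OF tendsto_const])
    show "\<forall>\<^sub>F h in at_left 0. 0 = (flat n h - flat n 0) / h"
      unfolding eventually_at_left_field by (intro exI[of _ "-1"]) (auto simp: flat_def)
  qed
  ultimately have "((\<lambda>h. (flat n (0 + h) - flat n 0) / h) \<longlongrightarrow> 0) (at 0)"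
    by (simp add: filterlim_split_at)
  then show ?thesis unfolding True DERIV_def by (simp add: flat_def)
next
  case False
  show ?thesis
  proof (cases "s > 0")
    case True
    have "((\<lambda>s. exp (- 1 / s)) has_field_derivative exp (- 1 / s) * (1 / s\<^sup>2)) (at s)"
      using True by (auto intro!: derivative_eq_intros simp: power2_eq_square)
    from DERIV_divide[OF this DERIV_pow[of n s UNIV]] True
    have "((\<lambda>s. exp (- 1 / s) / s ^ n) has_field_derivative
        (exp (- 1 / s) * (1 / s\<^sup>2) * s ^ n - exp (- 1 / s) * (n * s ^ (n - 1))) / (s ^ n * s ^ n)) (at s)"
      by simp
    also have "(exp (- 1 / s) * (1 / s\<^sup>2) * s ^ n - exp (- 1 / s) * (n * s ^ (n - 1))) / (s ^ n * s ^ n)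
        = flat (n + 2) s - n * flat (n + 1) s"
      using True by (cases n) (auto simp: flat_def field_simps power2_eq_square)
    finally have "((\<lambda>s. exp (- 1 / s) / s ^ n) has_field_derivative flat (n + 2) s - n * flat (n + 1) s) (at s)" .
    moreover have "\<forall>\<^sub>F t in nhds s. flat n t = exp (- 1 / t) / t ^ n"
      using True eventually_nhds_in_open[of "{0<..}" s] by (auto elim!: eventually_mono simp: flat_def)
    ultimately show ?thesis
      using DERIV_cong_ev[OF refl _ refl, of "flat n" "\<lambda>s. exp (- 1 / s) / s ^ n" s] by auto
  next
    case F2: False
    have "((\<lambda>s::real. 0) has_field_derivative 0) (at s)" by simp
    moreover have "\<forall>\<^sub>F t in nhds s. flat n t = 0"
      using False F2 eventually_nhds_in_open[of "{..<0}" s] by (auto elim!: eventually_mono simp: flat_def)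
    ultimately show ?thesis using DERIV_cong_ev[OF refl _ refl, of "flat n" "\<lambda>_. 0" s] F2 by (simp add: flat_def)
  qed
qed

text \<open>Flat functions of affine forms, closed under sums and products, are a class stable under
  \<open>dir_deriv\<close>. Smoothness of the bump then follows from \<open>smooth_coinduct\<close>
  with this class as invariant.\<close>

inductive_set flat_algebra :: "('a::euclidean_space \<Rightarrow> complex) set" where
  flat: "(\<lambda>x. of_real (flat n (a + x \<bullet> c))) \<in> flat_algebra"
| const: "(\<lambda>x. z) \<in> flat_algebra"
| add: "f \<in> flat_algebra \<Longrightarrow> g \<in> flat_algebra \<Longrightarrow> (\<lambda>x. f x + g x) \<in> flat_algebra"
| mult: "f \<in> flat_algebra \<Longrightarrow> g \<in> flat_algebra \<Longrightarrow> (\<lambda>x. f x * g x) \<in> flat_algebra"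

lemma flat_algebra_derivative:
  assumes "f \<in> flat_algebra"
  shows "\<exists>D. (\<forall>x. (f has_derivative D x) (at x)) \<and> (\<forall>b. (\<lambda>x. D x b) \<in> flat_algebra)"
  using assms
proof induction
  case (flat n a c)
  define d where "d = (\<lambda>x. flat (n + 2) (a + x \<bullet> c) - n * flat (n + 1) (a + x \<bullet> c))"
  have "((\<lambda>x. complex_of_real (flat n (a + x \<bullet> c))) has_derivative (\<lambda>h. of_real ((h \<bullet> c) * d x))) (at x)" for x
    unfolding d_def
    by (rule has_derivative_of_real, rule has_derivative_eq_rhs,
        rule has_derivative_compose[OF _ flat_has_derivative[unfolded has_field_derivative_def]])
       (auto intro!: derivative_eq_intros simp: mult.commute)
  moreover have "(\<lambda>x. of_real ((b \<bullet> c) * d x)) \<in> flat_algebra" for b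
  proof -
    have "(\<lambda>x. of_real (b \<bullet> c) * (of_real (flat (n + 2) (a + x \<bullet> c)) + (- of_nat n) * of_real (flat (n + 1) (a + x \<bullet> c)))) \<in> flat_algebra"
      by (intro flat_algebra.intros)
    then show ?thesis by (simp add: d_def)
  qed
  ultimately show ?case by (intro exI[of _ "\<lambda>x h. of_real ((h \<bullet> c) * d x)"]) auto
next
  case (const z)
  show ?case by (intro exI[of _ "\<lambda>x h. 0"]) (auto intro: flat_algebra.const)
next
  case (add f g)
  then obtain D E where "\<forall>x. (f has_derivative D x) (at x)" "\<forall>b. (\<lambda>x. D x b) \<in> flat_algebra"
    "\<forall>x. (g has_derivative E x) (at x)" "\<forall>b. (\<lambda>x. E x b) \<in> flat_algebra" by blast
  then show ?case by (intro exI[of _ "\<lambda>x h. D x h + E x h"]) (auto intro: flat_algebra.add has_derivative_add)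
next
  case (mult f g)
  then obtain D E where "\<forall>x. (f has_derivative D x) (at x)" "\<forall>b. (\<lambda>x. D x b) \<in> flat_algebra"
    "\<forall>x. (g has_derivative E x) (at x)" "\<forall>b. (\<lambda>x. E x b) \<in> flat_algebra" by blast
  then show ?case using mult.hyps
    by (intro exI[of _ "\<lambda>x h. f x * E x h + D x h * g x"])
       (auto intro!: flat_algebra.add flat_algebra.mult has_derivative_mult)
qed

lemma smooth_flat_algebra: "f \<in> flat_algebra \<Longrightarrow> smooth f"
proof (erule smooth_coinduct)
  fix f :: "'a \<Rightarrow> complex" and x b :: 'a assume "f \<in> flat_algebra"
  then obtain D where D: "\<And>x. (f has_derivative D x) (at x)" "\<And>b. (\<lambda>x. D x b) \<in> flat_algebra"
    using flat_algebra_derivative by blast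
  show "f differentiable (at x)" using D by (auto simp: differentiable_def)
  show "dir_deriv b f \<in> flat_algebra" using D dir_deriv_eqI[OF D(1)] by simp
qed

lemma flat_algebra_prod:
  "finite I \<Longrightarrow> (\<And>i. i \<in> I \<Longrightarrow> f i \<in> flat_algebra) \<Longrightarrow> (\<lambda>x. \<Prod>i\<in>I. f i x) \<in> flat_algebra"
  by (induction rule: finite_induct) (auto intro: flat_algebra.intros)

lemma bump_exists:
  assumes "r > 0"
  obtains v :: "'a::euclidean_space \<Rightarrow> real" where
    "(\<lambda>x. complex_of_real (v x)) \<in> test_functions (ball 0 r)" "v 0 > 0"
    "\<And>x. v x \<ge> 0" "\<And>x. v (- x) = v x" "\<And>x. v x \<noteq> 0 \<Longrightarrow> norm x < r"
proof -
  \<comment> \<open>The product of flat functions below lives on the cube of half-side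
    \<open>s\<close>. Its points have at most \<open>DIM('a) * s = r / 2\<close> as the sum of the
    absolute values of their coordinates, hence also as norm.\<close>
  define s where "s = r / (2 * real DIM('a))"
  have s: "s > 0" using assms by (simp add: s_def)
  define v where "v = (\<lambda>x::'a. \<Prod>b\<in>Basis. flat 0 (s + x \<bullet> b) * flat 0 (s + x \<bullet> (- b)))"
  have supp: "x \<in> cball 0 (r / 2)" if "v x \<noteq> 0" for x
  proof -
    have "\<bar>x \<bullet> b\<bar> \<le> s" if "b \<in> Basis" for b
      using \<open>v x \<noteq> 0\<close> that by (force simp: v_def flat_def split: if_splits)
    then have "(\<Sum>b\<in>Basis. \<bar>x \<bullet> b\<bar>) \<le> (\<Sum>b\<in>(Basis::'a set). s)" by (intro sum_mono)
    then show ?thesis using norm_le_l1[of x] by (simp add: s_def)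
  qed
  show ?thesis
  proof
    have "(\<lambda>x. complex_of_real (v x)) \<in> flat_algebra"
      unfolding v_def of_real_prod of_real_mult by (intro flat_algebra_prod flat_algebra.mult flat_algebra.flat) auto
    then show "(\<lambda>x. complex_of_real (v x)) \<in> test_functions (ball 0 r)"
      using supp assms by (intro test_functionsI[of _ "cball 0 (r/2)"] smooth_flat_algebra) auto
    show "v 0 > 0" using s by (auto simp: v_def flat_def intro!: prod_pos)
    show "v x \<ge> 0" for x by (auto simp: v_def flat_def intro!: prod_nonneg)
    show "v (- x) = v x" for x by (simp add: v_def mult.commute)
    show "norm x < r" if "v x \<noteq> 0" for x using supp[OF that] assms by auto
  qed
qed

section \<open>Convolutions\<close>

lemma lborel_distr_reflect:
  fixes c :: "'a::euclidean_space"
  shows "distr lborel borel (\<lambda>y. c - y) = lborel"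
  by (subst (2) lborel_affine[of "-1" c]) (auto simp: density_1 one_ennreal_def[symmetric])

lemma nn_integral_lborel_reflect:
  fixes c :: "'a::euclidean_space"
  assumes [measurable]: "f \<in> borel_measurable borel"
  shows "(\<integral>\<^sup>+y. f (c - y) \<partial>lborel) = (\<integral>\<^sup>+y. f y \<partial>lborel)"
  by (subst (2) lborel_distr_reflect[of c, symmetric]) (simp add: nn_integral_distr)

lemma integrable_lborel_reflect:
  fixes c :: "'a::euclidean_space" and f :: "'a \<Rightarrow> 'b::{banach, second_countable_topology}"
  assumes "integrable lborel f"
  shows "integrable lborel (\<lambda>y. f (c - y))"
proof -
  have "integrable (distr lborel borel (\<lambda>y. c - y)) f" using assms by (simp add: lborel_distr_reflect)
  then show ?thesis by (subst (asm) integrable_distr_eq) (use assms in auto)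
qed

lemma integral_lborel_reflect:
  fixes c :: "'a::euclidean_space" and f :: "'a \<Rightarrow> 'b::{banach, second_countable_topology}"
  assumes [measurable]: "f \<in> borel_measurable borel"
  shows "(\<integral>y. f (c - y) \<partial>lborel) = (\<integral>y. f y \<partial>lborel)"
  by (subst (2) lborel_distr_reflect[of c, symmetric]) (simp add: integral_distr)

lemma AE_lborel_reflect:
  fixes c :: "'a::euclidean_space"
  assumes "AE x in lborel. P x"
  shows "AE x in lborel. P (c - x)"
proof -
  have "AE x in distr lborel borel (\<lambda>y. c - y). P x" using assms by (subst lborel_distr_reflect)
  then show ?thesis by (rule AE_distrD[rotated]) simp
qed

text \<open>A translation is the composition of the two reflections \<open>y \<mapsto> - y\<close>
  and \<open>y \<mapsto> c - y\<close>.\<close>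

lemma nn_integral_lborel_translate:
  fixes c :: "'a::euclidean_space"
  assumes [measurable]: "f \<in> borel_measurable borel"
  shows "(\<integral>\<^sup>+y. f (y - c) \<partial>lborel) = (\<integral>\<^sup>+y. f y \<partial>lborel)"
  using nn_integral_lborel_reflect[of "\<lambda>y. f (- y)" c] nn_integral_lborel_reflect[of f 0] by simp

lemma integrable_lborel_translate:
  fixes c :: "'a::euclidean_space" and f :: "'a \<Rightarrow> 'b::{banach, second_countable_topology}"
  assumes "integrable lborel f"
  shows "integrable lborel (\<lambda>y. f (y - c))"
  using integrable_lborel_reflect[OF integrable_lborel_reflect[OF assms, of 0], of c] by simp

lemma integral_lborel_translate:
  fixes c :: "'a::euclidean_space" and f :: "'a \<Rightarrow> 'b::{banach, second_countable_topology}"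
  assumes [measurable]: "f \<in> borel_measurable borel"
  shows "(\<integral>y. f (y - c) \<partial>lborel) = (\<integral>y. f y \<partial>lborel)"
  using integral_lborel_reflect[of "\<lambda>y. f (- y)" c] integral_lborel_reflect[of f 0] by simp

lemma integrable_mult_bounded:
  fixes g w :: "'a::euclidean_space \<Rightarrow> complex"
  assumes "integrable lborel g" and [measurable]: "w \<in> borel_measurable borel"
    and "\<And>x. norm (w x) \<le> B"
  shows "integrable lborel (\<lambda>y. g y * w y)" and "integrable lborel (\<lambda>y. w y * g y)"
proof -
  have [measurable]: "g \<in> borel_measurable borel" using assms(1) by auto
  show "integrable lborel (\<lambda>y. g y * w y)"
  proof (rule Bochner_Integration.integrable_bound)
    show "integrable lborel (\<lambda>y. B * norm (g y))" using assms(1) by simp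
    show "AE x in lborel. norm (g x * w x) \<le> norm (B * norm (g x))"
    proof (intro AE_I2)
      fix x
      have "norm (g x * w x) \<le> norm (g x) * B" by (simp add: norm_mult assms(3) mult_left_mono)
      then show "norm (g x * w x) \<le> norm (B * norm (g x))" by (simp add: mult.commute)
    qed
  qed simp
  then show "integrable lborel (\<lambda>y. w y * g y)" by (simp add: mult.commute)
qed

section \<open>Smoothness of convolutions with test functions\<close>

lemma test_functions_dir_deriv:
  assumes "v \<in> test_functions U" "b \<in> Basis"
  shows "dir_deriv b v \<in> test_functions U"
proof (rule test_functionsI)
  show "smooth (dir_deriv b v)" using assms test_functionsD smooth_dir_deriv by blast
  show "compact (closure {x. v x \<noteq> 0})" "closure {x. v x \<noteq> 0} \<subseteq> U" using assms test_functionsD by blast+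
  fix x assume "x \<notin> closure {x. v x \<noteq> 0}"
  then have "iter_deriv [b] v x = 0"
    using closure_subset[of "{x. v x \<noteq> 0}"] by (intro iter_deriv_eq_0[of "- closure {x. v x \<noteq> 0}"]) auto
  then show "dir_deriv b v x = 0" by (simp add: iter_deriv_Cons)
qed

lemma test_functions_bounded:
  assumes "v \<in> test_functions U"
  obtains B where "B \<ge> 0" "\<And>x. norm (v x) \<le> B"
proof -
  have "bounded (range (\<lambda>x. (1 + norm x) ^ 0 * norm (iter_deriv [] v x)))"
    by (rule test_functions_bounded_iter_deriv[OF assms]) simp
  then obtain B where "\<And>x. norm (v x) \<le> B" unfolding bounded_iff by auto
  then show ?thesis using that norm_ge_zero order.trans by blast
qed

lemma frechet_derivative_eq_sum_dir_deriv:
  assumes "smooth v"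
  shows "frechet_derivative v (at z) h = (\<Sum>b\<in>Basis. (h \<bullet> b) *\<^sub>R dir_deriv b v z)"
proof -
  have "linear (frechet_derivative v (at z))"
    using smooth_has_derivative[OF assms] has_derivative_linear by blast
  then have "frechet_derivative v (at z) (\<Sum>b\<in>Basis. (h \<bullet> b) *\<^sub>R b) = (\<Sum>b\<in>Basis. (h \<bullet> b) *\<^sub>R frechet_derivative v (at z) b)"
    by (simp add: linear_sum linear_scale)
  then show ?thesis by (simp add: dir_deriv_def euclidean_representation)
qed

lemma norm_frechet_derivative_le:
  assumes "smooth v"
  shows "norm (frechet_derivative v (at z) h) \<le> (\<Sum>b\<in>Basis. norm (dir_deriv b v z)) * norm h"
  unfolding frechet_derivative_eq_sum_dir_deriv[OF assms] sum_distrib_right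
  by (rule order.trans[OF norm_sum], rule sum_mono)
     (simp add: mult.commute[of _ "norm h"] Basis_le_norm mult_right_mono)

lemma test_functions_Lipschitz:
  assumes "v \<in> test_functions U"
  obtains B where "B \<ge> 0" "\<And>z h. norm (frechet_derivative v (at z) h) \<le> B * norm h"
    "\<And>z h. norm (v (z + h) - v z) \<le> B * norm h"
proof -
  have sm: "smooth v" using assms test_functionsD by blast
  have "\<exists>B. \<forall>x. norm (dir_deriv b v x) \<le> B" if "b \<in> Basis" for b
    using test_functions_bounded[OF test_functions_dir_deriv[OF assms that]] by metis
  then obtain C where C: "\<And>b x. b \<in> Basis \<Longrightarrow> norm (dir_deriv b v x) \<le> C b" by metis
  define B where "B = (\<Sum>b\<in>Basis. C b)"
  have "(\<Sum>b\<in>Basis. norm (dir_deriv b v z)) \<le> B" for z unfolding B_def by (intro sum_mono C)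
  then have D: "norm (frechet_derivative v (at z) h) \<le> B * norm h" for z h
    using norm_frechet_derivative_le[OF sm, of z h] by (meson mult_right_mono norm_ge_zero order.trans)
  have "norm (v (z + h) - v z) \<le> B * norm ((z + h) - z)" for z h
  proof (rule differentiable_bound[of UNIV])
    show "(v has_derivative frechet_derivative v (at x)) (at x)" for x by (rule smooth_has_derivative[OF sm])
    show "onorm (frechet_derivative v (at x)) \<le> B" for x by (rule onorm_le) (rule D)
  qed auto
  moreover have "B \<ge> 0" unfolding B_def using C norm_ge_zero order.trans by (metis (mono_tags, lifting) sum_nonneg)
  ultimately show ?thesis using that D by simp
qed

definition conv :: "('a::euclidean_space \<Rightarrow> complex) \<Rightarrow> ('a \<Rightarrow> complex) \<Rightarrow> 'a \<Rightarrow> complex" where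
  "conv g v x = (\<integral>y. g y * v (x - y) \<partial>lborel)"

text \<open>Differentiation under the integral sign. The first-order remainder of \<open>v\<close>,
  divided by \<open>norm h\<close>, tends to 0 pointwise and is bounded by twice the Lipschitz
  constant of \<open>v\<close>, so dominated convergence applies along every sequence of increments
  tending to 0. All derivatives fall on \<open>v\<close>; of \<open>g\<close> only integrability is
  used.\<close>

lemma conv_has_derivative:
  fixes g :: "'a::euclidean_space \<Rightarrow> complex"
  assumes g: "integrable lborel g" and v: "v \<in> test_functions UNIV"
  shows "(conv g v has_derivative (\<lambda>h. \<Sum>b\<in>Basis. (h \<bullet> b) *\<^sub>R conv g (dir_deriv b v) x)) (at x)"
proof -
  obtain B where B: "B \<ge> 0" "\<And>z h. norm (frechet_derivative v (at z) h) \<le> B * norm h"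
    "\<And>z h. norm (v (z + h) - v z) \<le> B * norm h" using test_functions_Lipschitz[OF v] by metis
  have sm: "smooth v" using v test_functionsD by blast
  have [measurable]: "g \<in> borel_measurable borel" using g by auto
  have int: "integrable lborel (\<lambda>y. g y * w (x - y))" if w: "w \<in> test_functions UNIV" for w x
  proof -
    obtain C where "\<And>x. norm (w x) \<le> C" using test_functions_bounded[OF w] by metis
    moreover have [measurable]: "w \<in> borel_measurable borel" using w test_functionsD by blast
    ultimately show ?thesis using g by (intro integrable_mult_bounded[where B=C]) auto
  qed
  note [measurable] = test_functionsD(5)[OF v] test_functionsD(5)[OF test_functions_dir_deriv[OF v]]
  define D where "D = (\<lambda>h. \<Sum>b\<in>Basis. (h \<bullet> b) *\<^sub>R conv g (dir_deriv b v) x)"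
  define R where "R = (\<lambda>h y. v (x + h - y) - v (x - y) - frechet_derivative v (at (x - y)) h)"
  have R: "norm (conv g v (x + h) - conv g v x - D h) = norm (\<integral>y. g y * R h y \<partial>lborel)" for h
  proof -
    have "D h = (\<integral>y. g y * frechet_derivative v (at (x - y)) h \<partial>lborel)"
      unfolding frechet_derivative_eq_sum_dir_deriv[OF sm] D_def conv_def sum_distrib_left
      by (subst Bochner_Integration.integral_sum) (auto intro!: int test_functions_dir_deriv v)
    moreover have "integrable lborel (\<lambda>y. g y * frechet_derivative v (at (x - y)) h)"
      unfolding frechet_derivative_eq_sum_dir_deriv[OF sm] sum_distrib_left
      by (auto intro!: int test_functions_dir_deriv v)
    ultimately show ?thesis
      unfolding conv_def R_def using int[OF v]
      by (simp add: right_diff_distrib)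
  qed
  have "((\<lambda>h. norm (conv g v (x + h) - conv g v x - D h) / norm h) \<longlongrightarrow> 0) (at 0)"
    unfolding tendsto_at_iff_sequentially
  proof (intro allI impI)
    fix X :: "nat \<Rightarrow> 'a" assume X: "\<forall>i. X i \<in> UNIV - {0}" "X \<longlonglongrightarrow> 0"
    have "(\<lambda>i. \<integral>y. g y * (R (X i) y / of_real (norm (X i))) \<partial>lborel) \<longlonglongrightarrow> integral\<^sup>L lborel (\<lambda>y::'a. 0)"
    proof (rule integral_dominated_convergence[where w="\<lambda>y. 2 * B * norm (g y)"])
      show "integrable lborel (\<lambda>y. 2 * B * norm (g y))" using g by simp
      show "(\<lambda>y. g y * (R (X i) y / of_real (norm (X i)))) \<in> borel_measurable lborel" for i
        unfolding R_def frechet_derivative_eq_sum_dir_deriv[OF sm] by measurable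
      have "norm (R h y) \<le> 2 * B * norm h" for h y
      proof -
        have "norm (R h y) \<le> norm (v (x - y + h) - v (x - y)) + norm (frechet_derivative v (at (x - y)) h)"
          unfolding R_def
          using norm_triangle_ineq4[of "v (x - y + h) - v (x - y)" "frechet_derivative v (at (x - y)) h"]
          by (simp add: algebra_simps)
        then show ?thesis using B(2)[of "x - y" h] B(3)[of "x - y" h] by simp
      qed
      then have "norm (R (X i) y / of_real (norm (X i))) \<le> 2 * B" for i y
        using X(1) by (simp add: norm_divide pos_divide_le_eq)
      then have "norm (g y * (R (X i) y / of_real (norm (X i)))) \<le> norm (g y) * (2 * B)" for i y
        unfolding norm_mult by (rule mult_left_mono) simp
      then show "AE y in lborel. norm (g y * (R (X i) y / of_real (norm (X i)))) \<le> 2 * B * norm (g y)" for i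
        by (simp add: mult.commute)
      show "AE y in lborel. (\<lambda>i. g y * (R (X i) y / of_real (norm (X i)))) \<longlonglongrightarrow> 0"
      proof (rule AE_I2)
        fix y
        have "((\<lambda>h. norm (v ((x - y) + h) - v (x - y) - frechet_derivative v (at (x - y)) h) / norm h) \<longlongrightarrow> 0) (at 0)"
          using smooth_has_derivative[OF sm, of "x - y"] unfolding has_derivative_at by blast
        then have "(\<lambda>i. norm (R (X i) y) / norm (X i)) \<longlonglongrightarrow> 0"
          using X unfolding tendsto_at_iff_sequentially R_def by (simp add: comp_def algebra_simps)
        then have "(\<lambda>i. R (X i) y / of_real (norm (X i))) \<longlonglongrightarrow> 0"
          by (subst tendsto_norm_zero_iff[symmetric]) (simp add: norm_divide)
        then show "(\<lambda>i. g y * (R (X i) y / of_real (norm (X i)))) \<longlonglongrightarrow> 0"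
          using tendsto_mult_right_zero by blast
      qed
    qed simp
    then have "(\<lambda>i. norm (\<integral>y. g y * R (X i) y / of_real (norm (X i)) \<partial>lborel)) \<longlonglongrightarrow> 0"
      by (simp add: tendsto_norm_zero_iff)
    then show "((\<lambda>h. norm (conv g v (x + h) - conv g v x - D h) / norm h) \<circ> X) \<longlonglongrightarrow> 0"
      unfolding R comp_def by (simp add: norm_divide)
  qed
  moreover have "bounded_linear D"
    unfolding D_def by (intro bounded_linear_sum bounded_linear_scaleR_left[THEN bounded_linear_compose] bounded_linear_inner_left)
  ultimately show ?thesis unfolding has_derivative_at D_def by blast
qed

lemma smooth_conv:
  assumes g: "integrable lborel g" and v: "v \<in> test_functions UNIV"
  shows "smooth (conv g v)"
proof (rule smooth_coinduct[where P="\<lambda>f. \<exists>v\<in>test_functions UNIV. f = conv g v"])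
  fix f and b x :: 'a assume "\<exists>v\<in>test_functions UNIV. f = conv g v"
  then obtain v where v: "v \<in> test_functions UNIV" and f: "f = conv g v" by blast
  note D = conv_has_derivative[OF g v]
  show "f differentiable (at x)" using D unfolding f differentiable_def by blast
  assume b: "b \<in> Basis"
  have "dir_deriv b f = conv g (dir_deriv b v)"
    unfolding f dir_deriv_eqI[OF D] using b by (auto simp: inner_Basis if_distrib[of "\<lambda>c. c *\<^sub>R _"] cong: if_cong)
  then show "\<exists>v\<in>test_functions UNIV. dir_deriv b f = conv g v" using test_functions_dir_deriv[OF v b] by blast
qed (use v in blast)

lemma conv_nonzeroE:
  assumes "conv g v x \<noteq> 0" obtains y where "g y \<noteq> 0" "v (x - y) \<noteq> 0"
proof -
  have "\<exists>y. g y \<noteq> 0 \<and> v (x - y) \<noteq> 0"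
  proof (rule ccontr)
    assume "\<not> ?thesis"
    then have "(\<lambda>y. g y * v (x - y)) = (\<lambda>y. 0)" by auto
    then show False using assms by (simp add: conv_def)
  qed
  then show ?thesis using that by blast
qed

section \<open>Fourier transforms of integrable functions\<close>

definition ee :: "real \<Rightarrow> complex" where "ee s = exp (2 * of_real pi * \<i> * of_real s)"

lemma ee_eq_cis: "ee s = cis (2 * pi * s)"
  by (simp add: ee_def cis_conv_exp mult_ac)

lemma norm_ee [simp]: "norm (ee s) = 1" by (simp add: ee_eq_cis)
lemma ee_0 [simp]: "ee 0 = 1" by (simp add: ee_def)
lemma ee_add: "ee (a + b) = ee a * ee b" by (simp add: ee_def exp_add[symmetric] algebra_simps)
lemma cnj_ee: "cnj (ee s) = ee (- s)" by (simp add: ee_eq_cis cis_cnj)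
lemma continuous_on_ee [continuous_intros]: "continuous_on S f \<Longrightarrow> continuous_on S (\<lambda>x. ee (f x))"
  unfolding ee_def by (intro continuous_intros)
lemma borel_measurable_ee [measurable]: "ee \<in> borel_measurable borel"
  by (intro borel_measurable_continuous_onI continuous_intros)

lemma fourier_eq: "fourier f x = (\<integral>y. f y * ee (- (x \<bullet> y)) \<partial>lborel)"
  by (simp add: fourier_def ee_def)

lemma borel_measurable_fourier [measurable]:
  assumes [measurable]: "f \<in> borel_measurable borel"
  shows "fourier f \<in> borel_measurable borel"
proof -
  have "(\<lambda>x. \<integral>y. f y * ee (- (x \<bullet> y)) \<partial>lborel) \<in> borel_measurable borel"
    by (rule lborel.borel_measurable_lebesgue_integral) measurable
  then show ?thesis by (simp add: fourier_eq[abs_def])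
qed

lemma norm_fourier_le: "norm (fourier f x) \<le> (\<integral>y. norm (f y) \<partial>lborel)"
  unfolding fourier_eq by (rule order.trans[OF integral_norm_bound]) (simp add: norm_mult)

lemma fourier_cnj: "cnj (fourier f x) = fourier (\<lambda>y. cnj (f y)) (- x)"
proof -
  have "cnj (fourier f x) = (\<integral>y. cnj (f y * ee (- (x \<bullet> y))) \<partial>lborel)"
    unfolding fourier_eq by (rule Bochner_Integration.integral_cnj[symmetric])
  then show ?thesis by (simp add: fourier_eq cnj_ee)
qed

lemma integrable_mult_ee:
  fixes f :: "'a::euclidean_space \<Rightarrow> complex"
  assumes "integrable lborel f" and "g \<in> borel_measurable borel"
  shows "integrable lborel (\<lambda>y. f y * ee (g y))"
  using assms by (intro integrable_mult_bounded[where B=1]) auto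

lemma fourier_add:
  assumes "integrable lborel f" "integrable lborel g"
  shows "fourier (\<lambda>y. f y + g y) x = fourier f x + fourier g x"
  using assms unfolding fourier_eq by (simp add: ring_distribs integrable_mult_ee)

lemma fourier_cmult: "fourier (\<lambda>y. c * f y) x = c * fourier f x"
  unfolding fourier_eq by (simp add: mult.assoc)

lemma fourier_translate:
  assumes [measurable]: "f \<in> borel_measurable borel"
  shows "fourier (\<lambda>y. f (y - c)) x = fourier f x * ee (- (x \<bullet> c))"
proof -
  have "fourier (\<lambda>y. f (y - c)) x = (\<integral>y. f (y - c) * ee (- (x \<bullet> (y - c))) * ee (- (x \<bullet> c)) \<partial>lborel)"
    unfolding fourier_eq by (intro Bochner_Integration.integral_cong) (auto simp: ee_add[symmetric] inner_diff_right mult.assoc)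
  also have "\<dots> = (\<integral>y. f y * ee (- (x \<bullet> y)) * ee (- (x \<bullet> c)) \<partial>lborel)"
    by (rule integral_lborel_translate) measurable
  finally show ?thesis by (simp add: fourier_eq)
qed

lemma integrable_pair_mult_bounded:
  fixes a :: "'a::euclidean_space \<Rightarrow> complex" and b :: "'b::euclidean_space \<Rightarrow> complex"
  assumes a: "integrable lborel a" and b: "integrable lborel b"
    and w [measurable]: "(\<lambda>(x,y). w x y) \<in> borel_measurable (borel \<Otimes>\<^sub>M borel)" and B: "\<And>x y. norm (w x y) \<le> B"
  shows "integrable (lborel \<Otimes>\<^sub>M lborel) (\<lambda>(x, y). a x * b y * w x y)"
proof (rule integrableI_bounded)
  have [measurable]: "a \<in> borel_measurable borel" "b \<in> borel_measurable borel" using a b by auto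
  show meas: "(\<lambda>(x, y). a x * b y * w x y) \<in> borel_measurable (lborel \<Otimes>\<^sub>M lborel)" by measurable
  have "(\<integral>\<^sup>+ p. norm (case p of (x, y) \<Rightarrow> a x * b y * w x y) \<partial>(lborel \<Otimes>\<^sub>M lborel))
    = (\<integral>\<^sup>+x. \<integral>\<^sup>+y. norm (a x * b y * w x y) \<partial>lborel \<partial>lborel)"
    using meas by (subst lborel.nn_integral_fst[symmetric]) auto
  also have "\<dots> \<le> (\<integral>\<^sup>+x. \<integral>\<^sup>+y. ennreal B * (ennreal (norm (a x)) * ennreal (norm (b y))) \<partial>lborel \<partial>lborel)"
  proof (intro nn_integral_mono)
    fix x y
    have "norm (a x * b y * w x y) \<le> B * (norm (a x) * norm (b y))"
      using B[of x y] by (simp add: norm_mult mult.commute mult_right_mono)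
    then show "ennreal (norm (a x * b y * w x y)) \<le> ennreal B * (ennreal (norm (a x)) * ennreal (norm (b y)))"
      using order.trans[OF norm_ge_zero B] by (simp add: ennreal_mult[symmetric] ennreal_leI)
  qed
  also have "\<dots> = ennreal B * ((\<integral>\<^sup>+x. norm (a x) \<partial>lborel) * (\<integral>\<^sup>+y. norm (b y) \<partial>lborel))"
    by (simp add: nn_integral_cmult nn_integral_multc)
  also have "\<dots> < \<infinity>" using a b by (auto simp: integrable_iff_bounded ennreal_mult_less_top)
  finally show "(\<integral>\<^sup>+ p. norm (case p of (x, y) \<Rightarrow> a x * b y * w x y) \<partial>(lborel \<Otimes>\<^sub>M lborel)) < \<infinity>" .
qed

lemma Fubini_mult_bounded:
  fixes a :: "'a::euclidean_space \<Rightarrow> complex" and b :: "'b::euclidean_space \<Rightarrow> complex"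
  assumes a: "integrable lborel a" and b: "integrable lborel b"
    and w: "(\<lambda>(x,y). w x y) \<in> borel_measurable (borel \<Otimes>\<^sub>M borel)" and B: "\<And>x y. norm (w x y) \<le> B"
  shows "(\<integral>x. a x * (\<integral>y. b y * w x y \<partial>lborel) \<partial>lborel) = (\<integral>y. b y * (\<integral>x. a x * w x y \<partial>lborel) \<partial>lborel)"
    and "integrable lborel (\<lambda>x. a x * (\<integral>y. b y * w x y \<partial>lborel))"
proof -
  note int = integrable_pair_mult_bounded[OF assms]
  have "(\<integral>x. a x * (\<integral>y. b y * w x y \<partial>lborel) \<partial>lborel) = (\<integral>x. \<integral>y. a x * b y * w x y \<partial>lborel \<partial>lborel)"
    by (simp add: mult.assoc)
  also have "\<dots> = (\<integral>y. \<integral>x. a x * b y * w x y \<partial>lborel \<partial>lborel)"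
    using lborel_pair.Fubini_integral[OF int] by simp
  also have "\<dots> = (\<integral>y. \<integral>x. b y * (a x * w x y) \<partial>lborel \<partial>lborel)" by (simp add: mult_ac)
  finally show "(\<integral>x. a x * (\<integral>y. b y * w x y \<partial>lborel) \<partial>lborel) = (\<integral>y. b y * (\<integral>x. a x * w x y \<partial>lborel) \<partial>lborel)"
    by simp
  show "integrable lborel (\<lambda>x. a x * (\<integral>y. b y * w x y \<partial>lborel))"
    using lborel_pair.integrable_fst[OF int] by (simp add: mult.assoc)
qed

lemma fourier_conv:
  assumes f: "integrable lborel f" and g: "integrable lborel g" and B: "\<And>x. norm (g x) \<le> B"
  shows "fourier (conv f g) t = fourier f t * fourier g t" and "integrable lborel (conv f g)"
proof -
  have [measurable]: "f \<in> borel_measurable borel" "g \<in> borel_measurable borel" using f g by auto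
  \<comment> \<open>The weight \<open>w\<close> will be 1 for the integrability of the convolution
    and \<open>ee (- (t \<bullet> x))\<close> for its transform. The product is swapped because
    integrating over \<open>x\<close> first makes the inner integral of
    \<open>norm (g (x - y))\<close> independent of \<open>y\<close>.\<close>
  have int: "integrable (lborel \<Otimes>\<^sub>M lborel) (\<lambda>(x, y). f y * g (x - y) * w x)"
    if [measurable]: "w \<in> borel_measurable borel" and w: "\<And>x. norm (w x) \<le> 1" for w
  proof (subst lborel_pair.integrable_product_swap_iff[symmetric], rule integrableI_bounded)
    show "(\<lambda>(x, y). case (y, x) of (x, y) \<Rightarrow> f y * g (x - y) * w x) \<in> borel_measurable (lborel \<Otimes>\<^sub>M lborel)" by measurable
    have "(\<integral>\<^sup>+ p. norm (case p of (y, x) \<Rightarrow> f y * g (x - y) * w x) \<partial>(lborel \<Otimes>\<^sub>M lborel))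
      = (\<integral>\<^sup>+y. \<integral>\<^sup>+x. norm (f y * g (x - y) * w x) \<partial>lborel \<partial>lborel)"
      by (subst lborel.nn_integral_fst[symmetric]) auto
    also have "\<dots> \<le> (\<integral>\<^sup>+y. \<integral>\<^sup>+x. ennreal (norm (f y)) * ennreal (norm (g (x - y))) \<partial>lborel \<partial>lborel)"
      using w by (intro nn_integral_mono) (auto simp: norm_mult ennreal_mult[symmetric] intro!: ennreal_leI mult_left_le)
    also have "\<dots> = (\<integral>\<^sup>+y. ennreal (norm (f y)) * (\<integral>\<^sup>+x. ennreal (norm (g x)) \<partial>lborel) \<partial>lborel)"
      by (simp add: nn_integral_cmult nn_integral_lborel_translate[of "\<lambda>x. ennreal (norm (g x))"])
    also have "\<dots> = (\<integral>\<^sup>+y. ennreal (norm (f y)) \<partial>lborel) * (\<integral>\<^sup>+x. ennreal (norm (g x)) \<partial>lborel)"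
      by (simp add: nn_integral_multc)
    also have "\<dots> < \<infinity>" using f g by (auto simp: integrable_iff_bounded ennreal_mult_less_top)
    finally show "(\<integral>\<^sup>+ p. norm (case p of (x, y) \<Rightarrow> case (y, x) of (x, y) \<Rightarrow> f y * g (x - y) * w x) \<partial>(lborel \<Otimes>\<^sub>M lborel)) < \<infinity>"
      by (simp add: case_prod_beta)
  qed
  have "integrable lborel (\<lambda>x. \<integral>y. f y * g (x - y) * 1 \<partial>lborel)"
    by (rule lborel_pair.integrable_fst[OF int]) auto
  then show "integrable lborel (conv f g)" by (simp add: conv_def[abs_def])
  have "fourier (conv f g) t = (\<integral>x. \<integral>y. f y * g (x - y) * ee (- (t \<bullet> x)) \<partial>lborel \<partial>lborel)"
    by (simp add: fourier_eq conv_def)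
  also have "\<dots> = (\<integral>y. \<integral>x. f y * g (x - y) * ee (- (t \<bullet> x)) \<partial>lborel \<partial>lborel)"
    by (rule lborel_pair.Fubini_integral[symmetric]) (use int[of "\<lambda>x. ee (- (t \<bullet> x))"] in simp)
  also have "\<dots> = (\<integral>y. f y * fourier (\<lambda>x. g (x - y)) t \<partial>lborel)"
    by (simp add: fourier_eq mult.assoc)
  also have "\<dots> = (\<integral>y. f y * ee (- (t \<bullet> y)) * fourier g t \<partial>lborel)"
    by (simp add: fourier_translate mult_ac)
  finally show "fourier (conv f g) t = fourier f t * fourier g t" by (simp add: fourier_eq)
qed

section \<open>Gaussian multipliers and kernels\<close>

lemma
  fixes f :: "'a::euclidean_space \<Rightarrow> real \<Rightarrow> 'b::{real_normed_field,banach,second_countable_topology}"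
  assumes f: "\<And>b. b \<in> Basis \<Longrightarrow> integrable lborel (f b)"
  shows integral_lborel_Basis_prod: "(\<integral>x. (\<Prod>b\<in>Basis. f b (x \<bullet> b)) \<partial>lborel) = (\<Prod>b\<in>Basis. (\<integral>s. f b s \<partial>lborel))"
    and integrable_lborel_Basis_prod: "integrable lborel (\<lambda>x. \<Prod>b\<in>Basis. f b (x \<bullet> b))"
proof -
  interpret product_sigma_finite "\<lambda>_::'a. lborel :: real measure" by standard
  have [measurable]: "f b \<in> borel_measurable borel" if "b \<in> Basis" for b using f[OF that] by auto
  have eq: "(\<Prod>b\<in>Basis. f b ((\<Sum>c\<in>Basis. x c *\<^sub>R c) \<bullet> b)) = (\<Prod>b\<in>Basis. f b (x b))" for x
    by (intro prod.cong) (auto simp: inner_sum_left inner_Basis if_distrib cong: if_cong)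
  have m: "(\<lambda>x. \<Prod>b\<in>Basis. f b (x \<bullet> b)) \<in> borel_measurable borel"
    by (intro borel_measurable_prod) measurable
  show "(\<integral>x. (\<Prod>b\<in>Basis. f b (x \<bullet> b)) \<partial>lborel) = (\<Prod>b\<in>Basis. (\<integral>s. f b s \<partial>lborel))"
    by (subst lborel_eq, subst integral_distr[OF _ m], measurable)
       (simp add: eq product_integral_prod f)
  have "integrable (distr (\<Pi>\<^sub>M b\<in>Basis. lborel) borel (\<lambda>f. \<Sum>b\<in>Basis. f b *\<^sub>R b)) (\<lambda>x. \<Prod>b\<in>Basis. f b (x \<bullet> b))"
    by (subst integrable_distr_eq[OF _ m], measurable) (simp add: eq product_integrable_prod f)
  then show "integrable lborel (\<lambda>x. \<Prod>b\<in>Basis. f b (x \<bullet> b))" by (subst lborel_eq)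
qed

text \<open>This is the characteristic function of independent centred normal variables of standard
  deviation \<open>r\<close>, taken at \<open>2 * pi * t\<close>; \<open>gauss_kernel r\<close> is
  their density. Both are products over \<open>Basis\<close>, so that the transform of one into the
  other reduces to the line.\<close>

definition gauss_mult :: "real \<Rightarrow> 'a::euclidean_space \<Rightarrow> real" where
  "gauss_mult r t = (\<Prod>b\<in>Basis. exp (- 2 * (pi * r * (t \<bullet> b))\<^sup>2))"

definition gauss_kernel :: "real \<Rightarrow> 'a::euclidean_space \<Rightarrow> real" where
  "gauss_kernel r x = (\<Prod>b\<in>Basis. normal_density 0 r (x \<bullet> b))"

lemma gauss_mult_bounds: "0 < gauss_mult r t" "gauss_mult r t \<le> 1"
  unfolding gauss_mult_def by (auto intro!: prod_pos prod_le_1)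

lemma gauss_kernel_nonneg: "0 \<le> gauss_kernel r x"
  unfolding gauss_kernel_def by (intro prod_nonneg) auto

lemma gauss_kernel_minus: "gauss_kernel r (- x) = gauss_kernel r x"
  by (simp add: gauss_kernel_def normal_density_def)

lemma gauss_measurable [measurable]: "gauss_mult r \<in> borel_measurable borel" "gauss_kernel r \<in> borel_measurable borel"
  unfolding gauss_mult_def[abs_def] gauss_kernel_def[abs_def] by (intro borel_measurable_prod; measurable)+

lemma
  assumes "r > 0"
  shows integrable_gauss_kernel: "integrable lborel (gauss_kernel r :: 'a::euclidean_space \<Rightarrow> real)"
    and integral_gauss_kernel: "(\<integral>x. gauss_kernel r (x::'a) \<partial>lborel) = 1"
  using assms unfolding gauss_kernel_def[abs_def]
  by (auto intro!: integrable_lborel_Basis_prod simp: integral_lborel_Basis_prod[where f="\<lambda>_. normal_density 0 r"])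

lemma gauss_fourier_1D:
  assumes "r > 0"
  shows "integrable lborel (\<lambda>s. complex_of_real (exp (- 2 * (pi * r * s)\<^sup>2)) * ee (s * x))"
    and "(\<integral>s. complex_of_real (exp (- 2 * (pi * r * s)\<^sup>2)) * ee (s * x) \<partial>lborel) = of_real (normal_density 0 r x)"
proof -
  \<comment> \<open>With this scale the exponent \<open>- (c * s)\<^sup>2 / 2\<close> of the
    standard normal density becomes \<open>- 2 * (pi * r * s)\<^sup>2\<close>, and frequency
    \<open>x / c\<close> corresponds to the argument \<open>x / r\<close> of the characteristic
    function.\<close>
  define c where "c = 2 * pi * r"
  have c: "c > 0" using assms by (simp add: c_def)
  have int0: "integrable lborel (\<lambda>s. complex_of_real (std_normal_density s))" by simp
  have int: "integrable lborel (\<lambda>s. complex_of_real (std_normal_density s) * ee (s * (x / c)))"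
    using int0 by (intro integrable_mult_ee) measurable
  have eq: "complex_of_real (std_normal_density (0 + c * s)) * ee ((0 + c * s) * (x / c))
      = of_real (1 / sqrt (2 * pi)) * (complex_of_real (exp (- 2 * (pi * r * s)\<^sup>2)) * ee (s * x))" for s
    using c assms by (simp add: std_normal_density_def c_def power_mult_distrib)
  have "integrable lborel (\<lambda>s. complex_of_real (1 / sqrt (2 * pi)) * (complex_of_real (exp (- 2 * (pi * r * s)\<^sup>2)) * ee (s * x)))"
    using lborel_integrable_real_affine[OF int, of c 0] c unfolding eq by simp
  then have "integrable lborel (\<lambda>s. of_real (sqrt (2 * pi)) * (complex_of_real (1 / sqrt (2 * pi)) * (complex_of_real (exp (- 2 * (pi * r * s)\<^sup>2)) * ee (s * x))))"
    by (rule integrable_mult_right)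
  then show "integrable lborel (\<lambda>s. complex_of_real (exp (- 2 * (pi * r * s)\<^sup>2)) * ee (s * x))" by simp
  have "(\<integral>s. complex_of_real (std_normal_density s) * ee (s * (x / c)) \<partial>lborel) = char std_normal_distribution (x / r)"
    unfolding char_def using c
    by (subst integral_density) (auto simp: normal_density_nonneg scaleR_conv_of_real ee_def c_def mult_ac intro!: Bochner_Integration.integral_cong)
  also have "\<dots> = exp (- ((x / r)\<^sup>2) / 2)" by (simp add: char_std_normal_distribution exp_of_real[symmetric])
  finally have "complex_of_real (exp (- ((x / r)\<^sup>2) / 2)) = c *\<^sub>R (\<integral>s. complex_of_real (std_normal_density (0 + c * s)) * ee ((0 + c * s) * (x / c)) \<partial>lborel)"
    using lborel_integral_real_affine[of c "\<lambda>s. complex_of_real (std_normal_density s) * ee (s * (x / c))" 0] c by simp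
  also have "\<dots> = of_real (c / sqrt (2 * pi)) * (\<integral>s. complex_of_real (exp (- 2 * (pi * r * s)\<^sup>2)) * ee (s * x) \<partial>lborel)"
    unfolding eq integral_mult_right_zero by (simp add: scaleR_conv_of_real)
  finally have *: "complex_of_real (exp (- ((x / r)\<^sup>2) / 2)) = of_real (c / sqrt (2 * pi)) * (\<integral>s. complex_of_real (exp (- 2 * (pi * r * s)\<^sup>2)) * ee (s * x) \<partial>lborel)" .
  have "(\<integral>s. complex_of_real (exp (- 2 * (pi * r * s)\<^sup>2)) * ee (s * x) \<partial>lborel) = of_real (sqrt (2 * pi) / c) * complex_of_real (exp (- ((x / r)\<^sup>2) / 2))"
    unfolding * using c by simp
  also have "\<dots> = of_real (sqrt (2 * pi) / c * exp (- ((x / r)\<^sup>2) / 2))" by simp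
  also have "sqrt (2 * pi) / c * exp (- ((x / r)\<^sup>2) / 2) = normal_density 0 r x"
  proof -
    have "sqrt (2 * pi) / c = 1 / (sqrt (2 * pi) * r)"
      using assms real_sqrt_mult_self[of "2 * pi"] by (simp add: c_def field_simps)
    then show ?thesis using assms by (simp add: normal_density_def real_sqrt_mult power_divide field_simps)
  qed
  finally show "(\<integral>s. complex_of_real (exp (- 2 * (pi * r * s)\<^sup>2)) * ee (s * x) \<partial>lborel) = of_real (normal_density 0 r x)" .
qed

lemma ee_sum: "finite I \<Longrightarrow> ee (\<Sum>i\<in>I. f i) = (\<Prod>i\<in>I. ee (f i))"
  by (induction rule: finite_induct) (auto simp: ee_add)

lemma gauss_fourier:
  assumes "r > 0"
  shows "integrable lborel (\<lambda>t. complex_of_real (gauss_mult r t) * ee (t \<bullet> x))"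
    and "(\<integral>t. complex_of_real (gauss_mult r t) * ee (t \<bullet> x) \<partial>lborel) = of_real (gauss_kernel r x)"
proof -
  have eq: "complex_of_real (gauss_mult r t) * ee (t \<bullet> x)
      = (\<Prod>b\<in>Basis. complex_of_real (exp (- 2 * (pi * r * (t \<bullet> b))\<^sup>2)) * ee ((t \<bullet> b) * (x \<bullet> b)))" for t
    by (subst euclidean_inner) (simp add: ee_sum gauss_mult_def prod.distrib)
  show "integrable lborel (\<lambda>t. complex_of_real (gauss_mult r t) * ee (t \<bullet> x))"
    unfolding eq by (rule integrable_lborel_Basis_prod) (rule gauss_fourier_1D[OF assms])
  show "(\<integral>t. complex_of_real (gauss_mult r t) * ee (t \<bullet> x) \<partial>lborel) = of_real (gauss_kernel r x)"
    unfolding eq gauss_kernel_def of_real_prod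
    by (subst integral_lborel_Basis_prod) (use gauss_fourier_1D[OF assms] in auto)
qed

lemma integrable_gauss_mult: "r > 0 \<Longrightarrow> integrable lborel (\<lambda>t. complex_of_real (gauss_mult r t))"
  using gauss_fourier(1)[of r 0] by simp

section \<open>Plancherel inequality\<close>

lemma L2D: "f \<in> L2 \<Longrightarrow> f \<in> borel_measurable borel"
  by (simp add: L2_def)

lemma L2_iff_nn_integral:
  "f \<in> L2 \<longleftrightarrow> f \<in> borel_measurable borel \<and> (\<integral>\<^sup>+x. ennreal ((norm (f x))\<^sup>2) \<partial>lborel) < \<infinity>"
  unfolding L2_def by (auto simp: integrable_iff_bounded)

lemma L2_norm_nonneg: "0 \<le> L2_norm f"
  by (simp add: L2_norm_def)

lemma L2_norm_power2: "(L2_norm f)\<^sup>2 = (\<integral>x. (norm (f x))\<^sup>2 \<partial>lborel)"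
  by (simp add: L2_norm_def)

lemma nn_integral_L2: "f \<in> L2 \<Longrightarrow> (\<integral>\<^sup>+x. ennreal ((norm (f x))\<^sup>2) \<partial>lborel) = ennreal ((L2_norm f)\<^sup>2)"
  unfolding L2_norm_power2 by (rule nn_integral_eq_integral) (auto simp: L2_def)

lemma L2_norm_leI:
  assumes "f \<in> borel_measurable borel" "(\<integral>\<^sup>+x. ennreal ((norm (f x))\<^sup>2) \<partial>lborel) \<le> ennreal (M\<^sup>2)" "M \<ge> 0"
  shows "f \<in> L2" "L2_norm f \<le> M"
proof -
  show *: "f \<in> L2" using assms le_less_trans[OF assms(2)] by (simp add: L2_iff_nn_integral)
  then have "ennreal ((L2_norm f)\<^sup>2) \<le> ennreal (M\<^sup>2)" using assms nn_integral_L2[OF *] by simp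
  then have "(L2_norm f)\<^sup>2 \<le> M\<^sup>2" by simp
  then show "L2_norm f \<le> M" using assms(3) by (rule power2_le_imp_le)
qed

lemma borel_measurable_cnj [measurable]: "cnj \<in> borel_measurable borel"
  by (intro borel_measurable_continuous_onI continuous_intros)

lemma L2_add: assumes "f \<in> L2" "g \<in> L2" shows "(\<lambda>x. f x + g x) \<in> L2"
proof -
  note [measurable] = L2D[OF assms(1)] L2D[OF assms(2)]
  have "integrable lborel (\<lambda>x. 2 * (norm (f x))\<^sup>2 + 2 * (norm (g x))\<^sup>2)" using assms by (simp add: L2_def)
  then have "integrable lborel (\<lambda>x. (norm (f x + g x))\<^sup>2)"
  proof (rule Bochner_Integration.integrable_bound)
    show "AE x in lborel. norm ((norm (f x + g x))\<^sup>2) \<le> norm (2 * (norm (f x))\<^sup>2 + 2 * (norm (g x))\<^sup>2)"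
    proof (intro AE_I2)
      fix x
      have "(norm (f x + g x))\<^sup>2 \<le> (norm (f x) + norm (g x))\<^sup>2" by (intro power_mono norm_triangle_ineq) simp
      also have "\<dots> \<le> 2 * (norm (f x))\<^sup>2 + 2 * (norm (g x))\<^sup>2"
        using sum_squares_bound[of "norm (f x)" "norm (g x)"] by (simp add: power2_sum)
      finally show "norm ((norm (f x + g x))\<^sup>2) \<le> norm (2 * (norm (f x))\<^sup>2 + 2 * (norm (g x))\<^sup>2)" by simp
    qed
  qed measurable
  then show ?thesis by (simp add: L2_def)
qed

lemma L2_cmult: assumes "f \<in> L2" shows "(\<lambda>x. c * f x) \<in> L2" "L2_norm (\<lambda>x. c * f x) = norm c * L2_norm f"
  using assms by (auto simp: L2_def L2_norm_def norm_mult power_mult_distrib real_sqrt_mult)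

lemma L2_mult_integrable:
  assumes "f \<in> L2" "g \<in> L2"
  shows "integrable lborel (\<lambda>x. f x * g x)"
proof -
  note [measurable] = L2D[OF assms(1)] L2D[OF assms(2)]
  have "integrable lborel (\<lambda>x. (norm (f x))\<^sup>2 + (norm (g x))\<^sup>2)" using assms by (simp add: L2_def)
  then show ?thesis
  proof (rule Bochner_Integration.integrable_bound)
    show "AE x in lborel. norm (f x * g x) \<le> norm ((norm (f x))\<^sup>2 + (norm (g x))\<^sup>2)"
    proof (intro AE_I2)
      fix x
      have "norm (f x) * norm (g x) \<le> 2 * norm (f x) * norm (g x)" by simp
      also have "\<dots> \<le> (norm (f x))\<^sup>2 + (norm (g x))\<^sup>2" by (rule sum_squares_bound)
      finally show "norm (f x * g x) \<le> norm ((norm (f x))\<^sup>2 + (norm (g x))\<^sup>2)" by (simp add: norm_mult)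
    qed
  qed measurable
qed

lemma L2_Cauchy_Schwarz:
  assumes "f \<in> L2" "g \<in> L2"
  shows "(\<integral>x. norm (f x * g x) \<partial>lborel) \<le> L2_norm f * L2_norm g"
proof -
  have *: "(\<integral>x. norm (f x * g x) \<partial>lborel) \<le> (s * a)\<^sup>2 / 2 + (b / s)\<^sup>2 / 2"
    if "s > 0" "a = L2_norm f" "b = L2_norm g" for s a b
  proof -
    have "(\<integral>x. norm (f x * g x) \<partial>lborel) \<le> (\<integral>x. s\<^sup>2 / 2 * (norm (f x))\<^sup>2 + 1 / (2 * s\<^sup>2) * (norm (g x))\<^sup>2 \<partial>lborel)"
    proof (rule integral_mono)
      show "integrable lborel (\<lambda>x. norm (f x * g x))" using L2_mult_integrable[OF assms] by simp
      show "integrable lborel (\<lambda>x. s\<^sup>2 / 2 * (norm (f x))\<^sup>2 + 1 / (2 * s\<^sup>2) * (norm (g x))\<^sup>2)"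
        using assms by (simp add: L2_def)
      fix x
      show "norm (f x * g x) \<le> s\<^sup>2 / 2 * (norm (f x))\<^sup>2 + 1 / (2 * s\<^sup>2) * (norm (g x))\<^sup>2"
        using sum_squares_bound[of "s * norm (f x)" "norm (g x) / s"] \<open>s > 0\<close>
        by (simp add: norm_mult power_mult_distrib power_divide)
    qed
    also have "\<dots> = (s * a)\<^sup>2 / 2 + (b / s)\<^sup>2 / 2"
      using assms that(1) by (simp add: L2_def power_mult_distrib power_divide L2_norm_power2 that(2,3))
    finally show ?thesis .
  qed
  define a b where "a = L2_norm f" and "b = L2_norm g"
  have ab: "a \<ge> 0" "b \<ge> 0" by (simp_all add: a_def b_def L2_norm_nonneg)
  have "(\<integral>x. norm (f x * g x) \<partial>lborel) \<le> (a + e) * (b + e)" if "e > 0" for e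
  proof -
    \<comment> \<open>The weight that makes both halves of the arithmetic-geometric mean bound equal
      when the norms are replaced by \<open>a + e\<close> and \<open>b + e\<close>. The positive
      \<open>e\<close> keeps the quotient meaningful if one norm is 0.\<close>
    define s where "s = sqrt ((b + e) / (a + e))"
    have s: "s > 0" "s\<^sup>2 = (b + e) / (a + e)" using ab \<open>e > 0\<close> by (auto simp: s_def)
    have "(s * a)\<^sup>2 \<le> s\<^sup>2 * (a + e)\<^sup>2" "(b / s)\<^sup>2 \<le> (b + e)\<^sup>2 / s\<^sup>2"
      using ab \<open>e > 0\<close> by (auto simp: power_mult_distrib power_divide intro!: mult_left_mono divide_right_mono power_mono)
    moreover have "s\<^sup>2 * (a + e)\<^sup>2 = (a + e) * (b + e)" "(b + e)\<^sup>2 / s\<^sup>2 = (a + e) * (b + e)"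
      unfolding s(2) using ab \<open>e > 0\<close> by (auto simp: power2_eq_square field_simps)
    ultimately show ?thesis using *[OF s(1) a_def b_def] by linarith
  qed
  note eps = this
  show ?thesis
  proof (rule field_le_epsilon)
    fix d :: real assume "d > 0"
    \<comment> \<open>\<open>e \<le> 1\<close> bounds the quadratic term \<open>e * e\<close> by
      \<open>e\<close>, so the product exceeds \<open>a * b\<close> by at most
      \<open>e * (a + b + 1)\<close>, and the second entry of the minimum makes this at most
      \<open>d\<close>.\<close>
    define e where "e = min 1 (d / (a + b + 1))"
    have e: "0 < e" "e \<le> 1" "e \<le> d / (a + b + 1)" using ab \<open>d > 0\<close> by (auto simp: e_def)
    then have e3: "e * (a + b + 1) \<le> d" using ab by (simp add: pos_le_divide_eq)
    have "(a + e) * (b + e) = a * b + e * (a + b + e)" by (simp add: algebra_simps)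
    also have "\<dots> \<le> a * b + e * (a + b + 1)" using e ab by (intro add_left_mono mult_left_mono) auto
    finally show "(\<integral>x. norm (f x * g x) \<partial>lborel) \<le> L2_norm f * L2_norm g + d"
      using eps[OF e(1)] e3 by (simp add: a_def b_def)
  qed
qed

text \<open>The Bochner integral of a non-integrable function is 0, so the bound survives without an
  integrability assumption.\<close>

lemma integral_norm_bound_ennreal':
  fixes f :: "'a \<Rightarrow> 'b::{banach, second_countable_topology}"
  shows "ennreal (norm (\<integral>x. f x \<partial>M)) \<le> (\<integral>\<^sup>+x. ennreal (norm (f x)) \<partial>M)"
  by (cases "integrable M f") (auto simp: integral_norm_bound_ennreal not_integrable_integral_eq)

text \<open>Regularised Fourier inversion. The Gaussian factor makes the double integral absolutely
  convergent even if \<open>fourier f\<close> is not integrable; after Fubini the integral over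
  \<open>t\<close> is the Gaussian kernel at \<open>x - y\<close>.\<close>

lemma fourier_gauss_mult:
  assumes "r > 0" and f: "integrable lborel f"
  shows "(\<integral>t. fourier f t * ee (t \<bullet> x) * of_real (gauss_mult r t) \<partial>lborel) = (\<integral>y. f y * of_real (gauss_kernel r (x - y)) \<partial>lborel)"
proof -
  have [measurable]: "f \<in> borel_measurable borel" using f by auto
  have "(\<integral>t. fourier f t * ee (t \<bullet> x) * of_real (gauss_mult r t) \<partial>lborel)
      = (\<integral>t. of_real (gauss_mult r t) * (\<integral>y. f y * (ee (- (t \<bullet> y)) * ee (t \<bullet> x)) \<partial>lborel) \<partial>lborel)"
  proof (intro Bochner_Integration.integral_cong refl)
    fix t
    have "(\<integral>y. f y * (ee (- (t \<bullet> y)) * ee (t \<bullet> x)) \<partial>lborel) = (\<integral>y. f y * ee (- (t \<bullet> y)) * ee (t \<bullet> x) \<partial>lborel)"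
      by (simp only: mult.assoc)
    also have "\<dots> = fourier f t * ee (t \<bullet> x)" unfolding fourier_eq by (rule integral_mult_left_zero)
    finally show "fourier f t * ee (t \<bullet> x) * of_real (gauss_mult r t)
      = of_real (gauss_mult r t) * (\<integral>y. f y * (ee (- (t \<bullet> y)) * ee (t \<bullet> x)) \<partial>lborel)"
      by (simp only: mult.commute)
  qed
  also have "\<dots> = (\<integral>y. f y * (\<integral>t. of_real (gauss_mult r t) * (ee (- (t \<bullet> y)) * ee (t \<bullet> x)) \<partial>lborel) \<partial>lborel)"
    by (rule Fubini_mult_bounded(1)[OF integrable_gauss_mult[OF \<open>r > 0\<close>] f, where B=1]) (measurable, simp add: norm_mult)
  also have "\<dots> = (\<integral>y. f y * (\<integral>t. of_real (gauss_mult r t) * ee (t \<bullet> (x - y)) \<partial>lborel) \<partial>lborel)"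
    by (simp add: ee_add[symmetric] inner_diff_right)
  finally show ?thesis by (simp only: gauss_fourier[OF \<open>r > 0\<close>])
qed

lemma integrable_mult_fourier:
  assumes k: "integrable lborel k" and f: "integrable lborel f"
  shows "integrable lborel (\<lambda>t. k t * fourier f t)"
  using k f by (intro integrable_mult_bounded[where B="\<integral>y. norm (f y) \<partial>lborel"] norm_fourier_le) auto

text \<open>A regularised Parseval identity. With \<open>G\<close> the conjugate of \<open>f\<close>
  it drives \<open>plancherel_le\<close>; letting the width go to 0 it becomes
  \<open>fourier_pairing\<close>.\<close>

lemma fourier_pairing_gauss:
  assumes "r > 0" and f: "integrable lborel f" and G: "integrable lborel G"
  shows "(\<integral>t. fourier G (- t) * fourier f t * of_real (gauss_mult r t) \<partial>lborel)
       = (\<integral>x. G x * (\<integral>y. f y * of_real (gauss_kernel r (x - y)) \<partial>lborel) \<partial>lborel)"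
proof -
  have [measurable]: "f \<in> borel_measurable borel" "G \<in> borel_measurable borel" using f G by auto
  have "(\<integral>t. fourier G (- t) * fourier f t * of_real (gauss_mult r t) \<partial>lborel)
      = (\<integral>t. (of_real (gauss_mult r t) * fourier f t) * (\<integral>x. G x * ee (t \<bullet> x) \<partial>lborel) \<partial>lborel)"
  proof (intro Bochner_Integration.integral_cong refl)
    fix t
    have "fourier G (- t) = (\<integral>x. G x * ee (t \<bullet> x) \<partial>lborel)" by (simp add: fourier_eq)
    then show "fourier G (- t) * fourier f t * of_real (gauss_mult r t)
      = (of_real (gauss_mult r t) * fourier f t) * (\<integral>x. G x * ee (t \<bullet> x) \<partial>lborel)"
      by (simp only: mult_ac)
  qed
  also have "\<dots> = (\<integral>x. G x * (\<integral>t. (of_real (gauss_mult r t) * fourier f t) * ee (t \<bullet> x) \<partial>lborel) \<partial>lborel)"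
    by (rule Fubini_mult_bounded(1)[OF integrable_mult_fourier[OF integrable_gauss_mult[OF \<open>r > 0\<close>] f] G, where B=1]) auto
  also have "\<dots> = (\<integral>x. G x * (\<integral>t. fourier f t * ee (t \<bullet> x) * of_real (gauss_mult r t) \<partial>lborel) \<partial>lborel)"
    by (simp only: mult_ac)
  finally show ?thesis by (simp only: fourier_gauss_mult[OF assms(1,2)])
qed

lemma nn_integral_gauss_kernel: "r > 0 \<Longrightarrow> (\<integral>\<^sup>+y. ennreal (gauss_kernel r (x - y)) \<partial>lborel) = 1"
  by (subst nn_integral_lborel_reflect[of "\<lambda>y. ennreal (gauss_kernel r y)"], measurable)
     (simp add: nn_integral_eq_integral integrable_gauss_kernel integral_gauss_kernel gauss_kernel_nonneg)

text \<open>Schur's test: the product of the two values of \<open>norm f\<close> is at most half the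
  sum of their squares, and the kernel is symmetric with integral 1 in each variable, so each half
  contributes half of the squared norm.\<close>

lemma gauss_kernel_form_le:
  assumes "r > 0" and f: "f \<in> L2"
  shows "(\<integral>\<^sup>+x. \<integral>\<^sup>+y. ennreal (norm (f x) * norm (f y) * gauss_kernel r (x - y)) \<partial>lborel \<partial>lborel) \<le> ennreal ((L2_norm f)\<^sup>2)"
proof -
  note [measurable] = L2D[OF f]
  define q where "q = (\<lambda>x. ennreal ((norm (f x))\<^sup>2 / 2))"
  have [measurable]: "q \<in> borel_measurable borel" unfolding q_def by measurable
  define k where "k = (\<lambda>x::'a. ennreal (gauss_kernel r x))"
  have [measurable]: "k \<in> borel_measurable borel" unfolding k_def by measurable
  have k1: "(\<integral>\<^sup>+y. k (x - y) \<partial>lborel) = 1" for x unfolding k_def by (rule nn_integral_gauss_kernel[OF \<open>r > 0\<close>])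
  have k2: "k (x - y) = k (y - x)" for x y
    unfolding k_def using gauss_kernel_minus[of r "y - x"] by simp
  have "(\<integral>\<^sup>+x. \<integral>\<^sup>+y. ennreal (norm (f x) * norm (f y) * gauss_kernel r (x - y)) \<partial>lborel \<partial>lborel)
    \<le> (\<integral>\<^sup>+x. \<integral>\<^sup>+y. q x * k (x - y) + q y * k (x - y) \<partial>lborel \<partial>lborel)"
  proof (intro nn_integral_mono)
    fix x y
    have "norm (f x) * norm (f y) \<le> (norm (f x))\<^sup>2 / 2 + (norm (f y))\<^sup>2 / 2"
      using sum_squares_bound[of "norm (f x)" "norm (f y)"] by simp
    then have "norm (f x) * norm (f y) * gauss_kernel r (x - y) \<le> ((norm (f x))\<^sup>2 / 2 + (norm (f y))\<^sup>2 / 2) * gauss_kernel r (x - y)"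
      by (rule mult_right_mono) (rule gauss_kernel_nonneg)
    then show "ennreal (norm (f x) * norm (f y) * gauss_kernel r (x - y)) \<le> q x * k (x - y) + q y * k (x - y)"
      unfolding q_def k_def distrib_right[symmetric]
      by (subst ennreal_plus[symmetric], simp, simp, subst ennreal_mult[symmetric]) (auto intro!: ennreal_leI gauss_kernel_nonneg)
  qed
  also have "\<dots> = (\<integral>\<^sup>+x. \<integral>\<^sup>+y. q x * k (x - y) \<partial>lborel \<partial>lborel) + (\<integral>\<^sup>+x. \<integral>\<^sup>+y. q y * k (x - y) \<partial>lborel \<partial>lborel)"
    by (subst nn_integral_add, measurable, subst nn_integral_add, measurable)
  also have "(\<integral>\<^sup>+x. \<integral>\<^sup>+y. q y * k (x - y) \<partial>lborel \<partial>lborel) = (\<integral>\<^sup>+y. \<integral>\<^sup>+x. q y * k (x - y) \<partial>lborel \<partial>lborel)"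
    by (rule lborel_pair.Fubini') measurable
  also have "\<dots> = (\<integral>\<^sup>+y. \<integral>\<^sup>+x. q y * k (y - x) \<partial>lborel \<partial>lborel)" by (subst k2) (rule refl)
  also have "(\<integral>\<^sup>+x. \<integral>\<^sup>+y. q x * k (x - y) \<partial>lborel \<partial>lborel) = (\<integral>\<^sup>+x. q x \<partial>lborel)"
    by (simp add: nn_integral_cmult k1)
  also have "(\<integral>\<^sup>+x. q x \<partial>lborel) + (\<integral>\<^sup>+x. q x \<partial>lborel) = (\<integral>\<^sup>+x. ennreal ((norm (f x))\<^sup>2) \<partial>lborel)"
    by (subst nn_integral_add[symmetric]) (auto simp: q_def ennreal_plus[symmetric] simp del: ennreal_plus)
  finally show ?thesis by (simp add: nn_integral_L2[OF f])
qed

lemma gauss_mult_tendsto: "(\<lambda>n. gauss_mult (1 / real (Suc n)) t) \<longlonglongrightarrow> 1"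
proof -
  have "(\<lambda>n. 1 / real (Suc n)) \<longlonglongrightarrow> 0" by (rule LIMSEQ_Suc) (rule lim_1_over_n)
  then have "(\<lambda>n. \<Prod>b\<in>Basis. exp (- 2 * (pi * (1 / real (Suc n)) * (t \<bullet> b))\<^sup>2)) \<longlonglongrightarrow> (\<Prod>b\<in>(Basis::'a set). exp (- 2 * (pi * 0 * (t \<bullet> b))\<^sup>2))"
    by (intro tendsto_intros)
  then show ?thesis by (simp add: gauss_mult_def)
qed

text \<open>The square of \<open>norm (fourier f t)\<close> is
  \<open>fourier (\<lambda>y. cnj (f y)) (- t) * fourier f t\<close>. With the Gaussian factor, its
  integral is the quadratic form bounded in \<open>gauss_kernel_form_le\<close>, uniformly in the
  width; Fatou's lemma removes the factor.\<close>

theorem plancherel_le: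
  fixes f :: "'a::euclidean_space \<Rightarrow> complex"
  assumes f: "integrable lborel f" and f2: "f \<in> L2"
  shows "fourier f \<in> L2" and "L2_norm (fourier f) \<le> L2_norm f"
proof -
  note [measurable] = L2D[OF f2]
  define r where "r = (\<lambda>n. 1 / real (Suc n))"
  have r: "r n > 0" for n by (simp add: r_def)
  define A where "A = (\<lambda>n t. (norm (fourier f t))\<^sup>2 * gauss_mult (r n) t)"
  have A_int: "integrable lborel (A n)" for n
  proof -
    have [measurable]: "(\<lambda>t. cnj (fourier f t)) \<in> borel_measurable borel" by measurable
    have "integrable lborel (\<lambda>t. (complex_of_real (gauss_mult (r n) t) * fourier f t) * cnj (fourier f t))"
      by (rule integrable_mult_bounded(1)[OF integrable_mult_fourier[OF integrable_gauss_mult[OF r] f], where B="\<integral>y. norm (f y) \<partial>lborel"])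
         (auto simp: norm_fourier_le)
    moreover have "complex_of_real (A n t) = (complex_of_real (gauss_mult (r n) t) * fourier f t) * cnj (fourier f t)" for t
      unfolding A_def of_real_mult complex_norm_square by (simp only: mult_ac)
    ultimately have "integrable lborel (\<lambda>t. complex_of_real (A n t))" by simp
    then show ?thesis by (subst (asm) complex_of_real_integrable_eq)
  qed
  have A_le: "(\<integral>\<^sup>+t. ennreal (A n t) \<partial>lborel) \<le> ennreal ((L2_norm f)\<^sup>2)" for n
  proof -
    have A0: "A n t \<ge> 0" for t unfolding A_def using gauss_mult_bounds(1)[of "r n" t] by simp
    have c: "integrable lborel (\<lambda>y. cnj (f y))" using f by simp
    have "(\<integral>\<^sup>+t. ennreal (A n t) \<partial>lborel) = ennreal (\<integral>t. A n t \<partial>lborel)"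
      using A_int A0 by (intro nn_integral_eq_integral) auto
    also have "(\<integral>t. A n t \<partial>lborel) = norm (complex_of_real (\<integral>t. A n t \<partial>lborel))"
      using A0 by (simp add: Bochner_Integration.integral_nonneg)
    also have "complex_of_real (\<integral>t. A n t \<partial>lborel) = (\<integral>t. complex_of_real (A n t) \<partial>lborel)"
      by (rule integral_complex_of_real[symmetric])
    also have "\<dots> = (\<integral>t. fourier (\<lambda>y. cnj (f y)) (- t) * fourier f t * of_real (gauss_mult (r n) t) \<partial>lborel)"
      unfolding A_def of_real_mult complex_norm_square fourier_cnj by (simp only: mult_ac)
    also have "\<dots> = (\<integral>x. cnj (f x) * (\<integral>y. f y * of_real (gauss_kernel (r n) (x - y)) \<partial>lborel) \<partial>lborel)"
      by (rule fourier_pairing_gauss[OF r f c])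
    also have "ennreal (norm \<dots>) \<le> (\<integral>\<^sup>+x. norm (cnj (f x) * (\<integral>y. f y * of_real (gauss_kernel (r n) (x - y)) \<partial>lborel)) \<partial>lborel)"
      by (rule integral_norm_bound_ennreal')
    also have "\<dots> \<le> (\<integral>\<^sup>+x. \<integral>\<^sup>+y. ennreal (norm (f x) * norm (f y) * gauss_kernel (r n) (x - y)) \<partial>lborel \<partial>lborel)"
    proof (rule nn_integral_mono)
      fix x
      have "ennreal (norm (\<integral>y. f y * of_real (gauss_kernel (r n) (x - y)) \<partial>lborel)) \<le> (\<integral>\<^sup>+y. norm (f y * of_real (gauss_kernel (r n) (x - y))) \<partial>lborel)"
        by (rule integral_norm_bound_ennreal')
      then have "ennreal (norm (f x)) * ennreal (norm (\<integral>y. f y * of_real (gauss_kernel (r n) (x - y)) \<partial>lborel))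
         \<le> (\<integral>\<^sup>+y. ennreal (norm (f x)) * norm (f y * of_real (gauss_kernel (r n) (x - y))) \<partial>lborel)"
        by (subst nn_integral_cmult) (auto intro: mult_left_mono)
      then show "ennreal (norm (cnj (f x) * (\<integral>y. f y * of_real (gauss_kernel (r n) (x - y)) \<partial>lborel)))
         \<le> (\<integral>\<^sup>+y. ennreal (norm (f x) * norm (f y) * gauss_kernel (r n) (x - y)) \<partial>lborel)"
        by (simp add: norm_mult ennreal_mult[symmetric] gauss_kernel_nonneg mult.assoc)
    qed
    also have "\<dots> \<le> ennreal ((L2_norm f)\<^sup>2)" by (rule gauss_kernel_form_le[OF r f2])
    finally show ?thesis by simp
  qed
  have "(\<integral>\<^sup>+t. ennreal ((norm (fourier f t))\<^sup>2) \<partial>lborel) = (\<integral>\<^sup>+t. liminf (\<lambda>n. ennreal (A n t)) \<partial>lborel)"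
  proof (intro nn_integral_cong)
    fix t
    have "(\<lambda>n. A n t) \<longlonglongrightarrow> (norm (fourier f t))\<^sup>2 * 1"
      unfolding A_def r_def by (intro tendsto_intros gauss_mult_tendsto)
    then have "(\<lambda>n. ennreal (A n t)) \<longlonglongrightarrow> ennreal ((norm (fourier f t))\<^sup>2)" by simp
    then show "ennreal ((norm (fourier f t))\<^sup>2) = liminf (\<lambda>n. ennreal (A n t))"
      using lim_imp_Liminf[OF sequentially_bot] by metis
  qed
  also have "\<dots> \<le> liminf (\<lambda>n. \<integral>\<^sup>+t. ennreal (A n t) \<partial>lborel)"
    unfolding A_def by (intro nn_integral_liminf) measurable
  also have "\<dots> \<le> limsup (\<lambda>n. \<integral>\<^sup>+t. ennreal (A n t) \<partial>lborel)" by (rule Liminf_le_Limsup) simp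
  also have "\<dots> \<le> ennreal ((L2_norm f)\<^sup>2)" using A_le by (intro Limsup_bounded) auto
  finally show "fourier f \<in> L2" "L2_norm (fourier f) \<le> L2_norm f"
    using L2_norm_leI[of "fourier f" "L2_norm f"] by (auto simp: L2_norm_nonneg)
qed

section \<open>Density of test functions\<close>

lemma integrable_cball_indicator: "integrable lborel (indicator (cball (a::'a::euclidean_space) R) :: 'a \<Rightarrow> real)"
  using emeasure_bounded_finite[OF bounded_cball[of a R]] by (simp add: integrable_indicator_iff)

lemma integrable_bounded_support:
  fixes f :: "'a::euclidean_space \<Rightarrow> complex"
  assumes [measurable]: "f \<in> borel_measurable borel" and "\<And>x. norm (f x) \<le> B" "\<And>x. x \<notin> cball 0 R \<Longrightarrow> f x = 0"
  shows "integrable lborel f"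
proof (rule Bochner_Integration.integrable_bound)
  show "integrable lborel (\<lambda>x. B * indicator (cball (0::'a) R) x :: real)"
    by (rule integrable_mult_right[OF integrable_cball_indicator])
  show "AE x in lborel. norm (f x) \<le> norm (B * indicator (cball (0::'a) R) x :: real)"
    using assms by (intro AE_I2) (auto simp: indicator_def intro: order.trans[OF _ abs_ge_self])
qed simp

lemma integrable_bounded_imp_L2:
  fixes f :: "'a::euclidean_space \<Rightarrow> complex"
  assumes "integrable lborel f" and "\<And>x. norm (f x) \<le> B"
  shows "f \<in> L2"
proof -
  have "integrable lborel (\<lambda>x. f x * cnj (f x))"
    using assms(1) by (rule integrable_mult_bounded(1)[where B=B]) (use assms in auto)
  then have "integrable lborel (\<lambda>x. complex_of_real ((norm (f x))\<^sup>2))" by (simp only: complex_norm_square)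
  then show ?thesis using assms(1) by (subst (asm) complex_of_real_integrable_eq) (simp add: L2_def)
qed

lemma L2_bounded_support:
  fixes f :: "'a::euclidean_space \<Rightarrow> complex"
  assumes [measurable]: "f \<in> borel_measurable borel" and "\<And>x. norm (f x) \<le> B" "\<And>x. x \<notin> cball 0 R \<Longrightarrow> f x = 0"
  shows "f \<in> L2"
  using integrable_bounded_support[OF assms] assms(2) by (rule integrable_bounded_imp_L2)

lemma test_functions_support_cball:
  assumes "u \<in> test_functions U"
  obtains R where "\<And>x. x \<notin> cball 0 R \<Longrightarrow> u x = 0"
proof -
  have "bounded {x. u x \<noteq> 0}"
    using test_functionsD(2)[OF assms] by (meson bounded_subset closure_subset compact_imp_bounded)
  then obtain R where "\<And>x. u x \<noteq> 0 \<Longrightarrow> norm x \<le> R" by (auto simp: bounded_iff)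
  then show ?thesis by (intro that[of R]) auto
qed

lemma test_functions_integrable_L2:
  assumes "u \<in> test_functions U"
  shows "integrable lborel u" "u \<in> L2"
proof -
  obtain R where R: "\<And>x. x \<notin> cball 0 R \<Longrightarrow> u x = 0" using test_functions_support_cball[OF assms] by blast
  obtain B where B: "\<And>x. norm (u x) \<le> B" using test_functions_bounded[OF assms] by metis
  show "integrable lborel u" "u \<in> L2"
    using integrable_bounded_support[OF test_functionsD(5)[OF assms] B R]
      L2_bounded_support[OF test_functionsD(5)[OF assms] B R] by auto
qed

text \<open>Dominated convergence on both sides of the inequality. Since \<open>g\<close> is only
  square integrable, the pairing is dominated on the ball by means of
  \<open>norm (g x) \<le> (norm (g x))\<^sup>2 + 1\<close>; the norms are dominated by a multiple of
  the indicator of the ball.\<close>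

lemma tendsto_norm_pairing_le:
  fixes g :: "'a::euclidean_space \<Rightarrow> complex"
  assumes g: "g \<in> L2" and M: "\<And>n. norm (\<integral>x. g x * u n x \<partial>lborel) \<le> M * L2_norm (u n)"
    and [measurable]: "\<And>n. u n \<in> borel_measurable borel"
    and B: "\<And>n x. norm (u n x) \<le> B" and R: "\<And>n x. x \<notin> cball 0 R \<Longrightarrow> u n x = 0"
    and [measurable]: "c \<in> borel_measurable borel"
    and lim: "AE x in lborel. (\<lambda>n. u n x) \<longlonglongrightarrow> c x"
  shows "norm (\<integral>x. g x * c x \<partial>lborel) \<le> M * L2_norm c"
proof -
  note [measurable] = L2D[OF g]
  let ?I = "indicator (cball (0::'a) R) :: 'a \<Rightarrow> real"
  have B0: "B \<ge> 0" using B[of 0 0] norm_ge_zero order.trans by blast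
  have "(\<lambda>n. \<integral>x. g x * u n x \<partial>lborel) \<longlonglongrightarrow> (\<integral>x. g x * c x \<partial>lborel)"
  proof (rule integral_dominated_convergence[where w="\<lambda>x. B * ((norm (g x))\<^sup>2 + ?I x)"])
    show "integrable lborel (\<lambda>x. B * ((norm (g x))\<^sup>2 + ?I x))"
      using g by (intro integrable_mult_right Bochner_Integration.integrable_add integrable_cball_indicator) (simp add: L2_def)
    show "AE x in lborel. (\<lambda>n. g x * u n x) \<longlonglongrightarrow> g x * c x"
      using lim by eventually_elim (intro tendsto_intros)
    show "AE x in lborel. norm (g x * u n x) \<le> B * ((norm (g x))\<^sup>2 + ?I x)" for n
    proof (intro AE_I2)
      fix x
      show "norm (g x * u n x) \<le> B * ((norm (g x))\<^sup>2 + ?I x)"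
      proof (cases "x \<in> cball 0 R")
        case True
        have "norm (g x) \<le> (norm (g x))\<^sup>2 + 1"
          using sum_squares_bound[of "norm (g x)" 1] by (simp add: power2_eq_square) (smt (verit) mult_nonneg_nonneg norm_ge_zero)
        then have "norm (g x) * norm (u n x) \<le> ((norm (g x))\<^sup>2 + 1) * B"
          using B by (intro mult_mono) auto
        then show ?thesis using True by (simp add: norm_mult mult.commute)
      next
        case False
        then show ?thesis using R[OF False, of n] B0 by simp
      qed
    qed
  qed measurable
  then have 1: "(\<lambda>n. norm (\<integral>x. g x * u n x \<partial>lborel)) \<longlonglongrightarrow> norm (\<integral>x. g x * c x \<partial>lborel)" by (rule tendsto_norm)
  have "(\<lambda>n. \<integral>x. (norm (u n x))\<^sup>2 \<partial>lborel) \<longlonglongrightarrow> (\<integral>x. (norm (c x))\<^sup>2 \<partial>lborel)"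
  proof (rule integral_dominated_convergence[where w="\<lambda>x. B\<^sup>2 * ?I x"])
    show "integrable lborel (\<lambda>x. B\<^sup>2 * ?I x)" by (intro integrable_mult_right integrable_cball_indicator)
    show "AE x in lborel. (\<lambda>n. (norm (u n x))\<^sup>2) \<longlonglongrightarrow> (norm (c x))\<^sup>2"
      using lim by eventually_elim (intro tendsto_intros)
    show "AE x in lborel. norm ((norm (u n x))\<^sup>2) \<le> B\<^sup>2 * ?I x" for n
    proof (intro AE_I2)
      fix x show "norm ((norm (u n x))\<^sup>2) \<le> B\<^sup>2 * ?I x"
        using B[of n x] R[of x n] by (cases "x \<in> cball 0 R") (auto intro: power_mono)
    qed
  qed measurable
  then have "(\<lambda>n. M * L2_norm (u n)) \<longlonglongrightarrow> M * L2_norm c"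
    unfolding L2_norm_def by (intro tendsto_intros)
  then show ?thesis using 1 M by (intro LIMSEQ_le) auto
qed

lemma integral_pos_continuous:
  fixes v :: "'a::euclidean_space \<Rightarrow> real"
  assumes "continuous_on UNIV v" and int: "integrable lborel v" and v: "v a > 0" "\<And>x. v x \<ge> 0"
  shows "(\<integral>x. v x \<partial>lborel) > 0"
proof -
  have op: "open {x. v x > 0}" using assms(1) by (simp add: open_Collect_less continuous_on_const)
  then have "\<not> negligible {x. v x > 0}" using open_not_negligible v by blast
  then have ne: "emeasure lborel {x. v x > 0} \<noteq> 0"
    using op unfolding negligible_iff_null_sets by (auto intro!: null_sets_completionI null_setsI)
  have "(\<integral>x. v x \<partial>lborel) \<noteq> 0"
  proof
    assume "(\<integral>x. v x \<partial>lborel) = 0"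
    then have "AE x in lborel. v x = 0" using integral_nonneg_eq_0_iff_AE[OF int] v(2) by simp
    then have "AE x in lborel. \<not> v x > 0" by eventually_elim simp
    then have "emeasure lborel {x \<in> space lborel. v x > 0} = 0"
      using AE_iff_measurable[of "{x. v x > 0}" lborel "\<lambda>x. \<not> v x > 0"] op by simp
    then show False using ne by simp
  qed
  moreover have "(\<integral>x. v x \<partial>lborel) \<ge> 0" using v(2) by (simp add: Bochner_Integration.integral_nonneg)
  ultimately show ?thesis by simp
qed

text \<open>First stage of the approximation: mollify \<open>c\<close> by bumps \<open>w n\<close>
  of integral 1 and radius below \<open>1 / real (Suc n)\<close>. The mollified functions are test
  functions bounded by \<open>B\<close> and supported in the ball of radius
  \<open>R + 1\<close>.\<close>

lemma pairing_le_continuous: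
  fixes g :: "'a::euclidean_space \<Rightarrow> complex"
  assumes g: "g \<in> L2" and M: "\<And>u. u \<in> test_functions UNIV \<Longrightarrow> norm (\<integral>x. g x * u x \<partial>lborel) \<le> M * L2_norm u"
    and c: "continuous_on UNIV c" and B: "\<And>x. norm (c x) \<le> B" and R: "\<And>x. x \<notin> cball 0 R \<Longrightarrow> c x = 0"
  shows "norm (\<integral>x. g x * c x \<partial>lborel) \<le> M * L2_norm c"
proof -
  have [measurable]: "c \<in> borel_measurable borel" using c by (rule borel_measurable_continuous_onI)
  have ci: "integrable lborel c" by (rule integrable_bounded_support[OF _ B R]) auto
  have "\<exists>w :: 'a \<Rightarrow> complex. w \<in> test_functions UNIV \<and> (\<integral>x. w x \<partial>lborel) = 1 \<and> (\<integral>x. norm (w x) \<partial>lborel) = 1 \<and>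
     (\<forall>x. w x \<noteq> 0 \<longrightarrow> norm x < 1 / real (Suc n))" for n
  proof -
    obtain v :: "'a \<Rightarrow> real" where v: "(\<lambda>x. complex_of_real (v x)) \<in> test_functions (ball 0 (1 / real (Suc n)))" "v 0 > 0"
      "\<And>x. v x \<ge> 0" "\<And>x. v (- x) = v x" "\<And>x. v x \<noteq> 0 \<Longrightarrow> norm x < 1 / real (Suc n)"
      by (rule bump_exists[of "1 / real (Suc n)", where 'a='a]) (simp, blast)
    have vU: "(\<lambda>x. complex_of_real (v x)) \<in> test_functions UNIV" using v(1) test_functions_mono by blast
    have int: "integrable lborel v" using test_functions_integrable_L2(1)[OF v(1)] by (simp add: complex_of_real_integrable_eq)
    define s where "s = (\<integral>x. v x \<partial>lborel)"
    have "s > 0"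
      unfolding s_def using continuous_on_Re[OF test_functionsD(4)[OF v(1), of UNIV]] v
      by (intro integral_pos_continuous[OF _ int, of 0]) auto
    define a where a: "a = 1 / s"
    have "(\<lambda>x. of_real a * complex_of_real (v x)) \<in> test_functions UNIV"
    proof (rule test_functionsI)
      show "smooth (\<lambda>x. of_real a * complex_of_real (v x))" using smooth_cmult[OF test_functionsD(1)[OF v(1)]] .
      show "compact (closure {x. complex_of_real (v x) \<noteq> 0})" using v(1) test_functionsD(2) by blast
      show "of_real a * complex_of_real (v x) = 0" if "x \<notin> closure {x. complex_of_real (v x) \<noteq> 0}" for x
        using that closure_subset[of "{x. complex_of_real (v x) \<noteq> 0}"] by auto
    qed simp
    moreover have "(\<integral>x. of_real a * complex_of_real (v x) \<partial>lborel) = 1"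
      using \<open>s > 0\<close> by (simp add: a s_def[symmetric])
    moreover have "norm (of_real a * complex_of_real (v x)) = a * v x" for x
      using v(3)[of x] \<open>s > 0\<close> by (simp add: a norm_mult norm_divide)
    then have "(\<integral>x. norm (of_real a * complex_of_real (v x)) \<partial>lborel) = 1"
      using \<open>s > 0\<close> by (simp add: a s_def[symmetric])
    ultimately show ?thesis using v(5) by (intro exI[of _ "\<lambda>x. of_real a * complex_of_real (v x)"]) auto
  qed
  then obtain w :: "nat \<Rightarrow> 'a \<Rightarrow> complex" where w: "\<And>n. w n \<in> test_functions UNIV" "\<And>n. (\<integral>x. w n x \<partial>lborel) = 1"
     "\<And>n. (\<integral>x. norm (w n x) \<partial>lborel) = 1" "\<And>n x. w n x \<noteq> 0 \<Longrightarrow> norm x < 1 / real (Suc n)" by metis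
  note [measurable] = test_functionsD(5)[OF w(1)]
  have wint: "integrable lborel (\<lambda>y. w n (x - y))" for n x
    by (rule integrable_lborel_reflect) (rule test_functions_integrable_L2(1)[OF w(1)])
  have w1: "(\<integral>y. w n (x - y) \<partial>lborel) = 1" "(\<integral>y. norm (w n (x - y)) \<partial>lborel) = 1" for n x
    using integral_lborel_reflect[of "w n" x] integral_lborel_reflect[of "\<lambda>y. norm (w n y)" x] w(2,3) by auto
  have cwint: "integrable lborel (\<lambda>y. c y * w n (x - y))" for n x
    by (rule integrable_mult_bounded(2)[OF wint, where B=B]) (use B in auto)
  \<comment> \<open>A weighted mean of \<open>c\<close> stays as close to \<open>z\<close> as the
    values being averaged. It is used three times: \<open>z = 0\<close>, \<open>e = 0\<close> for
    the support, \<open>z = 0\<close>, \<open>e = B\<close> for the bound, and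
    \<open>z = c x\<close> for convergence.\<close>
  have near: "norm (conv c (w n) x - z) \<le> e"
    if "\<And>y. norm (x - y) < 1 / real (Suc n) \<Longrightarrow> norm (c y - z) \<le> e" for n x z e
  proof -
    have "conv c (w n) x - z = (\<integral>y. c y * w n (x - y) \<partial>lborel) - (\<integral>y. z * w n (x - y) \<partial>lborel)"
      by (simp add: conv_def w1)
    also have "\<dots> = (\<integral>y. c y * w n (x - y) - z * w n (x - y) \<partial>lborel)"
      using wint cwint by (subst Bochner_Integration.integral_diff) auto
    also have "norm \<dots> \<le> (\<integral>y. norm (c y * w n (x - y) - z * w n (x - y)) \<partial>lborel)"
      by (rule integral_norm_bound)
    also have "\<dots> \<le> (\<integral>y. e * norm (w n (x - y)) \<partial>lborel)"
    proof (rule integral_mono)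
      show "integrable lborel (\<lambda>y. norm (c y * w n (x - y) - z * w n (x - y)))" using wint cwint by simp
      show "integrable lborel (\<lambda>y. e * norm (w n (x - y)))" using wint by simp
      show "norm (c y * w n (x - y) - z * w n (x - y)) \<le> e * norm (w n (x - y))" for y
        unfolding left_diff_distrib[symmetric] norm_mult
        using w(4)[of n "x - y"] that[of y] by (cases "w n (x - y) = 0") (auto intro: mult_right_mono)
    qed
    finally show ?thesis by (simp add: w1)
  qed
  show ?thesis
  proof (rule tendsto_norm_pairing_le[OF g, where u="\<lambda>n. conv c (w n)" and B=B and R="R+1"])
    have z: "conv c (w n) x = 0" if "x \<notin> cball 0 (R + 1)" for n x
    proof -
      have "norm (c y - 0) \<le> 0" if "norm (x - y) < 1 / real (Suc n)" for y
      proof -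
        have "norm (x - y) < 1" using that by (rule less_le_trans) simp
        then have "y \<notin> cball 0 R" using norm_triangle_sub[of x y] \<open>x \<notin> cball 0 (R + 1)\<close> by auto
        then show ?thesis using R by simp
      qed
      then have "norm (conv c (w n) x - 0) \<le> 0" by (rule near)
      then show ?thesis by simp
    qed
    then show "conv c (w n) x = 0" if "x \<notin> cball 0 (R + 1)" for n x using that by blast
    have sm: "smooth (conv c (w n))" for n by (rule smooth_conv[OF ci w(1)])
    then show "conv c (w n) \<in> borel_measurable borel" for n by (rule smooth_borel_measurable)
    have "conv c (w n) \<in> test_functions UNIV" for n
      using z by (intro test_functionsI[OF sm, of "cball 0 (R + 1)"]) auto
    then show "norm (\<integral>x. g x * conv c (w n) x \<partial>lborel) \<le> M * L2_norm (conv c (w n))" for n by (rule M)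
    show "norm (conv c (w n) x) \<le> B" for n x
    proof -
      have "norm (conv c (w n) x - 0) \<le> B" by (rule near) (use B in simp)
      then show ?thesis by simp
    qed
    show "AE x in lborel. (\<lambda>n. conv c (w n) x) \<longlonglongrightarrow> c x"
    proof (intro AE_I2 LIMSEQ_I)
      fix x and e :: real assume "e > 0"
      have "continuous (at x) c" using c by (simp add: continuous_on_eq_continuous_at)
      then obtain d where d: "d > 0" "\<And>y. dist y x < d \<Longrightarrow> dist (c y) (c x) < e / 2"
        using \<open>e > 0\<close> unfolding continuous_at_eps_delta by (metis half_gt_zero)
      obtain N where N: "1 / real (Suc N) < d" using d(1) nat_approx_posE by blast
      have "norm (conv c (w n) x - c x) < e" if "n \<ge> N" for n
      proof -
        have "1 / real (Suc n) \<le> 1 / real (Suc N)" using that by (simp add: field_simps)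
        then have "norm (conv c (w n) x - c x) \<le> e / 2"
          using N d(2) by (intro near) (smt (verit) dist_norm norm_minus_commute)
        then show ?thesis using \<open>e > 0\<close> by simp
      qed
      then show "\<exists>N. \<forall>n\<ge>N. norm (conv c (w n) x - c x) < e" by blast
    qed
  qed measurable
qed

text \<open>Second stage: a measurable function is almost everywhere a limit of continuous ones, but
  these need not be bounded or supported in a common ball. Projecting their values to the disc of
  radius \<open>B\<close> and multiplying by the cut-off \<open>cut\<close> repairs both, and
  changes nothing in the limit because \<open>m\<close> is fixed by both operations.\<close>

lemma pairing_le_bounded:
  fixes g :: "'a::euclidean_space \<Rightarrow> complex"
  assumes g: "g \<in> L2" and M: "\<And>u. u \<in> test_functions UNIV \<Longrightarrow> norm (\<integral>x. g x * u x \<partial>lborel) \<le> M * L2_norm u"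
    and [measurable]: "m \<in> borel_measurable borel" and B: "\<And>x. norm (m x) \<le> B" and R: "\<And>x. x \<notin> cball 0 R \<Longrightarrow> m x = 0"
  shows "norm (\<integral>x. g x * m x \<partial>lborel) \<le> M * L2_norm m"
proof -
  have B0: "B \<ge> 0" using B[of 0] norm_ge_zero order.trans by blast
  have "m \<in> borel_measurable lebesgue" by (rule measurable_completion) simp
  then have "m measurable_on UNIV"
    using lebesgue_measurable_imp_measurable_on[of m UNIV] by simp
  then obtain N c where N: "negligible N" and c: "\<And>n. continuous_on UNIV (c n)" and lim: "\<And>x. x \<notin> N \<Longrightarrow> (\<lambda>n. c n x) \<longlonglongrightarrow> m x"
    unfolding measurable_on_def by auto
  define cut where "cut = (\<lambda>x::'a. max 0 (min 1 (R + 1 - norm x)))"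
  define p where "p = closest_point (cball (0::complex) B)"
  have p: "continuous_on UNIV p" "\<And>z. norm (p z) \<le> B" "\<And>z. norm z \<le> B \<Longrightarrow> p z = z"
    using B0 closest_point_in_set[of "cball (0::complex) B"]
    by (auto simp: p_def closest_point_self intro!: continuous_on_closest_point)
  define u where "u = (\<lambda>n x. of_real (cut x) * p (c n x))"
  have cu: "continuous_on UNIV (u n)" for n
  proof -
    have "continuous_on UNIV (\<lambda>x. p (c n x))" using continuous_on_compose2[OF p(1) c] by simp
    then show ?thesis unfolding u_def cut_def by (intro continuous_intros)
  qed
  have Bu: "norm (u n x) \<le> B" for n x
  proof -
    have "\<bar>cut x\<bar> * norm (p (c n x)) \<le> 1 * B" by (intro mult_mono p) (auto simp: cut_def)
    then show ?thesis by (simp add: u_def norm_mult)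
  qed
  have Ru: "u n x = 0" if "x \<notin> cball 0 (R + 1)" for n x using that by (simp add: u_def cut_def)
  show ?thesis
  proof (rule tendsto_norm_pairing_le[OF g _ _ Bu Ru])
    show "norm (\<integral>x. g x * u n x \<partial>lborel) \<le> M * L2_norm (u n)" for n
      by (rule pairing_le_continuous[OF g M cu Bu Ru])
    show "u n \<in> borel_measurable borel" for n using cu by (rule borel_measurable_continuous_onI)
    have "AE x in lebesgue. x \<notin> N" using N by (auto simp: negligible_iff_null_sets intro: AE_not_in)
    then have "AE x in lborel. x \<notin> N" by (simp add: AE_completion_iff)
    then show "AE x in lborel. (\<lambda>n. u n x) \<longlonglongrightarrow> m x"
    proof eventually_elim
      fix x assume "x \<notin> N"
      have "(\<lambda>n. p (c n x)) \<longlonglongrightarrow> p (m x)"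
        using p(1) lim[OF \<open>x \<notin> N\<close>] continuous_on_tendsto_compose[of UNIV p "\<lambda>n. c n x"] by simp
      then have "(\<lambda>n. of_real (cut x) * p (c n x)) \<longlonglongrightarrow> of_real (cut x) * m x"
        using p(3)[OF B] by (intro tendsto_intros) simp
      moreover have "of_real (cut x) * m x = m x"
        using R[of x] by (cases "x \<in> cball 0 R") (auto simp: cut_def)
      ultimately show "(\<lambda>n. u n x) \<longlonglongrightarrow> m x" by (simp add: u_def)
    qed
  qed measurable
qed

text \<open>The extremal function for the pairing is the conjugate of \<open>g\<close>. Truncated to
  \<open>A n\<close> it is admissible in \<open>pairing_le_bounded\<close>, and the truncated
  integral \<open>I\<close> satisfies \<open>I \<le> M * sqrt I\<close>. The sets \<open>A n\<close>
  exhaust the space.\<close>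

theorem L2_norm_le_if_pairing_le:
  fixes g :: "'a::euclidean_space \<Rightarrow> complex"
  assumes g: "g \<in> L2" and M0: "M \<ge> 0"
    and M: "\<And>u. u \<in> test_functions UNIV \<Longrightarrow> norm (\<integral>x. g x * u x \<partial>lborel) \<le> M * L2_norm u"
  shows "L2_norm g \<le> M"
proof -
  note [measurable] = L2D[OF g]
  define A where "A = (\<lambda>n. cball (0::'a) (real n) \<inter> {x. norm (g x) \<le> real n})"
  have [measurable]: "A n \<in> sets borel" for n unfolding A_def by measurable
  define m where "m = (\<lambda>n x. cnj (g x) * of_real (indicator (A n) x))"
  have I: "(\<integral>x. (norm (g x))\<^sup>2 * indicator (A n) x \<partial>lborel) \<le> M\<^sup>2" for n
  proof -
    define I where "I = (\<integral>x. (norm (g x))\<^sup>2 * indicator (A n) x \<partial>lborel)"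
    have I0: "I \<ge> 0" unfolding I_def by (intro Bochner_Integration.integral_nonneg) simp
    have "norm (\<integral>x. g x * m n x \<partial>lborel) \<le> M * L2_norm (m n)"
    proof (rule pairing_le_bounded[OF g M, where B="real n" and R="real n"])
      show "m n \<in> borel_measurable borel" unfolding m_def by measurable
      show "norm (m n x) \<le> real n" for x
        by (cases "x \<in> A n") (auto simp: m_def A_def)
      show "m n x = 0" if "x \<notin> cball 0 (real n)" for x using that by (auto simp: m_def A_def)
    qed
    also have "(\<lambda>x. g x * m n x) = (\<lambda>x. complex_of_real ((norm (g x))\<^sup>2 * indicator (A n) x))"
      unfolding m_def of_real_mult complex_norm_square by (simp only: mult.assoc)
    also have "norm (\<integral>x. complex_of_real ((norm (g x))\<^sup>2 * indicator (A n) x) \<partial>lborel) = I"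
      unfolding integral_complex_of_real I_def[symmetric] using I0 by simp
    also have "L2_norm (m n) = sqrt I"
    proof -
      have "(\<lambda>x. (norm (m n x))\<^sup>2) = (\<lambda>x. (norm (g x))\<^sup>2 * indicator (A n) x)"
        by (auto simp: m_def norm_mult indicator_def)
      then show ?thesis by (simp add: L2_norm_def I_def)
    qed
    finally have le: "I \<le> M * sqrt I" .
    show ?thesis
    proof (cases "I = 0")
      case False
      then have "sqrt I > 0" using I0 by simp
      moreover have "sqrt I * sqrt I \<le> M * sqrt I" using le I0 by simp
      ultimately have "sqrt I \<le> M" using mult_right_le_imp_le by blast
      then have "(sqrt I)\<^sup>2 \<le> M\<^sup>2" using I0 by (intro power_mono) auto
      then show ?thesis using I0 by (simp add: I_def)
    qed (simp add: I_def)
  qed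
  have "(\<lambda>n. \<integral>x. (norm (g x))\<^sup>2 * indicator (A n) x \<partial>lborel) \<longlonglongrightarrow> (\<integral>x. (norm (g x))\<^sup>2 \<partial>lborel)"
  proof (rule integral_dominated_convergence[where w="\<lambda>x. (norm (g x))\<^sup>2"])
    show "integrable lborel (\<lambda>x. (norm (g x))\<^sup>2)" using g by (simp add: L2_def)
    show "AE x in lborel. (\<lambda>n. (norm (g x))\<^sup>2 * indicator (A n) x) \<longlonglongrightarrow> (norm (g x))\<^sup>2"
    proof (intro AE_I2)
      fix x
      obtain N where N: "max (norm x) (norm (g x)) \<le> real N" using real_arch_simple by blast
      have "\<forall>\<^sub>F n in sequentially. (norm (g x))\<^sup>2 * indicator (A n) x = (norm (g x))\<^sup>2"
        using eventually_ge_at_top[of N]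
      proof eventually_elim
        fix n assume "n \<ge> N"
        then have "real N \<le> real n" by simp
        then have "x \<in> A n" using N by (auto simp: A_def)
        then show "(norm (g x))\<^sup>2 * indicator (A n) x = (norm (g x))\<^sup>2" by simp
      qed
      then show "(\<lambda>n. (norm (g x))\<^sup>2 * indicator (A n) x) \<longlonglongrightarrow> (norm (g x))\<^sup>2" by (rule tendsto_eventually)
    qed
    show "AE x in lborel. norm ((norm (g x))\<^sup>2 * indicator (A n) x) \<le> (norm (g x))\<^sup>2" for n
      by (intro AE_I2) (auto simp: indicator_def)
  qed measurable
  then have "(\<integral>x. (norm (g x))\<^sup>2 \<partial>lborel) \<le> M\<^sup>2" using I by (intro LIMSEQ_le_const2) auto
  then have "(L2_norm g)\<^sup>2 \<le> M\<^sup>2" by (simp add: L2_norm_power2)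
  then show ?thesis using M0 by (rule power2_le_imp_le)
qed

section \<open>Fourier inversion and the Fourier transform on \<open>L\<^sup>2\<close>\<close>

lemma integral_lborel_scale:
  fixes f :: "'a::euclidean_space \<Rightarrow> complex"
  assumes "r > 0" and [measurable]: "f \<in> borel_measurable borel"
  shows "(\<integral>x. f x \<partial>lborel) = (\<integral>z. of_real (r ^ DIM('a)) * f (r *\<^sub>R z) \<partial>lborel)"
  using assms(1)
  by (subst lborel_affine[of r 0]) (auto simp: integral_density integral_distr scaleR_conv_of_real)

lemma gauss_kernel_scale: "r > 0 \<Longrightarrow> r ^ DIM('a) * gauss_kernel r (r *\<^sub>R z) = gauss_kernel 1 (z::'a::euclidean_space)"
proof -
  assume "r > 0"
  have "r ^ DIM('a) * gauss_kernel r (r *\<^sub>R z) = (\<Prod>b\<in>(Basis::'a set). r * normal_density 0 r (r * (z \<bullet> b)))"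
    by (simp add: gauss_kernel_def prod.distrib)
  also have "\<dots> = gauss_kernel 1 z"
    unfolding gauss_kernel_def using \<open>r > 0\<close>
    by (intro prod.cong) (auto simp: normal_density_def real_sqrt_mult power_mult_distrib)
  finally show ?thesis .
qed

text \<open>Substituting \<open>y = q - r *\<^sub>R z\<close> moves the width from the kernel into
  the argument of \<open>u\<close>, so that one dominating function,
  \<open>B * gauss_kernel 1 z\<close>, serves for all widths.\<close>

lemma gauss_kernel_conv_tendsto:
  fixes u :: "'a::euclidean_space \<Rightarrow> complex"
  assumes [measurable]: "u \<in> borel_measurable borel" and B: "\<And>x. norm (u x) \<le> B" and q: "isCont u q"
  shows "(\<lambda>n. \<integral>y. u y * of_real (gauss_kernel (1 / real (Suc n)) (q - y)) \<partial>lborel) \<longlonglongrightarrow> u q"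
proof -
  have eq: "(\<integral>y. u y * of_real (gauss_kernel r (q - y)) \<partial>lborel) = (\<integral>z. u (q - r *\<^sub>R z) * of_real (gauss_kernel 1 z) \<partial>lborel)"
    if "r > 0" for r
  proof -
    have "(\<integral>y. u y * of_real (gauss_kernel r (q - y)) \<partial>lborel) = (\<integral>y. u (q - y) * of_real (gauss_kernel r y) \<partial>lborel)"
      using integral_lborel_reflect[of "\<lambda>y. u (q - y) * of_real (gauss_kernel r y)" q] by simp
    also have "\<dots> = (\<integral>z. of_real (r ^ DIM('a)) * (u (q - r *\<^sub>R z) * of_real (gauss_kernel r (r *\<^sub>R z))) \<partial>lborel)"
      by (rule integral_lborel_scale[OF that]) measurable
    also have "\<dots> = (\<integral>z. u (q - r *\<^sub>R z) * of_real (r ^ DIM('a) * gauss_kernel r (r *\<^sub>R z)) \<partial>lborel)"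
      unfolding of_real_mult by (simp only: mult_ac)
    finally show ?thesis by (simp only: gauss_kernel_scale[OF that])
  qed
  have "(\<lambda>n. \<integral>z. u (q - (1 / real (Suc n)) *\<^sub>R z) * of_real (gauss_kernel 1 z) \<partial>lborel) \<longlonglongrightarrow> integral\<^sup>L lborel (\<lambda>z::'a. u q * of_real (gauss_kernel 1 z))"
  proof (rule integral_dominated_convergence[where w="\<lambda>z. B * gauss_kernel 1 z"])
    show "integrable lborel (\<lambda>z. B * gauss_kernel 1 (z::'a))" by (simp add: integrable_gauss_kernel)
    show "AE z in lborel. (\<lambda>n. u (q - (1 / real (Suc n)) *\<^sub>R z) * of_real (gauss_kernel 1 z)) \<longlonglongrightarrow> u q * of_real (gauss_kernel 1 z)"
    proof (intro AE_I2)
      fix z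
      have "(\<lambda>n. 1 / real (Suc n)) \<longlonglongrightarrow> 0" by (rule LIMSEQ_Suc) (rule lim_1_over_n)
      then have "(\<lambda>n. q - (1 / real (Suc n)) *\<^sub>R z) \<longlonglongrightarrow> q - 0 *\<^sub>R z" by (intro tendsto_intros)
      then have "(\<lambda>n. u (q - (1 / real (Suc n)) *\<^sub>R z)) \<longlonglongrightarrow> u q"
        using isCont_tendsto_compose[OF q] by simp
      then show "(\<lambda>n. u (q - (1 / real (Suc n)) *\<^sub>R z) * of_real (gauss_kernel 1 z)) \<longlonglongrightarrow> u q * of_real (gauss_kernel 1 z)"
        by (intro tendsto_intros)
    qed
    show "AE z in lborel. norm (u (q - (1 / real (Suc n)) *\<^sub>R z) * of_real (gauss_kernel 1 z)) \<le> B * gauss_kernel 1 z" for n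
      using B by (intro AE_I2) (auto simp: norm_mult gauss_kernel_nonneg simp del: of_nat_Suc intro!: mult_right_mono)
  qed measurable
  also have "integral\<^sup>L lborel (\<lambda>z::'a. u q * of_real (gauss_kernel 1 z)) = u q"
    by (simp add: integral_gauss_kernel)
  finally show ?thesis by (subst eq) auto
qed

lemma fourier_inversion_gauss:
  fixes u :: "'a::euclidean_space \<Rightarrow> complex"
  assumes u: "integrable lborel u" and B: "\<And>x. norm (u x) \<le> B" and q: "isCont u q"
  shows "(\<lambda>n. \<integral>t. fourier u t * ee (t \<bullet> q) * of_real (gauss_mult (1 / real (Suc n)) t) \<partial>lborel) \<longlonglongrightarrow> u q"
  by (subst fourier_gauss_mult[OF _ u], simp) (rule gauss_kernel_conv_tendsto[OF _ B q], use u in auto)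

text \<open>Both sides of \<open>fourier_pairing_gauss\<close> converge as the width tends to 0. On
  the left the two transforms are in L2 by \<open>plancherel_le\<close>, so their product is
  integrable and dominates; on the right the smoothed \<open>u\<close> converges pointwise by
  continuity and stays bounded by \<open>B\<close>.\<close>

lemma fourier_pairing:
  fixes u G :: "'a::euclidean_space \<Rightarrow> complex"
  assumes u: "integrable lborel u" "u \<in> L2" and B: "\<And>x. norm (u x) \<le> B" and c: "continuous_on UNIV u"
    and G: "integrable lborel G" "G \<in> L2"
  shows "(\<integral>t. fourier G (- t) * fourier u t \<partial>lborel) = (\<integral>x. G x * u x \<partial>lborel)"
proof (rule LIMSEQ_unique)
  let ?r = "\<lambda>n. 1 / real (Suc n)"
  have [measurable]: "u \<in> borel_measurable borel" "G \<in> borel_measurable borel" using u G by auto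
  have "(\<lambda>y. G (- y)) \<in> L2" "integrable lborel (\<lambda>y. G (- y))"
  proof -
    show "integrable lborel (\<lambda>y. G (- y))" using integrable_lborel_reflect[OF G(1), of 0] by simp
    have "integrable lborel (\<lambda>x. (norm (G (0 - x)))\<^sup>2)"
      by (rule integrable_lborel_reflect) (use G in \<open>simp add: L2_def\<close>)
    then show "(\<lambda>y. G (- y)) \<in> L2" by (simp add: L2_def)
  qed
  then have "fourier (\<lambda>y. G (- y)) \<in> L2" using plancherel_le(1) by blast
  moreover have "fourier (\<lambda>y. G (- y)) = (\<lambda>t. fourier G (- t))"
  proof
    fix t show "fourier (\<lambda>y. G (- y)) t = fourier G (- t)"
      using integral_lborel_reflect[of "\<lambda>y. G y * ee (t \<bullet> y)" 0] by (simp add: fourier_eq)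
  qed
  ultimately have int: "integrable lborel (\<lambda>t. fourier G (- t) * fourier u t)"
    using L2_mult_integrable plancherel_le(1)[OF u] by auto
  show "(\<lambda>n. \<integral>t. fourier G (- t) * fourier u t * of_real (gauss_mult (?r n) t) \<partial>lborel) \<longlonglongrightarrow> (\<integral>t. fourier G (- t) * fourier u t \<partial>lborel)"
  proof (rule integral_dominated_convergence[where w="\<lambda>t. norm (fourier G (- t) * fourier u t)"])
    show "integrable lborel (\<lambda>t. norm (fourier G (- t) * fourier u t))" using int by simp
    show "AE t in lborel. (\<lambda>n. fourier G (- t) * fourier u t * of_real (gauss_mult (?r n) t)) \<longlonglongrightarrow> fourier G (- t) * fourier u t"
    proof (intro AE_I2)
      fix t
      have "(\<lambda>n. fourier G (- t) * fourier u t * of_real (gauss_mult (?r n) t)) \<longlonglongrightarrow> fourier G (- t) * fourier u t * of_real 1"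
        by (intro tendsto_intros gauss_mult_tendsto)
      then show "(\<lambda>n. fourier G (- t) * fourier u t * of_real (gauss_mult (?r n) t)) \<longlonglongrightarrow> fourier G (- t) * fourier u t" by simp
    qed
    show "AE t in lborel. norm (fourier G (- t) * fourier u t * of_real (gauss_mult (?r n) t)) \<le> norm (fourier G (- t) * fourier u t)" for n
    proof (intro AE_I2)
      fix t :: 'a
      have "norm (complex_of_real (gauss_mult (?r n) t)) \<le> 1"
        using gauss_mult_bounds[of "?r n" t] by simp
      then show "norm (fourier G (- t) * fourier u t * of_real (gauss_mult (?r n) t)) \<le> norm (fourier G (- t) * fourier u t)"
        unfolding norm_mult[of "fourier G (- t) * fourier u t"] by (rule mult_left_le) simp
    qed
  qed measurable
  have B0: "B \<ge> 0" using B[of 0] norm_ge_zero order.trans by blast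
  have "(\<lambda>n. \<integral>x. G x * (\<integral>y. u y * of_real (gauss_kernel (?r n) (x - y)) \<partial>lborel) \<partial>lborel) \<longlonglongrightarrow> (\<integral>x. G x * u x \<partial>lborel)"
  proof (rule integral_dominated_convergence[where w="\<lambda>x. norm (G x) * B"])
    show "integrable lborel (\<lambda>x. norm (G x) * B)" using G by simp
    show "AE x in lborel. (\<lambda>n. G x * (\<integral>y. u y * of_real (gauss_kernel (?r n) (x - y)) \<partial>lborel)) \<longlonglongrightarrow> G x * u x"
      using c by (intro AE_I2 tendsto_intros gauss_kernel_conv_tendsto[where B=B]) (auto simp: B continuous_on_eq_continuous_at)
    show "AE x in lborel. norm (G x * (\<integral>y. u y * of_real (gauss_kernel (?r n) (x - y)) \<partial>lborel)) \<le> norm (G x) * B" for n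
    proof (intro AE_I2)
      fix x :: 'a
      have ki: "integrable lborel (\<lambda>y. B * gauss_kernel (?r n) (x - y))"
        by (intro integrable_mult_right integrable_lborel_reflect integrable_gauss_kernel) simp
      have "norm (\<integral>y. u y * of_real (gauss_kernel (?r n) (x - y)) \<partial>lborel) \<le> (\<integral>y. B * gauss_kernel (?r n) (x - y) \<partial>lborel)"
      proof (rule Bochner_Integration.integral_norm_bound_integral[OF _ ki])
        show "integrable lborel (\<lambda>y. u y * of_real (gauss_kernel (?r n) (x - y)))"
          using B by (intro Bochner_Integration.integrable_bound[OF ki])
            (auto simp: norm_mult B0 gauss_kernel_nonneg intro!: AE_I2 mult_right_mono)
        show "norm (u y * of_real (gauss_kernel (?r n) (x - y))) \<le> B * gauss_kernel (?r n) (x - y)" for y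
          using B by (auto simp: norm_mult gauss_kernel_nonneg intro!: mult_right_mono)
      qed
      also have "\<dots> = B"
        using integral_lborel_reflect[of "gauss_kernel (?r n)" x] integral_gauss_kernel[of "?r n", where 'a='a] by simp
      finally show "norm (G x * (\<integral>y. u y * of_real (gauss_kernel (?r n) (x - y)) \<partial>lborel)) \<le> norm (G x) * B"
        by (simp add: norm_mult mult_left_mono)
    qed
  qed measurable
  then show "(\<lambda>n. \<integral>t. fourier G (- t) * fourier u t * of_real (gauss_mult (?r n) t) \<partial>lborel) \<longlonglongrightarrow> (\<integral>x. G x * u x \<partial>lborel)"
    by (subst fourier_pairing_gauss[OF _ u(1) G(1)]) auto
qed

section \<open>Decay of Schwartz functions and the Fourier transform on L2\<close>

definition decay :: "'a::euclidean_space \<Rightarrow> real" where "decay x = inverse ((1 + norm x) ^ (2 * DIM('a)))"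

lemma integrable_inverse_1_plus_square': "integrable lborel (\<lambda>s::real. inverse (1 + s\<^sup>2))"
  using integrable_inverse_1_plus_square by (simp add: set_integrable_def einterval_def)

lemma decay_bounds: "0 < decay x" "decay x \<le> 1"
proof -
  show "0 < decay x" by (simp add: decay_def add_pos_nonneg)
  show "decay x \<le> 1" by (simp add: decay_def inverse_le_1_iff one_le_power)
qed

lemma borel_measurable_decay [measurable]: "decay \<in> borel_measurable borel"
  unfolding decay_def[abs_def] by measurable

text \<open>This explains the exponent \<open>2 * DIM('a)\<close>: it gives two powers of
  \<open>1 + norm x\<close> per coordinate, enough to lie below the product of the integrable
  functions \<open>inverse (1 + (x \<bullet> b)\<^sup>2)\<close>.\<close>

lemma integrable_decay: "integrable lborel (decay :: 'a::euclidean_space \<Rightarrow> real)"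
proof (rule Bochner_Integration.integrable_bound)
  show "integrable lborel (\<lambda>x::'a. \<Prod>b\<in>Basis. inverse (1 + (x \<bullet> b)\<^sup>2))"
    by (rule integrable_lborel_Basis_prod) (rule integrable_inverse_1_plus_square')
  show "AE x in lborel. norm (decay (x::'a)) \<le> norm (\<Prod>b\<in>(Basis::'a set). inverse (1 + (x \<bullet> b)\<^sup>2))"
  proof (intro AE_I2)
    fix x :: 'a
    have "(\<Prod>b\<in>(Basis::'a set). 1 + (x \<bullet> b)\<^sup>2) \<le> (\<Prod>b\<in>(Basis::'a set). (1 + norm x)\<^sup>2)"
    proof (rule prod_mono)
      fix b :: 'a assume "b \<in> Basis"
      then have "(x \<bullet> b)\<^sup>2 \<le> (norm x)\<^sup>2" using Basis_le_norm[of b x] by (metis abs_le_square_iff abs_norm_cancel)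
      then show "0 \<le> 1 + (x \<bullet> b)\<^sup>2 \<and> 1 + (x \<bullet> b)\<^sup>2 \<le> (1 + norm x)\<^sup>2" by (simp add: power2_sum add_increasing2)
    qed
    also have "\<dots> = (1 + norm x) ^ (2 * DIM('a))" by (simp add: power_mult)
    finally have "(\<Prod>b\<in>(Basis::'a set). 1 + (x \<bullet> b)\<^sup>2) \<le> (1 + norm x) ^ (2 * DIM('a))" .
    moreover have "0 < (\<Prod>b\<in>(Basis::'a set). 1 + (x \<bullet> b)\<^sup>2)" by (intro prod_pos) (simp add: add_pos_nonneg)
    ultimately have "decay x \<le> inverse (\<Prod>b\<in>(Basis::'a set). 1 + (x \<bullet> b)\<^sup>2)"
      unfolding decay_def by (rule le_imp_inverse_le)
    then show "norm (decay x) \<le> norm (\<Prod>b\<in>(Basis::'a set). inverse (1 + (x \<bullet> b)\<^sup>2))"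
      using decay_bounds(1)[of x] by (simp add: prod_inversef[symmetric])
  qed
qed simp

lemma schwartzD:
  assumes "u \<in> schwartz"
  shows "smooth u" "u \<in> borel_measurable borel" "continuous_on S u"
    "set vs \<subseteq> Basis \<Longrightarrow> (1 + norm x) ^ k * norm (iter_deriv vs u x) \<le> schwartz_seminorm k vs u"
proof -
  show sm: "smooth u" using assms by (simp add: schwartz_def)
  show "u \<in> borel_measurable borel" "continuous_on S u" using smooth_borel_measurable[OF sm] smooth_continuous_on[OF sm] by auto
  assume "set vs \<subseteq> Basis"
  then have "bdd_above (range (\<lambda>x. (1 + norm x) ^ k * norm (iter_deriv vs u x)))"
    using assms bounded_imp_bdd_above by (auto simp: schwartz_def)
  then show "(1 + norm x) ^ k * norm (iter_deriv vs u x) \<le> schwartz_seminorm k vs u"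
    unfolding schwartz_seminorm_def by (rule cSUP_upper2[of _ _ x]) auto
qed

lemma schwartz_seminorm_nonneg: "u \<in> schwartz \<Longrightarrow> set vs \<subseteq> Basis \<Longrightarrow> 0 \<le> schwartz_seminorm k vs u"
  using schwartzD(4)[where u=u and vs=vs and k=k and x=0] by (auto intro: order.trans[OF norm_ge_zero])

lemma schwartz_decay:
  assumes "u \<in> schwartz" "set vs \<subseteq> Basis"
  shows "(1 + norm x) ^ j * norm (iter_deriv vs u x) \<le> schwartz_seminorm (j + 2 * DIM('a)) vs u * decay (x::'a::euclidean_space)"
proof -
  have "(1 + norm x) ^ j * norm (iter_deriv vs u x) = (1 + norm x) ^ (j + 2 * DIM('a)) * norm (iter_deriv vs u x) * decay x"
  proof -
    have "1 + norm x \<noteq> 0" by (smt (verit) norm_ge_zero)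
    then show ?thesis by (simp add: decay_def power_add)
  qed
  also have "\<dots> \<le> schwartz_seminorm (j + 2 * DIM('a)) vs u * decay x"
    using decay_bounds(1)[of x] by (intro mult_right_mono schwartzD(4) assms) auto
  finally show ?thesis .
qed

lemma schwartz_bounded:
  fixes u :: "'a::euclidean_space \<Rightarrow> complex"
  assumes "u \<in> schwartz" obtains B where "\<And>x. norm (u x) \<le> B"
  using schwartzD(4)[OF assms, where vs="[]" and k=0] that by auto

lemma schwartz_integrable_L2:
  fixes u :: "'a::euclidean_space \<Rightarrow> complex"
  assumes "u \<in> schwartz" shows "integrable lborel u" "u \<in> L2"
proof -
  note [measurable] = schwartzD(2)[OF assms]
  have u: "norm (u x) \<le> schwartz_seminorm (2 * DIM('a)) [] u * decay x" for x
    using schwartz_decay[OF assms, of "[]" x 0] by simp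
  show int: "integrable lborel u"
    by (rule Bochner_Integration.integrable_bound[OF integrable_mult_right[OF integrable_decay, of "schwartz_seminorm (2 * DIM('a)) [] u"]])
       (auto intro!: AE_I2 order.trans[OF u abs_ge_self])
  obtain B where B: "\<And>x. norm (u x) \<le> B" using schwartz_bounded[OF assms] by blast
  show "u \<in> L2" by (rule integrable_bounded_imp_L2[OF int B])
qed

lemma fourier_schwartz_L2: "u \<in> schwartz \<Longrightarrow> fourier u \<in> L2" "u \<in> schwartz \<Longrightarrow> L2_norm (fourier u) \<le> L2_norm u"
  using plancherel_le schwartz_integrable_L2 by blast+

lemma L2_fourier_iff:
  "L2_fourier f g \<longleftrightarrow> f \<in> L2 \<and> g \<in> L2 \<and> (\<forall>u\<in>schwartz. (\<integral>x. f x * fourier u x \<partial>lborel) = (\<integral>x. g x * u x \<partial>lborel))"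
  by (simp add: L2_fourier_def fourier_distr_def distr_of_def)

text \<open>\<open>L2_fourier\<close> only tells how \<open>g\<close> pairs with Schwartz functions.
  Each such pairing is one of \<open>f\<close> with \<open>fourier u\<close>, which Cauchy-Schwarz
  and \<open>plancherel_le\<close> control; duality then bounds \<open>g\<close>. Uniqueness of
  \<open>g\<close> is this bound applied to a difference.\<close>

lemma L2_fourier_norm_le:
  fixes f :: "'a::euclidean_space \<Rightarrow> complex"
  assumes "L2_fourier f g" shows "L2_norm g \<le> L2_norm f"
proof (rule L2_norm_le_if_pairing_le)
  show f: "g \<in> L2" "0 \<le> L2_norm f" using assms by (auto simp: L2_fourier_iff L2_norm_nonneg)
  have f2: "f \<in> L2" using assms by (simp add: L2_fourier_iff)
  fix u :: "'a \<Rightarrow> complex" assume "u \<in> test_functions UNIV"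
  then have u: "u \<in> schwartz" using test_functions_subset_schwartz by blast
  have "(\<integral>x. g x * u x \<partial>lborel) = (\<integral>x. f x * fourier u x \<partial>lborel)" using assms u by (simp add: L2_fourier_iff)
  also have "norm \<dots> \<le> (\<integral>x. norm (f x * fourier u x) \<partial>lborel)" by (rule integral_norm_bound)
  also have "\<dots> \<le> L2_norm f * L2_norm (fourier u)" using L2_Cauchy_Schwarz f2 fourier_schwartz_L2(1)[OF u] by blast
  also have "\<dots> \<le> L2_norm f * L2_norm u" using fourier_schwartz_L2(2)[OF u] by (intro mult_left_mono) (auto simp: L2_norm_nonneg)
  finally show "norm (\<integral>x. g x * u x \<partial>lborel) \<le> L2_norm f * L2_norm u" .
qed

lemma L2_fourier_add:
  assumes "L2_fourier f g" "L2_fourier f' g'"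
  shows "L2_fourier (\<lambda>x. f x + f' x) (\<lambda>x. g x + g' x)"
  using assms by (auto simp: L2_fourier_iff L2_add ring_distribs L2_mult_integrable fourier_schwartz_L2 schwartz_integrable_L2)

lemma L2_fourier_cmult:
  assumes "L2_fourier f g" shows "L2_fourier (\<lambda>x. c * f x) (\<lambda>x. c * g x)"
  using assms by (auto simp: L2_fourier_iff L2_cmult mult.assoc)

lemma L2_fourier_unique:
  assumes "L2_fourier f g" "L2_fourier f g'"
  shows "AE x in lborel. g x = g' x"
proof -
  have "L2_fourier (\<lambda>x. f x + (-1) * f x) (\<lambda>x. g x + (-1) * g' x)" by (intro L2_fourier_add L2_fourier_cmult assms)
  from L2_fourier_norm_le[OF this] this have *: "L2_norm (\<lambda>x. g x - g' x) \<le> 0" "(\<lambda>x. g x - g' x) \<in> L2"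
    by (auto simp: L2_norm_def L2_fourier_iff)
  then have "(\<integral>x. (norm (g x - g' x))\<^sup>2 \<partial>lborel) = 0"
    using L2_norm_nonneg[of "\<lambda>x. g x - g' x"] L2_norm_power2[of "\<lambda>x. g x - g' x"] by (metis order_antisym zero_power2)
  moreover have "integrable lborel (\<lambda>x. (norm (g x - g' x))\<^sup>2)" using *(2) by (simp add: L2_def)
  ultimately have "AE x in lborel. (norm (g x - g' x))\<^sup>2 = 0"
    using integral_nonneg_eq_0_iff_AE[of lborel "\<lambda>x. (norm (g x - g' x))\<^sup>2"] by simp
  then show ?thesis by eventually_elim simp
qed

text \<open>The source of elements of \<open>PW \<Omega>\<close> with a prescribed transform: for
  integrable \<open>G\<close> the inverse transform is an explicit integral, and
  \<open>fourier_pairing\<close> verifies the defining relation.\<close>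

lemma L2_fourier_inverse:
  fixes G :: "'a::euclidean_space \<Rightarrow> complex"
  assumes G: "integrable lborel G" "G \<in> L2"
  shows "L2_fourier (\<lambda>t. fourier G (- t)) G" and "L2_norm (\<lambda>t. fourier G (- t)) \<le> L2_norm G"
proof -
  note [measurable] = L2D[OF G(2)]
  have F: "fourier G \<in> L2" "L2_norm (fourier G) \<le> L2_norm G" using plancherel_le[OF G] by auto
  have "integrable lborel (\<lambda>t. (norm (fourier G (0 - t)))\<^sup>2)"
    by (rule integrable_lborel_reflect) (use F in \<open>simp add: L2_def\<close>)
  then have L: "(\<lambda>t. fourier G (- t)) \<in> L2" by (simp add: L2_def)
  have "(\<integral>t. (norm (fourier G (0 - t)))\<^sup>2 \<partial>lborel) = (\<integral>t. (norm (fourier G t))\<^sup>2 \<partial>lborel)"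
    by (rule integral_lborel_reflect) measurable
  then show "L2_norm (\<lambda>t. fourier G (- t)) \<le> L2_norm G" using F(2) by (simp add: L2_norm_def)
  have "(\<integral>t. fourier G (- t) * fourier u t \<partial>lborel) = (\<integral>x. G x * u x \<partial>lborel)" if u: "u \<in> schwartz" for u
  proof -
    obtain B where "\<And>x. norm (u x) \<le> B" using schwartz_bounded[OF u] by blast
    then show ?thesis using fourier_pairing[OF schwartz_integrable_L2[OF u] _ schwartzD(3)[OF u] G] by blast
  qed
  then show "L2_fourier (\<lambda>t. fourier G (- t)) G" using L G by (simp add: L2_fourier_iff)
qed

section \<open>Hankel operators built from reflections\<close>

definition seminorm_sum :: "nat \<Rightarrow> ('a::euclidean_space \<Rightarrow> complex) \<Rightarrow> real" where
  "seminorm_sum N u = (\<Sum>k\<le>N. \<Sum>vs | set vs \<subseteq> Basis \<and> length vs \<le> N. schwartz_seminorm k vs u)"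

text \<open>The symbol is \<open>\<Sum>\<^sub>k (\<delta> - \<sigma> \<delta>\<^sub>q)\<close> on the Fourier side, with the first point mass at
  \<open>2 p\<^sub>k\<close>. The correction term lives outside \<open>2\<Omega>\<close>, so it does not affect the Hankel operator, but
  it makes the series converge when the points accumulate at \<open>q\<close>.\<close>

locale reflections =
  fixes \<Omega> :: "'a::euclidean_space set" and p :: "nat \<Rightarrow> 'a" and q :: 'a and \<sigma> :: complex
    and C :: real and M :: nat
  assumes open_Omega: "open \<Omega>" and convex_Omega: "convex \<Omega>" and p_in: "p k \<in> \<Omega>"
    and disj: "j \<noteq> k \<Longrightarrow> x \<in> \<Omega> \<Longrightarrow> 2 *\<^sub>R p j - x \<in> \<Omega> \<Longrightarrow> 2 *\<^sub>R p k - x \<notin> \<Omega>"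
    and finite_measure: "emeasure lborel (\<Union>k. {x \<in> \<Omega>. 2 *\<^sub>R p k - x \<in> \<Omega>}) < \<infinity>"
    and q_notin: "q \<notin> (\<lambda>x. 2 *\<^sub>R x) ` \<Omega>"
    and symbol_bound: "u \<in> schwartz \<Longrightarrow>
      norm (\<integral>t. u t * (ee (t \<bullet> (2 *\<^sub>R p k)) - \<sigma> * ee (t \<bullet> q)) \<partial>lborel) \<le> (1 / 2) ^ k * (C * seminorm_sum M u)"
begin

definition W :: "nat \<Rightarrow> 'a set" where "W k = {x \<in> \<Omega>. 2 *\<^sub>R p k - x \<in> \<Omega>}"

lemma open_W: "open (W k)"
proof -
  have "W k = \<Omega> \<inter> (\<lambda>x. 2 *\<^sub>R p k - x) -` \<Omega>" by (auto simp: W_def)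
  then show ?thesis using open_Omega by (auto intro!: open_Int continuous_open_vimage continuous_intros)
qed

lemma W_measurable [measurable]: "W k \<in> sets borel"
  using open_W by simp

lemma W_disjoint: "x \<in> W j \<Longrightarrow> x \<in> W k \<Longrightarrow> j = k"
  using disj[of j k x] by (auto simp: W_def)

lemma W_symmetric: "2 *\<^sub>R p k - x \<in> W k \<longleftrightarrow> x \<in> W k"
  by (auto simp: W_def)

lemma p_in_W: "p k \<in> W k"
  using p_in[of k] by (simp add: W_def scaleR_2)

text \<open>The Fourier transform of the exponential of frequency \<open>a\<close> is the point mass
  at \<open>a\<close>; this bounded function is therefore the k-th term of the symbol before the
  transform.\<close>

definition symbol_exp :: "nat \<Rightarrow> 'a \<Rightarrow> complex" where
  "symbol_exp k t = ee (t \<bullet> (2 *\<^sub>R p k)) - \<sigma> * ee (t \<bullet> q)"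

lemma symbol_exp_measurable [measurable]: "symbol_exp k \<in> borel_measurable borel"
  unfolding symbol_exp_def[abs_def] by measurable

lemma norm_sym_exp: "norm (symbol_exp k t) \<le> 1 + norm \<sigma>"
  unfolding symbol_exp_def by (rule order.trans[OF norm_triangle_ineq4]) (simp add: norm_mult)

text \<open>The Gaussian factor makes the terms of the symbol computable on Fourier transforms without
  knowing that these are integrable; on Schwartz functions it disappears in the limit.\<close>

definition symbol_term :: "nat \<Rightarrow> 'a distr" where
  "symbol_term k u = lim (\<lambda>n. \<integral>t. u t * symbol_exp k t * of_real (gauss_mult (1 / real (Suc n)) t) \<partial>lborel)"

definition symbol :: "'a distr" where "symbol u = (\<Sum>k. symbol_term k u)"

lemma symbol_term_integrable:
  assumes "integrable lborel u"
  shows "symbol_term k u = (\<integral>t. u t * symbol_exp k t \<partial>lborel)" and "integrable lborel (\<lambda>t. u t * symbol_exp k t)"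
proof -
  have [measurable]: "u \<in> borel_measurable borel" using assms by auto
  show int: "integrable lborel (\<lambda>t. u t * symbol_exp k t)"
    by (rule integrable_mult_bounded(1)[OF assms _ norm_sym_exp]) simp
  have "(\<lambda>n. \<integral>t. u t * symbol_exp k t * of_real (gauss_mult (1 / real (Suc n)) t) \<partial>lborel) \<longlonglongrightarrow> (\<integral>t. u t * symbol_exp k t \<partial>lborel)"
  proof (rule integral_dominated_convergence[where w="\<lambda>t. norm (u t * symbol_exp k t)"])
    show "integrable lborel (\<lambda>t. norm (u t * symbol_exp k t))" using int by simp
    show "AE t in lborel. (\<lambda>n. u t * symbol_exp k t * of_real (gauss_mult (1 / real (Suc n)) t)) \<longlonglongrightarrow> u t * symbol_exp k t"
    proof (intro AE_I2)
      fix t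
      have "(\<lambda>n. u t * symbol_exp k t * of_real (gauss_mult (1 / real (Suc n)) t)) \<longlonglongrightarrow> u t * symbol_exp k t * of_real 1"
        by (intro tendsto_intros gauss_mult_tendsto)
      then show "(\<lambda>n. u t * symbol_exp k t * of_real (gauss_mult (1 / real (Suc n)) t)) \<longlonglongrightarrow> u t * symbol_exp k t" by simp
    qed
    show "AE t in lborel. norm (u t * symbol_exp k t * of_real (gauss_mult (1 / real (Suc n)) t)) \<le> norm (u t * symbol_exp k t)" for n
    proof (intro AE_I2)
      fix t :: 'a
      have "norm (complex_of_real (gauss_mult (1 / real (Suc n)) t)) \<le> 1"
        using gauss_mult_bounds[of "1 / real (Suc n)" t] by simp
      then show "norm (u t * symbol_exp k t * of_real (gauss_mult (1 / real (Suc n)) t)) \<le> norm (u t * symbol_exp k t)"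
        unfolding norm_mult[of "u t * symbol_exp k t"] by (rule mult_left_le) simp
    qed
  qed measurable
  then show "symbol_term k u = (\<integral>t. u t * symbol_exp k t \<partial>lborel)" unfolding symbol_term_def by (rule limI)
qed

lemma symbol_term_fourier:
  assumes v: "integrable lborel v" and B: "\<And>x. norm (v x) \<le> B" and c: "continuous_on UNIV v"
  shows "symbol_term k (fourier v) = v (2 *\<^sub>R p k) - \<sigma> * v q"
proof -
  let ?\<kappa> = "\<lambda>n t. complex_of_real (gauss_mult (1 / real (Suc n)) (t::'a))"
  have i: "integrable lborel (\<lambda>t. fourier v t * ee (t \<bullet> a) * ?\<kappa> n t)" for a n
  proof -
    have "integrable lborel (\<lambda>t. (?\<kappa> n t * fourier v t) * ee (t \<bullet> a))"
      by (intro integrable_mult_ee integrable_mult_fourier integrable_gauss_mult v) simp_all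
    then show ?thesis by (simp only: mult_ac)
  qed
  have eq: "(\<integral>t. fourier v t * symbol_exp k t * ?\<kappa> n t \<partial>lborel)
     = (\<integral>t. fourier v t * ee (t \<bullet> (2 *\<^sub>R p k)) * ?\<kappa> n t \<partial>lborel) - \<sigma> * (\<integral>t. fourier v t * ee (t \<bullet> q) * ?\<kappa> n t \<partial>lborel)" for n
  proof -
    have "fourier v t * symbol_exp k t * ?\<kappa> n t = fourier v t * ee (t \<bullet> (2 *\<^sub>R p k)) * ?\<kappa> n t - \<sigma> * (fourier v t * ee (t \<bullet> q) * ?\<kappa> n t)" for t
      by (simp add: symbol_exp_def algebra_simps)
    then show ?thesis by (simp only: integral_mult_right_zero Bochner_Integration.integral_diff[OF i integrable_mult_right[OF i]])
  qed
  have lim: "(\<lambda>n. \<integral>t. fourier v t * ee (t \<bullet> a) * ?\<kappa> n t \<partial>lborel) \<longlonglongrightarrow> v a" for a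
    using c by (intro fourier_inversion_gauss[OF v B]) (simp add: continuous_on_eq_continuous_at)
  show ?thesis unfolding symbol_term_def eq by (intro limI tendsto_intros lim)
qed

text \<open>Every test function of \<open>2\<Omega>\<close> vanishes at \<open>q\<close>, so the
  correction is invisible there and \<open>fourier_distr symbol\<close> acts as the sum of the point
  masses at \<open>2 *\<^sub>R p k\<close>.\<close>

lemma symbol_fourier:
  assumes "integrable lborel v" "\<And>x. norm (v x) \<le> B" "continuous_on UNIV v" "v q = 0"
  shows "symbol (fourier v) = (\<Sum>k. v (2 *\<^sub>R p k))"
  unfolding symbol_def by (simp add: symbol_term_fourier[OF assms(1-3)] assms(4))

lemma symbol_term_bound: "u \<in> schwartz \<Longrightarrow> norm (symbol_term k u) \<le> (1 / 2) ^ k * (C * seminorm_sum M u)"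
  using symbol_bound by (simp add: symbol_term_integrable schwartz_integrable_L2 symbol_exp_def)

lemma symbol_term_summable: "u \<in> schwartz \<Longrightarrow> summable (\<lambda>k. symbol_term k u)"
  by (rule summable_comparison_test'[where N=0, OF _ symbol_term_bound]) (auto intro!: summable_mult2)

lemma tempered_symbol: "tempered_distribution symbol"
proof -
  have add: "symbol (\<lambda>x. f x + g x) = symbol f + symbol g" if fg: "f \<in> schwartz" "g \<in> schwartz" for f g
  proof -
    have "symbol_term k (\<lambda>x. f x + g x) = symbol_term k f + symbol_term k g" for k
      using fg by (simp add: symbol_term_integrable schwartz_integrable_L2 ring_distribs)
    then show ?thesis unfolding symbol_def using fg by (simp add: suminf_add symbol_term_summable)
  qed
  have cm: "symbol (\<lambda>x. c * f x) = c * symbol f" if f: "f \<in> schwartz" for f c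
  proof -
    have "symbol_term k (\<lambda>x. c * f x) = c * symbol_term k f" for k
      using f by (simp add: symbol_term_integrable schwartz_integrable_L2 mult.assoc)
    then show ?thesis unfolding symbol_def using f by (simp add: suminf_mult symbol_term_summable)
  qed
  have bound: "norm (symbol f) \<le> (2 * C) * seminorm_sum M f" if "f \<in> schwartz" for f
  proof -
    have s: "summable (\<lambda>k. (1 / 2) ^ k * (C * seminorm_sum M f))" by (auto intro!: summable_mult2)
    then have sn: "summable (\<lambda>k. norm (symbol_term k f))"
      by (rule summable_comparison_test'[where N=0]) (use symbol_term_bound[OF that] in simp)
    have "norm (symbol f) \<le> (\<Sum>k. norm (symbol_term k f))" unfolding symbol_def by (rule summable_norm[OF sn])
    also have "\<dots> \<le> (\<Sum>k. (1 / 2) ^ k * (C * seminorm_sum M f))" by (rule suminf_le[OF symbol_term_bound[OF that] sn s])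
    also have "\<dots> = 2 * (C * seminorm_sum M f)" by (subst suminf_mult2[symmetric]) (auto simp: suminf_geometric)
    finally show ?thesis by simp
  qed
  show ?thesis unfolding tempered_distribution_def
    using add cm bound unfolding seminorm_sum_def by blast
qed

section \<open>The reflection operator and the Hankel operator it induces\<close>

definition reflected :: "('a \<Rightarrow> complex) \<Rightarrow> 'a \<Rightarrow> complex" where
  "reflected g x = (\<Sum>k. indicator (W k) x * g (2 *\<^sub>R p k - x))"

lemma reflected_in: "x \<in> W k \<Longrightarrow> reflected g x = g (2 *\<^sub>R p k - x)"
proof -
  assume x: "x \<in> W k"
  have "(\<Sum>j. indicator (W j) x * g (2 *\<^sub>R p j - x)) = (\<Sum>j\<in>{k}. indicator (W j) x * g (2 *\<^sub>R p j - x))"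
    by (rule suminf_finite) (use x W_disjoint in \<open>auto simp: indicator_def\<close>)
  then show ?thesis using x by (simp add: reflected_def)
qed

lemma reflected_notin: "(\<And>k. x \<notin> W k) \<Longrightarrow> reflected g x = 0"
  by (simp add: reflected_def)

lemma reflected_measurable [measurable]:
  assumes [measurable]: "g \<in> borel_measurable borel" shows "reflected g \<in> borel_measurable borel"
  unfolding reflected_def[abs_def] by measurable

text \<open>The reflection at \<open>p k\<close> maps \<open>W k\<close> to itself and preserves
  Lebesgue measure, so the k-th piece has the same square integral as \<open>g\<close> on
  \<open>W k\<close>. Disjointness lets the pieces add up to no more than the square integral of
  \<open>g\<close>.\<close>

lemma reflected_L2:
  assumes g: "g \<in> L2"
  shows "reflected g \<in> L2" "L2_norm (reflected g) \<le> L2_norm g"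
proof -
  note [measurable] = L2D[OF g]
  define h where "h = (\<lambda>x. ennreal ((norm (g x))\<^sup>2))"
  have [measurable]: "h \<in> borel_measurable borel" unfolding h_def by measurable
  have ind1: "(\<Sum>k. indicator (W k) x :: ennreal) \<le> 1" for x
  proof (cases "\<exists>k. x \<in> W k")
    case True
    then obtain k where k: "x \<in> W k" by blast
    have "(\<Sum>j. indicator (W j) x :: ennreal) = (\<Sum>j\<in>{k}. indicator (W j) x)"
      by (rule suminf_finite) (use k W_disjoint in \<open>auto simp: indicator_def\<close>)
    then show ?thesis using k by simp
  qed simp
  have "(\<integral>\<^sup>+x. ennreal ((norm (reflected g x))\<^sup>2) \<partial>lborel) = (\<integral>\<^sup>+x. (\<Sum>k. indicator (W k) x * h (2 *\<^sub>R p k - x)) \<partial>lborel)"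
  proof (rule nn_integral_cong)
    fix x
    show "ennreal ((norm (reflected g x))\<^sup>2) = (\<Sum>k. indicator (W k) x * h (2 *\<^sub>R p k - x))"
    proof (cases "\<exists>k. x \<in> W k")
      case True
      then obtain k where k: "x \<in> W k" by blast
      have "(\<Sum>j. indicator (W j) x * h (2 *\<^sub>R p j - x)) = (\<Sum>j\<in>{k}. indicator (W j) x * h (2 *\<^sub>R p j - x))"
        by (rule suminf_finite) (use k W_disjoint in \<open>auto simp: indicator_def\<close>)
      then show ?thesis using k by (simp add: reflected_in h_def)
    next
      case False
      then show ?thesis by (simp add: reflected_notin)
    qed
  qed
  also have "\<dots> = (\<Sum>k. \<integral>\<^sup>+x. indicator (W k) x * h (2 *\<^sub>R p k - x) \<partial>lborel)"
    by (rule nn_integral_suminf) measurable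
  also have "\<dots> = (\<Sum>k. \<integral>\<^sup>+x. indicator (W k) x * h x \<partial>lborel)"
  proof (rule suminf_cong)
    fix k
    have "(\<integral>\<^sup>+x. indicator (W k) x * h (2 *\<^sub>R p k - x) \<partial>lborel) = (\<integral>\<^sup>+x. indicator (W k) (2 *\<^sub>R p k - x) * h (2 *\<^sub>R p k - x) \<partial>lborel)"
      by (simp add: indicator_def W_symmetric)
    also have "\<dots> = (\<integral>\<^sup>+x. indicator (W k) x * h x \<partial>lborel)" by (rule nn_integral_lborel_reflect) measurable
    finally show "(\<integral>\<^sup>+x. indicator (W k) x * h (2 *\<^sub>R p k - x) \<partial>lborel) = (\<integral>\<^sup>+x. indicator (W k) x * h x \<partial>lborel)" .
  qed
  also have "\<dots> = (\<integral>\<^sup>+x. (\<Sum>k. indicator (W k) x * h x) \<partial>lborel)"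
    by (rule nn_integral_suminf[symmetric]) measurable
  also have "\<dots> \<le> (\<integral>\<^sup>+x. h x \<partial>lborel)"
  proof (rule nn_integral_mono)
    fix x
    have "(\<Sum>k. indicator (W k) x * h x) = (\<Sum>k. indicator (W k) x) * h x" by (rule ennreal_suminf_multc)
    also have "\<dots> \<le> 1 * h x" by (rule mult_right_mono[OF ind1]) simp
    finally show "(\<Sum>k. indicator (W k) x * h x) \<le> h x" by simp
  qed
  also have "\<dots> = ennreal ((L2_norm g)\<^sup>2)" unfolding h_def by (rule nn_integral_L2[OF g])
  finally show "reflected g \<in> L2" "L2_norm (reflected g) \<le> L2_norm g"
    using L2_norm_leI[of "reflected g" "L2_norm g"] by (auto simp: L2_norm_nonneg)
qed

text \<open>The function lives on the union of the \<open>W k\<close>, which has finite measure, and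
  there \<open>norm h \<le> (norm h)\<^sup>2 + 1\<close>. Integrability is what makes
  \<open>hankel_op\<close> an absolutely convergent integral.\<close>

lemma reflected_integrable:
  assumes g: "g \<in> L2" shows "integrable lborel (reflected g)"
proof (rule Bochner_Integration.integrable_bound)
  note [measurable] = L2D[OF g]
  show "integrable lborel (\<lambda>x. (norm (reflected g x))\<^sup>2 + indicator (\<Union>k. W k) x :: real)"
    using reflected_L2(1)[OF g] finite_measure
    by (intro Bochner_Integration.integrable_add) (auto simp: L2_def W_def[symmetric])
  show "AE x in lborel. norm (reflected g x) \<le> norm ((norm (reflected g x))\<^sup>2 + indicator (\<Union>k. W k) x :: real)"
  proof (intro AE_I2)
    fix x
    show "norm (reflected g x) \<le> norm ((norm (reflected g x))\<^sup>2 + indicator (\<Union>k. W k) x :: real)"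
    proof (cases "\<exists>k. x \<in> W k")
      case True
      have "2 * norm (reflected g x) \<le> (norm (reflected g x))\<^sup>2 + 1" using sum_squares_bound[of "norm (reflected g x)" 1] by simp
      then have "norm (reflected g x) \<le> (norm (reflected g x))\<^sup>2 + 1" using norm_ge_zero[of "reflected g x"] by linarith
      then show ?thesis using True by (auto simp: indicator_def)
    next
      case False then show ?thesis by (simp add: reflected_notin)
    qed
  qed
  show "reflected g \<in> borel_measurable lborel" by measurable
qed

text \<open>The transform of an L2 function is known only up to a null set, and countably many
  reflections of a null set again form a null set.\<close>

lemma reflected_cong_AE:
  assumes "AE x in lborel. g x = g' x" shows "AE x in lborel. reflected g x = reflected g' x"
proof -
  have "AE x in lborel. \<forall>k. g (2 *\<^sub>R p k - x) = g' (2 *\<^sub>R p k - x)"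
    unfolding AE_all_countable using AE_lborel_reflect[OF assms] by blast
  then show ?thesis by eventually_elim (simp add: reflected_def)
qed

lemma reflected_add: "reflected (\<lambda>x. f x + g x) x = reflected f x + reflected g x"
  by (cases "\<exists>k. x \<in> W k") (auto simp: reflected_in reflected_notin)

lemma reflected_cmult: "reflected (\<lambda>x. c * f x) x = c * reflected f x"
  by (cases "\<exists>k. x \<in> W k") (auto simp: reflected_in reflected_notin)

text \<open>\<open>L2_fourier\<close> is a relation, so a representative has to be picked. By
  \<open>hankel_op_eq\<close> the operator does not depend on the choice, not even at single points;
  linearity follows by taking sums and multiples of representatives.\<close>

definition ft :: "('a \<Rightarrow> complex) \<Rightarrow> 'a \<Rightarrow> complex" where
  "ft f = (SOME g. L2_fourier f g \<and> (AE x in lborel. x \<notin> \<Omega> \<longrightarrow> g x = 0))"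

definition hankel_op :: "('a \<Rightarrow> complex) \<Rightarrow> 'a \<Rightarrow> complex" where
  "hankel_op f t = fourier (reflected (ft f)) (- t)"

lemma ft: "f \<in> PW \<Omega> \<Longrightarrow> L2_fourier f (ft f)"
  and ft_L2: "f \<in> PW \<Omega> \<Longrightarrow> ft f \<in> L2"
proof -
  assume "f \<in> PW \<Omega>"
  then have "\<exists>g. L2_fourier f g \<and> (AE x in lborel. x \<notin> \<Omega> \<longrightarrow> g x = 0)" by (simp add: PW_def)
  then have "L2_fourier f (ft f) \<and> (AE x in lborel. x \<notin> \<Omega> \<longrightarrow> ft f x = 0)" unfolding ft_def by (rule someI_ex)
  then show "L2_fourier f (ft f)" "ft f \<in> L2" by (auto simp: L2_fourier_iff)
qed

lemma PW_add: "f \<in> PW \<Omega> \<Longrightarrow> g \<in> PW \<Omega> \<Longrightarrow> (\<lambda>x. f x + g x) \<in> PW \<Omega>"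
  unfolding PW_def
proof safe
  fix F G assume "L2_fourier f F" "AE x in lborel. x \<notin> \<Omega> \<longrightarrow> F x = 0" "L2_fourier g G" "AE x in lborel. x \<notin> \<Omega> \<longrightarrow> G x = 0"
  then show "\<exists>ga. L2_fourier (\<lambda>x. f x + g x) ga \<and> (AE x in lborel. x \<notin> \<Omega> \<longrightarrow> ga x = 0)"
    by (intro exI[of _ "\<lambda>x. F x + G x"] conjI L2_fourier_add) (auto elim: AE_mp)
qed (auto intro: L2_add)

lemma PW_cmult: "f \<in> PW \<Omega> \<Longrightarrow> (\<lambda>x. c * f x) \<in> PW \<Omega>"
  unfolding PW_def
proof safe
  fix F assume "L2_fourier f F" "AE x in lborel. x \<notin> \<Omega> \<longrightarrow> F x = 0"
  then show "\<exists>ga. L2_fourier (\<lambda>x. c * f x) ga \<and> (AE x in lborel. x \<notin> \<Omega> \<longrightarrow> ga x = 0)"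
    by (intro exI[of _ "\<lambda>x. c * F x"] conjI L2_fourier_cmult) auto
qed (auto intro: L2_cmult)

lemma hankel_op_fourier:
  assumes "f \<in> PW \<Omega>" shows "L2_fourier (hankel_op f) (reflected (ft f))"
  using L2_fourier_inverse(1)[OF reflected_integrable reflected_L2(1)] ft_L2[OF assms] by (simp add: hankel_op_def[abs_def])

lemma hankel_op_PW: assumes "f \<in> PW \<Omega>" shows "hankel_op f \<in> PW \<Omega>"
proof -
  have "reflected (ft f) x = 0" if "x \<notin> \<Omega>" for x
    using that by (intro reflected_notin) (auto simp: W_def)
  then show ?thesis using hankel_op_fourier[OF assms] unfolding PW_def L2_fourier_iff by blast
qed

lemma hankel_op_eq:
  assumes "f \<in> PW \<Omega>" "L2_fourier f g" shows "hankel_op f t = fourier (reflected g) (- t)"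
proof -
  have g: "g \<in> L2" using assms by (simp add: L2_fourier_iff)
  note [measurable] = L2D[OF g] L2D[OF ft_L2[OF assms(1)]]
  have "AE x in lborel. reflected (ft f) x = reflected g x" by (rule reflected_cong_AE) (rule L2_fourier_unique[OF ft[OF assms(1)] assms(2)])
  then have "AE x in lborel. reflected (ft f) x * ee (- (- t \<bullet> x)) = reflected g x * ee (- (- t \<bullet> x))" by eventually_elim simp
  then show ?thesis unfolding hankel_op_def fourier_eq by (intro integral_cong_AE) measurable
qed

lemma hankel_op_bounded: "bounded_operator_on (PW \<Omega>) hankel_op"
  unfolding bounded_operator_on_def
proof (intro conjI ballI allI)
  show "hankel_op f \<in> PW \<Omega>" if "f \<in> PW \<Omega>" for f using hankel_op_PW[OF that] .
  show "AE x in lborel. hankel_op (\<lambda>y. f y + g y) x = hankel_op f x + hankel_op g x" if fg: "f \<in> PW \<Omega>" "g \<in> PW \<Omega>" for f g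
  proof (intro AE_I2)
    fix x
    have "hankel_op (\<lambda>y. f y + g y) x = fourier (reflected (\<lambda>y. ft f y + ft g y)) (- x)"
      by (rule hankel_op_eq[OF PW_add[OF fg] L2_fourier_add[OF ft ft]]) (use fg in auto)
    then show "hankel_op (\<lambda>y. f y + g y) x = hankel_op f x + hankel_op g x"
      unfolding reflected_add[abs_def] using fg by (simp add: fourier_add reflected_integrable ft_L2 hankel_op_def)
  qed
  show "AE x in lborel. hankel_op (\<lambda>y. c * f y) x = c * hankel_op f x" if f: "f \<in> PW \<Omega>" for f c
  proof (intro AE_I2)
    fix x
    have "hankel_op (\<lambda>y. c * f y) x = fourier (reflected (\<lambda>y. c * ft f y)) (- x)"
      by (rule hankel_op_eq[OF PW_cmult[OF f] L2_fourier_cmult[OF ft]]) (use f in auto)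
    then show "hankel_op (\<lambda>y. c * f y) x = c * hankel_op f x"
      unfolding reflected_cmult[abs_def] by (simp add: fourier_cmult hankel_op_def)
  qed
  have "L2_norm (hankel_op f) \<le> 1 * L2_norm f" if f: "f \<in> PW \<Omega>" for f
  proof -
    have "L2_norm (hankel_op f) \<le> L2_norm (reflected (ft f))"
      using L2_fourier_inverse(2)[OF reflected_integrable reflected_L2(1)] ft_L2[OF f] by (simp add: hankel_op_def[abs_def])
    also have "\<dots> \<le> L2_norm (ft f)" by (rule reflected_L2(2)[OF ft_L2[OF f]])
    also have "\<dots> \<le> L2_norm f" by (rule L2_fourier_norm_le[OF ft[OF f]])
    finally show ?thesis by simp
  qed
  then show "\<exists>C. \<forall>f\<in>PW \<Omega>. L2_norm (hankel_op f) \<le> C * L2_norm f" by blast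
qed

lemma sum_in_2Omega: "x \<in> \<Omega> \<Longrightarrow> y \<in> \<Omega> \<Longrightarrow> x + y \<in> (\<lambda>x. 2 *\<^sub>R x) ` \<Omega>"
proof -
  assume "x \<in> \<Omega>" "y \<in> \<Omega>"
  then have "(1/2) *\<^sub>R x + (1/2) *\<^sub>R y \<in> \<Omega>" using convex_Omega by (intro convexD) auto
  moreover have "x + y = 2 *\<^sub>R ((1/2) *\<^sub>R x + (1/2) *\<^sub>R y)" by (simp add: scaleR_add_right)
  ultimately show ?thesis by blast
qed

text \<open>For \<open>x \<in> \<Omega>\<close> the value \<open>F (2 *\<^sub>R p k - x)\<close> is
  nonzero only if \<open>x \<in> W k\<close>, so the indicators in \<open>reflected\<close> come for
  free. The correction gives \<open>F (q - x) = 0\<close>, because \<open>q\<close> is not a sum of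
  two points of \<open>\<Omega>\<close>.\<close>

lemma shift_pairing_symbol:
  assumes F: "F \<in> test_functions \<Omega>" and x: "x \<in> \<Omega>"
  shows "shift_pairing (fourier_distr symbol) F x = reflected F x"
proof -
  obtain B where B: "\<And>x. norm (F x) \<le> B" using test_functions_bounded[OF F] by metis
  have "F (q - x) = 0"
  proof (rule test_functionsD(6)[OF F], rule notI)
    assume "q - x \<in> \<Omega>"
    then show False using sum_in_2Omega[OF _ x, of "q - x"] q_notin by simp
  qed
  moreover have "integrable lborel (\<lambda>z. F (z - x))"
    by (rule integrable_lborel_translate) (rule test_functions_integrable_L2(1)[OF F])
  moreover have "continuous_on UNIV (\<lambda>z. F (z - x))"
    by (rule continuous_on_compose2[OF test_functionsD(4)[OF F, of UNIV]]) (auto intro: continuous_intros)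
  ultimately have "symbol (fourier (\<lambda>z. F (z - x))) = (\<Sum>k. F (2 *\<^sub>R p k - x))"
    using B by (intro symbol_fourier) auto
  also have "\<dots> = reflected F x"
    unfolding reflected_def
  proof (rule suminf_cong)
    show "F (2 *\<^sub>R p k - x) = indicator (W k) x * F (2 *\<^sub>R p k - x)" for k
      using x test_functionsD(6)[OF F, of "2 *\<^sub>R p k - x"] by (auto simp: indicator_def W_def)
  qed
  finally show ?thesis by (simp add: shift_pairing_def fourier_distr_def)
qed

lemma symbol_generates_bounded_hankel: "generates_bounded_hankel symbol \<Omega>"
  unfolding generates_bounded_hankel_def
proof (intro exI[of _ hankel_op] conjI ballI hankel_op_bounded)
  fix f assume "f \<in> hankel_domain \<Omega>"
  then obtain F where f: "f \<in> PW \<Omega>" and F: "F \<in> test_functions \<Omega>" "L2_fourier f F" by (auto simp: hankel_domain_def)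
  have "AE x in lborel. reflected (ft f) x = reflected F x" by (rule reflected_cong_AE) (rule L2_fourier_unique[OF ft[OF f] F(2)])
  then have "AE x in lborel. x \<in> \<Omega> \<longrightarrow> reflected (ft f) x = shift_pairing (fourier_distr symbol) F x"
    by eventually_elim (simp add: shift_pairing_symbol[OF F(1)])
  then show "hankel symbol \<Omega> f (hankel_op f)"
    unfolding hankel_def using f hankel_op_PW[OF f] F hankel_op_fourier[OF f] by blast
qed

end

section \<open>No bounded function has the same Fourier transform as the symbol on 2 Omega\<close>

context reflections begin

lemma refuting_test_function:
  obtains s v V where "s > (0::real)" "v \<in> test_functions UNIV" "integrable lborel V" "V \<in> L2"
    "L2_norm v = sqrt s" "L2_norm V = sqrt (real n * s)"
    "conv V v \<in> test_functions ((\<lambda>x. 2 *\<^sub>R x) ` \<Omega>)"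
    "(\<Sum>j. conv V v (2 *\<^sub>R p j)) = of_real (real n * s)"
proof -
  have "\<forall>k. \<exists>e>0. cball (p k) e \<subseteq> W k" using open_W p_in_W open_contains_cball by blast
  then obtain e where e: "\<And>k. e k > 0" "\<And>k. cball (p k) (e k) \<subseteq> W k" by metis
  \<comment> \<open>The entry 1 keeps the minimum defined for \<open>n = 0\<close>.\<close>
  define r where "r = Min (insert 1 (e ` {..<n}))"
  have r: "r > 0" using e(1) by (auto simp: r_def)
  have rW: "cball (p k) r \<subseteq> W k" if "k < n" for k
  proof -
    have "r \<le> e k" using that by (auto simp: r_def)
    then show ?thesis using e(2)[of k] by (meson order.trans subset_cball)
  qed
  \<comment> \<open>Otherwise \<open>p j\<close> would lie in both \<open>W j\<close> and
    \<open>W k\<close>. Only \<open>k\<close> is restricted to be below \<open>n\<close>: the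
    indices \<open>j \<ge> n\<close> must be separated too, so that the infinite sum at the end
    reduces to its first \<open>n\<close> terms.\<close>
  have sep: "dist (2 *\<^sub>R p j) (2 *\<^sub>R p k) > 2 * r" if "k < n" "j \<noteq> k" for j k
  proof (rule ccontr)
    assume "\<not> ?thesis"
    moreover have "dist (2 *\<^sub>R p j) (2 *\<^sub>R p k) = 2 * dist (p k) (p j)"
      by (simp add: dist_norm norm_minus_commute flip: scaleR_diff_right)
    ultimately have "p j \<in> cball (p k) r" by simp
    then have "p j \<in> W k" using rW that by blast
    then show False using W_disjoint p_in_W that by blast
  qed
  obtain v0 :: "'a \<Rightarrow> real" where v0: "(\<lambda>x. complex_of_real (v0 x)) \<in> test_functions (ball 0 r)" "v0 0 > 0"
    "\<And>x. v0 x \<ge> 0" "\<And>x. v0 (- x) = v0 x" "\<And>x. v0 x \<noteq> 0 \<Longrightarrow> norm x < r"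
    by (rule bump_exists[OF r, where 'a='a]) blast
  define v where "v = (\<lambda>x. complex_of_real (v0 x))"
  have v: "v \<in> test_functions UNIV" using v0(1) test_functions_mono unfolding v_def by blast
  have "continuous_on UNIV v0" using continuous_on_Re[OF test_functionsD(4)[OF v, of UNIV]] by (simp add: v_def)
  then have [measurable]: "v0 \<in> borel_measurable borel" by (rule borel_measurable_continuous_onI)
  define s where "s = (\<integral>x. (v0 x)\<^sup>2 \<partial>lborel)"
  have int2: "integrable lborel (\<lambda>x. (v0 x)\<^sup>2)" using test_functions_integrable_L2(2)[OF v] by (simp add: v_def L2_def)
  have "s > 0" unfolding s_def
    using continuous_on_Re[OF test_functionsD(4)[OF v, of UNIV]] v0(2)
    by (intro integral_pos_continuous[OF _ int2, of 0]) (auto simp: v_def intro!: continuous_on_power)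
  have Lv: "L2_norm v = sqrt s" by (simp add: L2_norm_def v_def s_def)
  define V0 where "V0 = (\<lambda>y. \<Sum>k<n. v0 (y - 2 *\<^sub>R p k))"
  define V where "V = (\<lambda>y. complex_of_real (V0 y))"
  have V_eq: "V = (\<lambda>y. \<Sum>k<n. v (y - 2 *\<^sub>R p k))" by (simp add: V_def V0_def v_def)
  have Vint: "integrable lborel V"
    unfolding V_eq by (intro Bochner_Integration.integrable_sum integrable_lborel_translate test_functions_integrable_L2[OF v])
  have disj0: "v0 (y - 2 *\<^sub>R p k) * v0 (y - 2 *\<^sub>R p j) = 0" if "k < n" "j \<noteq> k" for y j k
  proof (rule ccontr)
    assume "\<not> ?thesis"
    then have "norm (y - 2 *\<^sub>R p k) < r" "norm (y - 2 *\<^sub>R p j) < r" using v0(5) by auto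
    then have "dist (2 *\<^sub>R p j) (2 *\<^sub>R p k) < 2 * r"
      using dist_triangle[of "2 *\<^sub>R p j" "2 *\<^sub>R p k" y] by (simp add: dist_norm norm_minus_commute)
    then show False using sep[OF that] by simp
  qed
  have sq: "(V0 y)\<^sup>2 = (\<Sum>k<n. (v0 (y - 2 *\<^sub>R p k))\<^sup>2)" for y
  proof -
    have "(V0 y)\<^sup>2 = (\<Sum>k<n. \<Sum>j<n. v0 (y - 2 *\<^sub>R p k) * v0 (y - 2 *\<^sub>R p j))"
      by (simp add: V0_def power2_eq_square sum_product)
    also have "\<dots> = (\<Sum>k<n. \<Sum>j\<in>{k}. v0 (y - 2 *\<^sub>R p k) * v0 (y - 2 *\<^sub>R p j))"
      using disj0 by (intro sum.cong sum.mono_neutral_right) auto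
    finally show ?thesis by (simp add: power2_eq_square)
  qed
  have int2t: "integrable lborel (\<lambda>y. (v0 (y - c))\<^sup>2)" for c using integrable_lborel_translate[OF int2] .
  have intV: "integrable lborel (\<lambda>y. (V0 y)\<^sup>2)" unfolding sq using int2t by simp
  have sV: "(\<integral>y. (V0 y)\<^sup>2 \<partial>lborel) = real n * s"
  proof -
    have "(\<integral>y. (v0 (y - c))\<^sup>2 \<partial>lborel) = s" for c
      unfolding s_def by (rule integral_lborel_translate) measurable
    then show ?thesis unfolding sq using int2t by simp
  qed
  have V2: "V \<in> L2" using intV Vint by (auto simp: L2_def V_def)
  have LV: "L2_norm V = sqrt (real n * s)" by (simp add: L2_norm_def V_def sV)
  have supp: "\<exists>k<n. dist (2 *\<^sub>R p k) x < 2 * r" if "conv V v x \<noteq> 0" for x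
  proof -
    obtain y where y: "V y \<noteq> 0" "v (x - y) \<noteq> 0" using conv_nonzeroE[OF \<open>conv V v x \<noteq> 0\<close>] .
    then obtain k where k: "k < n" "v0 (y - 2 *\<^sub>R p k) \<noteq> 0"
      unfolding V_def V0_def by (metis (mono_tags, lifting) lessThan_iff of_real_0 sum.neutral)
    have "norm (y - 2 *\<^sub>R p k) < r" "norm (x - y) < r" using v0(5) k y by (auto simp: v_def)
    then have "dist (2 *\<^sub>R p k) x < 2 * r"
      using dist_triangle[of "2 *\<^sub>R p k" x y] by (simp add: dist_norm norm_minus_commute)
    then show ?thesis using k by blast
  qed
  have test: "conv V v \<in> test_functions ((\<lambda>x. 2 *\<^sub>R x) ` \<Omega>)"
  proof (rule test_functionsI)
    show "smooth (conv V v)" by (rule smooth_conv[OF Vint v])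
    \<comment> \<open>\<open>V\<close> contributes radius \<open>r\<close> around each
      \<open>2 *\<^sub>R p k\<close> and \<open>v\<close> another \<open>r\<close>. Halving such a
      ball gives \<open>cball (p k) r\<close>, which lies in \<open>W k\<close> and hence in
      \<open>\<Omega>\<close>.\<close>
    show "compact (\<Union>k<n. cball (2 *\<^sub>R p k) (2 * r))" by (intro compact_UN) auto
    show "(\<Union>k<n. cball (2 *\<^sub>R p k) (2 * r)) \<subseteq> (\<lambda>x. 2 *\<^sub>R x) ` \<Omega>"
    proof
      fix x assume "x \<in> (\<Union>k<n. cball (2 *\<^sub>R p k) (2 * r))"
      then obtain k where k: "k < n" "dist (2 *\<^sub>R p k) x \<le> 2 * r" by auto
      have "2 *\<^sub>R p k - x = 2 *\<^sub>R (p k - (1/2) *\<^sub>R x)" by (simp add: scaleR_diff_right)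
      then have "dist (2 *\<^sub>R p k) x = 2 * dist (p k) ((1/2) *\<^sub>R x)" by (simp add: dist_norm)
      then have "(1/2) *\<^sub>R x \<in> cball (p k) r" using k by simp
      then have "(1/2) *\<^sub>R x \<in> \<Omega>" using rW[OF k(1)] by (auto simp: W_def)
      moreover have "x = 2 *\<^sub>R ((1/2) *\<^sub>R x)" by simp
      ultimately show "x \<in> (\<lambda>x. 2 *\<^sub>R x) ` \<Omega>" by blast
    qed
    show "conv V v x = 0" if "x \<notin> (\<Union>k<n. cball (2 *\<^sub>R p k) (2 * r))" for x
      using supp[of x] that by force
  qed
  have val: "conv V v (2 *\<^sub>R p j) = of_real s" if "j < n" for j
  proof -
    have "V y * v (2 *\<^sub>R p j - y) = of_real ((v0 (y - 2 *\<^sub>R p j))\<^sup>2)" for y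
    proof -
      \<comment> \<open>Evenness of the bump turns the value of the convolution into the integral of
        a square; the other translates in \<open>V\<close> vanish wherever this one does
        not.\<close>
      have "v0 (2 *\<^sub>R p j - y) = v0 (y - 2 *\<^sub>R p j)" using v0(4)[of "y - 2 *\<^sub>R p j"] by simp
      then have "V y * v (2 *\<^sub>R p j - y) = of_real (\<Sum>k<n. v0 (y - 2 *\<^sub>R p j) * v0 (y - 2 *\<^sub>R p k))"
        by (simp add: V_def v_def V0_def sum_distrib_left sum_distrib_right mult.commute)
      also have "(\<Sum>k<n. v0 (y - 2 *\<^sub>R p j) * v0 (y - 2 *\<^sub>R p k)) = (\<Sum>k\<in>{j}. v0 (y - 2 *\<^sub>R p j) * v0 (y - 2 *\<^sub>R p k))"
        using disj0[OF \<open>j < n\<close>] \<open>j < n\<close> by (intro sum.mono_neutral_right) auto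
      finally show ?thesis by (simp add: power2_eq_square)
    qed
    then have "conv V v (2 *\<^sub>R p j) = of_real (\<integral>y. (v0 (y - 2 *\<^sub>R p j))\<^sup>2 \<partial>lborel)"
      unfolding conv_def by (simp only: integral_complex_of_real)
    also have "(\<integral>y. (v0 (y - 2 *\<^sub>R p j))\<^sup>2 \<partial>lborel) = s"
      unfolding s_def by (rule integral_lborel_translate) measurable
    finally show ?thesis .
  qed
  have "(\<Sum>j. conv V v (2 *\<^sub>R p j)) = (\<Sum>j<n. conv V v (2 *\<^sub>R p j))"
  proof (rule suminf_finite)
    fix j assume "j \<notin> {..<n}"
    then have "\<not> (\<exists>k<n. dist (2 *\<^sub>R p k) (2 *\<^sub>R p j) < 2 * r)"
      using sep[of _ j] by (force simp: dist_commute)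
    then show "conv V v (2 *\<^sub>R p j) = 0" using supp by blast
  qed simp
  also have "\<dots> = of_real (real n * s)" by (simp add: val)
  finally show ?thesis using that[OF \<open>s > 0\<close> v Vint V2 Lv LV test] by blast
qed

theorem nehari_fails: "\<not> nehari_theorem_true \<Omega>"
proof
  assume "nehari_theorem_true \<Omega>"
  then obtain \<psi> where psi: "\<psi> \<in> Linf"
    and eq: "distr_eq_on ((\<lambda>x. 2 *\<^sub>R x) ` \<Omega>) (fourier_distr symbol) (fourier_distr (distr_of \<psi>))"
    using tempered_symbol symbol_generates_bounded_hankel unfolding nehari_theorem_true_def by blast
  obtain D0 where psi_m: "\<psi> \<in> borel_measurable borel" and "AE x in lborel. norm (\<psi> x) \<le> D0" using psi by (auto simp: Linf_def)
  define D where "D = max D0 0"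
  have D: "AE x in lborel. norm (\<psi> x) \<le> D" "D \<ge> 0"
    using \<open>AE x in lborel. norm (\<psi> x) \<le> D0\<close> by (auto simp: D_def elim: eventually_mono)
  have sqrt_le: "sqrt (real n) \<le> D" if "n > 0" for n
  proof -
    obtain s v V where sv: "s > (0::real)" "v \<in> test_functions UNIV" "integrable lborel V" "V \<in> L2"
      "L2_norm v = sqrt s" "L2_norm V = sqrt (real n * s)"
      and test: "conv V v \<in> test_functions ((\<lambda>x. 2 *\<^sub>R x) ` \<Omega>)"
      and sum: "(\<Sum>j. conv V v (2 *\<^sub>R p j)) = of_real (real n * s)"
      using refuting_test_function[of n] by metis
    let ?u = "conv V v"
    obtain B where B: "\<And>x. norm (v x) \<le> B" using test_functions_bounded[OF sv(2)] by metis
    obtain B' where B': "\<And>x. norm (?u x) \<le> B'" using test_functions_bounded[OF test] by metis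
    have "?u q = 0" using test_functionsD(6)[OF test] q_notin by blast
    then have "fourier_distr symbol ?u = (\<Sum>j. ?u (2 *\<^sub>R p j))"
      unfolding fourier_distr_def
      using symbol_fourier[OF test_functions_integrable_L2(1)[OF test] B' test_functionsD(4)[OF test]] by blast
    then have val: "(\<integral>x. \<psi> x * fourier ?u x \<partial>lborel) = of_real (real n * s)"
      using eq test sum by (simp add: distr_eq_on_def fourier_distr_def distr_of_def)
    have vi: "integrable lborel v" "v \<in> L2" using test_functions_integrable_L2[OF sv(2)] by auto
    have fu: "fourier ?u x = fourier V x * fourier v x" for x by (rule fourier_conv(1)[OF sv(3) vi(1) B])
    have Vh: "fourier V \<in> L2" "L2_norm (fourier V) \<le> sqrt (real n * s)" using plancherel_le[OF sv(3,4)] sv(6) by auto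
    have vh: "fourier v \<in> L2" "L2_norm (fourier v) \<le> sqrt s" using plancherel_le[OF vi] sv(5) by auto
    have int: "integrable lborel (\<lambda>x. D * norm (fourier V x * fourier v x))"
      using L2_mult_integrable[OF Vh(1) vh(1)] by simp
    have "real n * s = norm (\<integral>x. \<psi> x * fourier ?u x \<partial>lborel)" unfolding val norm_of_real using sv(1) by simp
    also have "\<dots> \<le> (\<integral>x. norm (\<psi> x * fourier ?u x) \<partial>lborel)" by (rule integral_norm_bound)
    also have "\<dots> \<le> (\<integral>x. D * norm (fourier V x * fourier v x) \<partial>lborel)"
    proof (rule integral_mono_AE[OF _ int])
      show *: "AE x in lborel. norm (\<psi> x * fourier ?u x) \<le> D * norm (fourier V x * fourier v x)"
        using D(1) by eventually_elim (simp add: fu norm_mult mult_right_mono)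
      have [measurable]: "?u \<in> borel_measurable borel" using test by (rule test_functionsD(5))
      note [measurable] = psi_m
      show "integrable lborel (\<lambda>x. norm (\<psi> x * fourier ?u x))"
        by (rule Bochner_Integration.integrable_bound[OF int]) (measurable, use * in eventually_elim, use D(2) in simp)
    qed
    also have "\<dots> = D * (\<integral>x. norm (fourier V x * fourier v x) \<partial>lborel)" by simp
    also have "\<dots> \<le> D * (L2_norm (fourier V) * L2_norm (fourier v))"
      by (intro mult_left_mono L2_Cauchy_Schwarz Vh vh D)
    also have "\<dots> \<le> D * (sqrt (real n * s) * sqrt s)"
      by (intro mult_left_mono mult_mono Vh vh D) (auto simp: L2_norm_nonneg sv(1) less_imp_le)
    also have "\<dots> = D * (sqrt (real n) * s)" using sv(1) by (simp add: real_sqrt_mult)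
    finally have "sqrt (real n) * (sqrt (real n) * s) \<le> D * (sqrt (real n) * s)"
      by (simp flip: mult.assoc)
    moreover have "sqrt (real n) * s > 0" using sv(1) that by simp
    ultimately show ?thesis using mult_right_le_imp_le by blast
  qed
  obtain n where n: "D\<^sup>2 < real n" using reals_Archimedean2 by blast
  then have "n > 0" using zero_le_power2[of D] by (metis gr0I not_le of_nat_0)
  have "real n \<le> D\<^sup>2" using power_mono[OF sqrt_le[OF \<open>n > 0\<close>], of 2] by simp
  then show False using n by simp
qed

end

section \<open>Extreme points\<close>

text \<open>If \<open>x \<in> K\<close> lies on the sphere of radius \<open>r\<close> around
  \<open>e\<close>, then \<open>2 *\<^sub>R e - x\<close> is outside \<open>K\<close>, as
  \<open>e\<close> would otherwise be the midpoint of a segment in \<open>K\<close>. By compactness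
  its distance to \<open>K\<close> has a positive lower bound \<open>d\<close> on that sphere. A
  pair with \<open>x\<close> farther away is contracted towards \<open>e\<close> until
  \<open>x\<close> reaches the sphere; this stays in \<open>K\<close> and only decreases the
  distance of the sum from \<open>2 *\<^sub>R e\<close>.\<close>

lemma extreme_point_midpoint_stability:
  fixes K :: "'a::euclidean_space set"
  assumes "closed K" "convex K" and e: "e extreme_point_of K" and "r > 0"
  obtains d where "d > 0"
    "\<And>x y. x \<in> K \<Longrightarrow> y \<in> K \<Longrightarrow> dist (x + y) (2 *\<^sub>R e) < d \<Longrightarrow> dist x e < r"
proof -
  have eK: "e \<in> K" using e by (auto simp: extreme_point_of_def)
  let ?f = "\<lambda>x. infdist (2 *\<^sub>R e - x) K"
  let ?S = "K \<inter> sphere e r"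
  have "compact ?S" using \<open>closed K\<close> by (simp add: closed_Int_compact)
  have pos: "?f x > 0" if "x \<in> ?S" for x
  proof (rule ccontr)
    assume "\<not> ?f x > 0"
    then have "?f x = 0" using infdist_nonneg[of "2 *\<^sub>R e - x" K] by linarith
    then have "2 *\<^sub>R e - x \<in> K" using \<open>closed K\<close> eK in_closed_iff_infdist_zero by blast
    moreover have "e \<in> open_segment x (2 *\<^sub>R e - x)"
    proof -
      have "x \<noteq> e" using that \<open>r > 0\<close> by auto
      moreover have "2 *\<^sub>R (x - e) = 0" if "x = 2 *\<^sub>R e - x"
        using that by (simp add: scaleR_2 algebra_simps)
      ultimately have "x \<noteq> 2 *\<^sub>R e - x" by auto
      moreover have "e = midpoint x (2 *\<^sub>R e - x)" by (simp add: midpoint_def)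
      ultimately show ?thesis by (metis midpoint_in_open_segment)
    qed
    ultimately show False using e that by (auto simp: extreme_point_of_def)
  qed
  obtain d where d: "d > 0" "\<And>x. x \<in> ?S \<Longrightarrow> d \<le> ?f x"
  proof (cases "?S = {}")
    case True then show ?thesis using that[of 1] by auto
  next
    case False
    have "continuous_on ?S ?f" by (intro continuous_intros)
    then obtain z where "z \<in> ?S" "\<And>x. x \<in> ?S \<Longrightarrow> ?f z \<le> ?f x"
      using continuous_attains_inf[OF \<open>compact ?S\<close> False] by blast
    then show ?thesis using pos that by blast
  qed
  show ?thesis
  proof (rule that[OF d(1)], rule ccontr)
    fix x y assume xy: "x \<in> K" "y \<in> K" "dist (x + y) (2 *\<^sub>R e) < d" "\<not> dist x e < r"
    define l where "l = r / dist x e"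
    have "x \<noteq> e" using xy \<open>r > 0\<close> by auto
    then have l: "0 < l" "l \<le> 1" using xy \<open>r > 0\<close> unfolding l_def not_less
      by (simp_all add: divide_le_eq_1 zero_less_divide_iff)
    define x' y' where "x' = (1 - l) *\<^sub>R e + l *\<^sub>R x" and "y' = (1 - l) *\<^sub>R e + l *\<^sub>R y"
    have K: "x' \<in> K" "y' \<in> K" using xy l eK \<open>convex K\<close> unfolding x'_def y'_def by (auto intro!: convexD_alt[unfolded scaleR_scaleR])
    have "x' - e = l *\<^sub>R (x - e)" by (simp add: x'_def algebra_simps)
    then have "norm (x' - e) = r" using xy \<open>r > 0\<close> by (auto simp: l_def dist_norm)
    then have "x' \<in> ?S" using K by (auto simp: dist_norm norm_minus_commute)
    then have "d \<le> dist (2 *\<^sub>R e - x') y'" using d(2) infdist_le[OF K(2)] by (meson order.trans)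
    also have "2 *\<^sub>R e - x' - y' = l *\<^sub>R (2 *\<^sub>R e - (x + y))"
      by (simp add: x'_def y'_def algebra_simps scaleR_2)
    then have "dist (2 *\<^sub>R e - x') y' = l * dist (x + y) (2 *\<^sub>R e)"
      using l by (simp add: dist_norm norm_minus_commute)
    also have "\<dots> \<le> dist (x + y) (2 *\<^sub>R e)" using l by (intro mult_left_le_one_le) auto
    finally show False using xy by simp
  qed
qed

text \<open>An extreme point of the truncation inside the open square is extreme in
  \<open>K\<close>, since any segment of \<open>K\<close> through it can be contracted into the
  square. On each of the four sides there are at most two more, whence 8. What matters later is that
  the bound does not depend on \<open>R\<close>.\<close>

lemma card_extreme_points_truncation:
  fixes K :: "(real^2) set"
  assumes fin: "finite {x. x extreme_point_of K}"
  defines "Q \<equiv> \<lambda>R. {x::real^2. \<forall>i. \<bar>x $ i\<bar> \<le> R}"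
  assumes cK: "convex K"
  shows "finite {x. x extreme_point_of (K \<inter> Q R)}"
    and "card {x. x extreme_point_of (K \<inter> Q R)} \<le> card {x. x extreme_point_of K} + 8"
proof -
  let ?X = "{x. x extreme_point_of (K \<inter> Q R)}"
  \<comment> \<open>\<open>i\<close> and \<open>s\<close> name a side of the square, and
    \<open>b\<close> one of the two ends of the slice of the truncated set by the line of that side.
    In the plane an end of such a slice is a single point, so \<open>A\<close> contributes at most
    one point for each of its eight indices.\<close>
  define A where "A = (\<lambda>(i::2, s::bool, b::bool). {x \<in> ?X. x $ i = (if s then R else - R) \<and>
     (\<forall>y\<in>K \<inter> Q R. y $ i = x $ i \<longrightarrow> (\<forall>j. j \<noteq> i \<longrightarrow> (if b then y $ j \<le> x $ j else x $ j \<le> y $ j)))})"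
  have A1: "x = y" if "x \<in> A t" "y \<in> A t" for t x y
  proof -
    obtain i s b where t: "t = (i, s, b)" by (metis prod_cases3)
    have "x \<in> K \<inter> Q R" "y \<in> K \<inter> Q R" "x $ i = y $ i"
      using that by (auto simp: A_def t extreme_point_of_def)
    moreover have "x $ j = y $ j" if "j \<noteq> i" for j
      using \<open>x \<in> A t\<close> \<open>y \<in> A t\<close> calculation that
      by (cases b) (force simp: A_def t intro: antisym)+
    ultimately show "x = y" by (metis vec_eq_iff)
  qed
  have A: "finite (A t) \<and> card (A t) \<le> 1" for t
  proof (cases "A t = {}")
    case False
    then obtain x where "A t = {x}" using A1[of _ t] by blast
    then show ?thesis by simp
  qed simp
  have sub: "?X \<subseteq> {x. x extreme_point_of K} \<union> (\<Union>t. A t)"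
  proof
    fix x assume "x \<in> ?X"
    then have x: "x extreme_point_of (K \<inter> Q R)" by simp
    then have xKQ: "x \<in> K" "x \<in> Q R" by (auto simp: extreme_point_of_def)
    show "x \<in> {x. x extreme_point_of K} \<union> (\<Union>t. A t)"
    proof (cases "\<forall>i. \<bar>x $ i\<bar> < R")
      case True
      have "x extreme_point_of K"
        unfolding extreme_point_of_def
      proof (intro conjI ballI notI)
        show "x \<in> K" by fact
        fix a b assume ab: "a \<in> K" "b \<in> K" "x \<in> open_segment a b"
        then obtain u where u: "a \<noteq> b" "0 < u" "u < 1" "x = (1 - u) *\<^sub>R a + u *\<^sub>R b"
          by (auto simp: in_segment)
        have op: "open {y::real^2. \<forall>i. \<bar>y $ i\<bar> < R}"
          using open_box[of "\<chi> i. - R" "\<chi> i::2. R"] by (simp add: box_def abs_less_iff Basis_vec_def inner_axis conj_commute minus_less_iff)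
        then obtain d where d: "d > 0" "\<And>y. dist y x < d \<Longrightarrow> \<forall>i. \<bar>y $ i\<bar> < R"
          using True unfolding open_dist by blast
        \<comment> \<open>At most 1, so that contracting the segment towards \<open>x\<close> stays
          in \<open>K\<close>; and \<open>l * dist a b \<le> d / 2\<close>, so that both new
          endpoints fall into the square.\<close>
        define l where "l = min 1 (d / (2 * dist a b))"
        have nab: "norm (a - b) > 0" using u by simp
        have l: "0 < l" "l \<le> 1" "l * norm (a - b) < d"
          using d(1) nab unfolding l_def by (auto simp: min_def dist_norm field_simps)
        define a' b' where "a' = (1 - l) *\<^sub>R x + l *\<^sub>R a" and "b' = (1 - l) *\<^sub>R x + l *\<^sub>R b"
        have "a' - x = (l * u) *\<^sub>R (a - b)" "b' - x = (l * (1 - u)) *\<^sub>R (b - a)"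
          by (auto simp: a'_def b'_def u(4) algebra_simps)
        then have "dist a' x = u * (l * norm (a - b))" "dist b' x = (1 - u) * (l * norm (a - b))"
          using u l by (auto simp: dist_norm abs_mult norm_minus_commute)
        then have "dist a' x \<le> l * norm (a - b)" "dist b' x \<le> l * norm (a - b)"
          using u l by (auto intro!: mult_left_le_one_le)
        then have "dist a' x < d" "dist b' x < d" using l by auto
        then have "a' \<in> Q R" "b' \<in> Q R" using d(2) by (force simp: Q_def intro: less_imp_le)+
        moreover have "a' \<in> K" "b' \<in> K" using cK xKQ ab l unfolding a'_def b'_def by (auto intro: convexD_alt)
        moreover have "x \<in> open_segment a' b'"
        proof -
          have "b' - a' = l *\<^sub>R (b - a)" by (simp add: a'_def b'_def algebra_simps)
          then have "a' \<noteq> b'" using l u by auto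
          moreover have "x = (1 - u) *\<^sub>R a' + u *\<^sub>R b'"
            using arg_cong[OF u(4), of "\<lambda>z. l *\<^sub>R z"] by (simp add: a'_def b'_def algebra_simps)
          ultimately show ?thesis using u by (auto simp: in_segment)
        qed
        ultimately show False using x by (auto simp: extreme_point_of_def)
      qed
      then show ?thesis by simp
    next
      case False
      then obtain i where "\<bar>x $ i\<bar> = R" using xKQ by (force simp: Q_def not_less intro: antisym)
      then obtain s where s: "x $ i = (if s then R else - R)" by (metis abs_if minus_minus)
      obtain j where j: "j \<noteq> i" "\<And>k. k = i \<or> k = j"
        using that[of 1] that[of 2] exhaust_2[of i] exhaust_2 by fastforce
      have "(\<forall>y\<in>K \<inter> Q R. y $ i = x $ i \<longrightarrow> y $ j \<le> x $ j) \<or> (\<forall>y\<in>K \<inter> Q R. y $ i = x $ i \<longrightarrow> x $ j \<le> y $ j)"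
      proof (rule ccontr)
        assume "\<not> ?thesis"
        then obtain y z where yz: "y \<in> K \<inter> Q R" "z \<in> K \<inter> Q R" "y $ i = x $ i" "z $ i = x $ i"
          "x $ j < y $ j" "z $ j < x $ j" by force
        define u where "u = (x $ j - z $ j) / (y $ j - z $ j)"
        have u: "0 < u" "u < 1" using yz by (auto simp: u_def)
        have "x $ k = ((1 - u) *\<^sub>R z + u *\<^sub>R y) $ k" for k
          using j(2)[of k]
        proof
          assume "k = j"
          have "u * (y $ j - z $ j) = x $ j - z $ j" using yz by (simp add: u_def)
          then show ?thesis using \<open>k = j\<close> by (simp add: algebra_simps)
        qed (use yz in \<open>simp add: algebra_simps\<close>)
        then have "x = (1 - u) *\<^sub>R z + u *\<^sub>R y" by (metis vec_eq_iff)
        moreover have "z \<noteq> y" using yz by auto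
        ultimately have "x \<in> open_segment z y" using u by (auto simp: in_segment)
        then show False using x yz by (auto simp: extreme_point_of_def)
      qed
      then have "\<exists>b. x \<in> A (i, s, b)"
      proof
        assume "\<forall>y\<in>K \<inter> Q R. y $ i = x $ i \<longrightarrow> y $ j \<le> x $ j"
        then have "x \<in> A (i, s, True)" using x s j by (simp add: A_def) metis
        then show ?thesis ..
      next
        assume "\<forall>y\<in>K \<inter> Q R. y $ i = x $ i \<longrightarrow> x $ j \<le> y $ j"
        then have "x \<in> A (i, s, False)" using x s j by (simp add: A_def) metis
        then show ?thesis ..
      qed
      then show ?thesis by blast
    qed
  qed
  have f: "finite (\<Union>t. A t)" using A by auto
  show "finite ?X" using sub fin f finite_subset by blast
  have "card (\<Union>t. A t) \<le> (\<Sum>t\<in>UNIV. card (A t))" by (rule card_UN_le) simp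
  also have "\<dots> \<le> (\<Sum>t\<in>(UNIV::(2 \<times> bool \<times> bool) set). 1)" by (rule sum_mono) (use A in auto)
  also have "\<dots> = 8" by (simp add: card_UNIV_bool)
  finally have "card (\<Union>t. A t) \<le> 8" .
  moreover have "card ?X \<le> card ({x. x extreme_point_of K} \<union> (\<Union>t. A t))"
    using sub fin f by (intro card_mono) auto
  ultimately show "card ?X \<le> card {x. x extreme_point_of K} + 8"
    using card_Un_le[of "{x. x extreme_point_of K}" "\<Union>t. A t"] by linarith
qed

text \<open>A closed convex set with finitely many faces is a polyhedron, so faces are counted.
  Finitely many distinct faces already differ inside some large square \<open>Q R\<close>, where
  each slice is compact and determined by its extreme points. These are extreme points of
  \<open>K \<inter> Q R\<close>, of which there are at most \<open>M\<close>, so at most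
  \<open>2 ^ M\<close> faces can be told apart, whatever \<open>R\<close> is.\<close>

lemma polyhedron_if_finite_extreme_points:
  fixes K :: "(real^2) set"
  assumes "closed K" "convex K" and fin: "finite {x. x extreme_point_of K}"
  shows "polyhedron K"
proof -
  define M where "M = card {x. x extreme_point_of K} + 8"
  define Q where "Q = (\<lambda>R. {x::real^2. \<forall>i. \<bar>x $ i\<bar> \<le> R})"
  have Qcbox: "Q R = cbox (\<chi> i. - R) (\<chi> i. R)" for R
    by (auto simp: Q_def mem_box_cart abs_le_iff minus_le_iff)
  have "finite {F. F face_of K}"
  proof (rule ccontr)
    assume "infinite {F. F face_of K}"
    \<comment> \<open>One more face than an \<open>M\<close>-element set has subsets.\<close>
    then obtain G where G: "G \<subseteq> {F. F face_of K}" "finite G" "card G = Suc (2 ^ M)"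
      using infinite_arbitrarily_large by blast
    have "\<forall>A B :: (real^2) set. \<exists>z. A \<noteq> B \<longrightarrow> (z \<in> A) \<noteq> (z \<in> B)" by blast
    then obtain z :: "(real^2) set \<Rightarrow> (real^2) set \<Rightarrow> real^2"
      where z: "\<And>A B. A \<noteq> B \<Longrightarrow> (z A B \<in> A) \<noteq> (z A B \<in> B)" by metis
    have "bounded ((\<lambda>(A,B). z A B) ` (G \<times> G))" using G by (intro finite_imp_bounded) auto
    then obtain R where R: "\<And>A B. A \<in> G \<Longrightarrow> B \<in> G \<Longrightarrow> norm (z A B) \<le> R"
      unfolding bounded_iff by fastforce
    have zQ: "z A B \<in> Q R" if "A \<in> G" "B \<in> G" for A B
      using R[OF that] component_le_norm_cart[of "z A B"] by (auto simp: Q_def intro: order.trans)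
    define ex where "ex = (\<lambda>A. {x. x extreme_point_of (A \<inter> Q R)})"
    have cc: "compact (A \<inter> Q R) \<and> convex (A \<inter> Q R)" if "A \<in> G" for A
    proof -
      have "A face_of K" using that G by auto
      then have "closed A" "convex A" using assms face_of_imp_closed face_of_imp_convex by blast+
      then show ?thesis by (auto simp: Qcbox closed_Int_compact convex_Int)
    qed
    have "inj_on ex G"
    proof (rule inj_onI, rule ccontr)
      fix A B assume AB: "A \<in> G" "B \<in> G" "ex A = ex B" "A \<noteq> B"
      then have "A \<inter> Q R = B \<inter> Q R" using cc Krein_Milman_Minkowski unfolding ex_def by metis
      then show False using z[OF AB(4)] zQ[OF AB(1,2)] by blast
    qed
    moreover have "ex ` G \<subseteq> Pow (ex K)"
    proof -
      have "ex A \<subseteq> ex K" if "A \<in> G" for A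
      proof -
        have "A \<inter> Q R face_of K \<inter> Q R" using that G by (intro face_of_slice) (auto simp: Qcbox)
        then show ?thesis unfolding ex_def using extreme_point_of_face by blast
      qed
      then show ?thesis by blast
    qed
    moreover have "finite (ex K)" "card (ex K) \<le> M"
      using card_extreme_points_truncation[OF fin \<open>convex K\<close>, of R] by (auto simp: ex_def Q_def M_def)
    ultimately have "card G \<le> card (Pow (ex K))" by (metis card_inj_on_le finite_Pow_iff)
    also have "\<dots> \<le> 2 ^ M" using \<open>finite (ex K)\<close> \<open>card (ex K) \<le> M\<close> by (simp add: card_Pow)
    finally show False using G by simp
  qed
  then show ?thesis using assms by (simp add: polyhedron_eq_finite_faces)
qed

section \<open>Convergence of the symbol and choice of the points\<close>

lemma norm_ee_diff_le: "norm (ee a - ee b) \<le> 2 * pi * \<bar>a - b\<bar>"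
proof -
  have "ee a - ee b = ee b * (ee (a - b) - 1)" using ee_add[of b "a - b"] by (simp add: right_diff_distrib)
  moreover have "ee (a - b) = iexp (2 * pi * (a - b))" by (simp add: ee_def mult_ac)
  ultimately have "norm (ee a - ee b) = norm (iexp (2 * pi * (a - b)) - 1)" by (simp only: norm_mult norm_ee mult_1)
  also have "\<dots> \<le> \<bar>2 * pi * (a - b)\<bar>" using iexp_approx1[of "2 * pi * (a - b)" 0] by simp
  finally show ?thesis by (simp add: abs_mult)
qed

lemma seminorm_sum_nonneg: "u \<in> schwartz \<Longrightarrow> 0 \<le> seminorm_sum N u"
  unfolding seminorm_sum_def by (auto intro!: sum_nonneg schwartz_seminorm_nonneg)

lemma schwartz_seminorm_le_sum:
  assumes "u \<in> schwartz" "k \<le> N" "set vs \<subseteq> Basis" "length vs \<le> N"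
  shows "schwartz_seminorm k vs u \<le> seminorm_sum N u"
proof -
  have fin: "finite {vs :: 'a list. set vs \<subseteq> Basis \<and> length vs \<le> N}" by (rule finite_lists_length_le) simp
  have "schwartz_seminorm k vs u \<le> (\<Sum>vs | set vs \<subseteq> Basis \<and> length vs \<le> N. schwartz_seminorm k vs u)"
    using assms fin by (intro member_le_sum) (auto intro: schwartz_seminorm_nonneg)
  also have "\<dots> \<le> seminorm_sum N u"
    unfolding seminorm_sum_def using assms fin
    by (intro member_le_sum[of k "{..N}" "\<lambda>k. \<Sum>vs | set vs \<subseteq> Basis \<and> length vs \<le> N. schwartz_seminorm k vs u"])
       (auto intro!: sum_nonneg schwartz_seminorm_nonneg)
  finally show ?thesis .
qed

lemma integral_decay_nonneg: "0 \<le> integral\<^sup>L lborel decay"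
  using decay_bounds(1) by (intro Bochner_Integration.integral_nonneg) (auto intro: less_imp_le)

lemma norm_integral_le_decay:
  fixes f :: "'a::euclidean_space \<Rightarrow> complex"
  assumes "\<And>t. norm (f t) \<le> B * decay t"
  shows "norm (\<integral>t. f t \<partial>lborel) \<le> B * integral\<^sup>L lborel (decay :: 'a \<Rightarrow> real)"
proof (cases "integrable lborel f")
  case True
  have "norm (\<integral>t. f t \<partial>lborel) \<le> (\<integral>t. B * decay (t::'a) \<partial>lborel)"
    by (rule Bochner_Integration.integral_norm_bound_integral[OF True]) (use integrable_decay assms in auto)
  then show ?thesis by simp
next
  \<comment> \<open>The integral takes its default value 0, so it remains to see that
    \<open>B\<close> is nonnegative, which the hypothesis at the origin shows.\<close>
  case False
  have "0 \<le> B * decay (0::'a)" using assms norm_ge_zero order.trans by blast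
  then have "0 \<le> B" using decay_bounds(1)[of "0::'a"] by (simp add: zero_le_mult_iff)
  then show ?thesis using False integral_decay_nonneg[where 'a='a] by (simp add: not_integrable_integral_eq)
qed

text \<open>The two exponentials differ by at most \<open>2 * pi * norm t * norm (a - b)\<close>.
  The extra power of \<open>norm t\<close> is the reason for \<open>2 * DIM('a) + 1\<close> instead
  of \<open>2 * DIM('a)\<close> in the seminorms.\<close>

lemma exp_difference_bound:
  fixes u :: "'a::euclidean_space \<Rightarrow> complex"
  assumes u: "u \<in> schwartz"
  shows "norm (\<integral>t. u t * (ee (t \<bullet> a) - ee (t \<bullet> b)) \<partial>lborel)
    \<le> norm (a - b) * (2 * pi * integral\<^sup>L lborel (decay :: 'a \<Rightarrow> real) * seminorm_sum (2 * DIM('a) + 1) u)"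
proof -
  let ?S = "seminorm_sum (2 * DIM('a) + 1) u"
  have "norm (u t * (ee (t \<bullet> a) - ee (t \<bullet> b))) \<le> (2 * pi * norm (a - b) * ?S) * decay t" for t
  proof -
    have "norm (ee (t \<bullet> a) - ee (t \<bullet> b)) \<le> 2 * pi * \<bar>t \<bullet> (a - b)\<bar>"
      using norm_ee_diff_le[of "t \<bullet> a" "t \<bullet> b"] by (simp add: inner_diff_right)
    also have "\<dots> \<le> 2 * pi * (norm (a - b) * (1 + norm t))"
      using Cauchy_Schwarz_ineq2[of t "a - b"] by (intro mult_left_mono) (auto simp: algebra_simps intro: order.trans)
    finally have "norm (u t * (ee (t \<bullet> a) - ee (t \<bullet> b))) \<le> norm (u t) * (2 * pi * (norm (a - b) * (1 + norm t)))"
      by (simp add: norm_mult mult_left_mono)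
    also have "\<dots> = 2 * pi * norm (a - b) * ((1 + norm t) ^ 1 * norm (iter_deriv [] u t))" by simp
    also have "\<dots> \<le> 2 * pi * norm (a - b) * (?S * decay t)"
    proof (rule mult_left_mono)
      have "(1 + norm t) ^ 1 * norm (iter_deriv [] u t) \<le> schwartz_seminorm (1 + 2 * DIM('a)) [] u * decay t"
        by (rule schwartz_decay[OF u]) simp
      also have "\<dots> \<le> ?S * decay t"
        using schwartz_seminorm_le_sum[OF u, of "1 + 2 * DIM('a)" "2 * DIM('a) + 1" "[]"] decay_bounds(1)[of t]
        by (intro mult_right_mono) auto
      finally show "(1 + norm t) ^ 1 * norm (iter_deriv [] u t) \<le> ?S * decay t" .
    qed simp
    finally show ?thesis by (simp add: mult.assoc)
  qed
  from norm_integral_le_decay[OF this] show ?thesis by (simp add: mult_ac)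
qed

text \<open>Shifting by \<open>s = a / (2 |a|\<^sup>2)\<close> changes the sign of the exponential, so the integral is half that
  of \<open>u(t) - u(t + s)\<close> against it: this replaces an integration by parts.\<close>

lemma exp_decay_bound:
  fixes u :: "'a::euclidean_space \<Rightarrow> complex"
  assumes u: "u \<in> schwartz" and a: "norm a \<ge> 1"
  shows "norm (\<integral>t. u t * ee (t \<bullet> a) \<partial>lborel)
    \<le> inverse (norm a) * (2 ^ (2 * DIM('a)) * DIM('a) * integral\<^sup>L lborel (decay :: 'a \<Rightarrow> real) * seminorm_sum (2 * DIM('a) + 1) u)"
proof -
  let ?S = "seminorm_sum (2 * DIM('a) + 1) u"
  let ?D = "2 * DIM('a)"
  note [measurable] = schwartzD(2)[OF u]
  have sm: "smooth u" by (rule schwartzD(1)[OF u])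
  define s where "s = (1 / (2 * (norm a)\<^sup>2)) *\<^sub>R a"
  have a0: "a \<noteq> 0" using a by auto
  have ns: "norm s = inverse (2 * norm a)" using a0 by (simp add: s_def power2_eq_square field_simps)
  then have s: "norm s \<le> 1 / 2" using le_imp_inverse_le[of 2 "2 * norm a"] a by simp
  have sa: "s \<bullet> a = 1 / 2" using a0 by (simp add: s_def power2_norm_eq_inner)
  have ui: "integrable lborel u" by (rule schwartz_integrable_L2[OF u])
  have i1: "integrable lborel (\<lambda>t. u t * ee (t \<bullet> a))" by (intro integrable_mult_ee ui) measurable
  have us: "integrable lborel (\<lambda>t. u (t + s))" using integrable_lborel_translate[OF ui, of "- s"] by simp
  have i2: "integrable lborel (\<lambda>t. u (t + s) * ee (t \<bullet> a))" by (intro integrable_mult_ee us) measurable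
  have half: "ee (1 / 2) = -1" by (simp add: ee_eq_cis)
  have "(\<integral>t. u t * ee (t \<bullet> a) \<partial>lborel) = (\<integral>t. u (t - (- s)) * ee ((t - (- s)) \<bullet> a) \<partial>lborel)"
    by (rule integral_lborel_translate[symmetric]) measurable
  also have "\<dots> = - (\<integral>t. u (t + s) * ee (t \<bullet> a) \<partial>lborel)"
    by (simp add: inner_add_left sa ee_add half)
  finally have "2 * (\<integral>t. u t * ee (t \<bullet> a) \<partial>lborel) = (\<integral>t. u t * ee (t \<bullet> a) \<partial>lborel) - (\<integral>t. u (t + s) * ee (t \<bullet> a) \<partial>lborel)"
    by simp
  also have "\<dots> = (\<integral>t. (u t - u (t + s)) * ee (t \<bullet> a) \<partial>lborel)"
    by (simp add: left_diff_distrib i1 i2)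
  finally have two: "2 * norm (\<integral>t. u t * ee (t \<bullet> a) \<partial>lborel) = norm (\<integral>t. (u t - u (t + s)) * ee (t \<bullet> a) \<partial>lborel)"
    by (metis norm_mult norm_numeral)
  have S0: "?S \<ge> 0" by (rule seminorm_sum_nonneg[OF u])
  have "norm ((u t - u (t + s)) * ee (t \<bullet> a)) \<le> (norm s * (DIM('a) * ?S * 2 ^ ?D)) * decay t" for t
  proof -
    have "norm (u (t + s) - u t) \<le> (DIM('a) * ?S * (2 ^ ?D * decay t)) * norm ((t + s) - t)"
    proof (rule differentiable_bound[of "closed_segment t (t + s)" u "\<lambda>z. frechet_derivative u (at z)"])
      fix z assume z: "z \<in> closed_segment t (t + s)"
      show "(u has_derivative frechet_derivative u (at z)) (at z within closed_segment t (t + s))"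
        by (rule has_derivative_at_withinI) (rule smooth_has_derivative[OF sm])
      \<comment> \<open>On the segment \<open>z\<close> stays within 1/2 of \<open>t\<close>, so
        \<open>1 + norm t \<le> 2 * (1 + norm z)\<close> and \<open>decay z\<close> is at most
        \<open>2 ^ ?D\<close> times \<open>decay t\<close>. This is the power of 2 in the
        constant.\<close>
      have "norm (z - t) \<le> norm s" using segment_bound(1)[OF z] by simp
      then have "norm t \<le> norm z + 1 / 2"
        using s norm_triangle_sub[of t z] by (simp add: norm_minus_commute)
      moreover have "0 \<le> norm z" by (rule norm_ge_zero)
      ultimately have "1 + norm t \<le> 2 + 2 * norm z" by linarith
      then have "1 + norm t \<le> 2 * (1 + norm z)" by simp
      then have "(1 + norm t) ^ ?D \<le> (2 * (1 + norm z)) ^ ?D" by (intro power_mono) auto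
      then have "inverse ((2 * (1 + norm z)) ^ ?D) \<le> decay t"
        unfolding decay_def by (rule le_imp_inverse_le) (simp add: add_pos_nonneg)
      moreover have "decay z = 2 ^ ?D * inverse ((2 * (1 + norm z)) ^ ?D)"
        unfolding decay_def power_mult_distrib inverse_mult_distrib mult.assoc[symmetric] by simp
      ultimately have dz: "decay z \<le> 2 ^ ?D * decay t" by simp
      have "(\<Sum>b\<in>Basis. norm (dir_deriv b u z)) \<le> (\<Sum>b\<in>(Basis::'a set). ?S * (2 ^ ?D * decay t))"
      proof (rule sum_mono)
        fix b :: 'a assume b: "b \<in> Basis"
        have "norm (dir_deriv b u z) = (1 + norm z) ^ 0 * norm (iter_deriv [b] u z)" by (simp add: iter_deriv_Cons)
        also have "\<dots> \<le> schwartz_seminorm (0 + 2 * DIM('a)) [b] u * decay z" by (rule schwartz_decay[OF u]) (use b in simp)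
        also have "\<dots> \<le> ?S * (2 ^ ?D * decay t)"
          using schwartz_seminorm_le_sum[OF u, of "0 + 2 * DIM('a)" "2 * DIM('a) + 1" "[b]"] b dz S0 decay_bounds(1)[of z]
          by (intro mult_mono) auto
        finally show "norm (dir_deriv b u z) \<le> ?S * (2 ^ ?D * decay t)" .
      qed
      also have "\<dots> = DIM('a) * ?S * (2 ^ ?D * decay t)" by simp
      finally have "norm (frechet_derivative u (at z) h) \<le> DIM('a) * ?S * (2 ^ ?D * decay t) * norm h" for h
        using norm_frechet_derivative_le[OF sm, of z h] by (meson mult_right_mono norm_ge_zero order.trans)
      then show "onorm (frechet_derivative u (at z)) \<le> DIM('a) * ?S * (2 ^ ?D * decay t)" by (rule onorm_le)
    qed auto
    then show ?thesis by (simp add: norm_mult norm_minus_commute mult_ac)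
  qed
  from norm_integral_le_decay[OF this]
  have "2 * norm (\<integral>t. u t * ee (t \<bullet> a) \<partial>lborel) \<le> norm s * (DIM('a) * ?S * 2 ^ ?D) * integral\<^sup>L lborel (decay :: 'a \<Rightarrow> real)"
    unfolding two .
  also have "\<dots> = inverse (norm a) * (2 ^ ?D * DIM('a) * integral\<^sup>L lborel (decay :: 'a \<Rightarrow> real) * ?S) / 2"
    by (simp add: ns)
  finally show ?thesis
    using norm_ge_zero[of "\<integral>t. u t * ee (t \<bullet> a) \<partial>lborel"] by linarith
qed

section \<open>Separated sequences of extreme points and nearby reflection centres\<close>

lemma separated_sequence_limit_point:
  fixes E :: "'a::euclidean_space set"
  assumes "z islimpt E"
  obtains e r where "\<And>k. e k \<in> E" "\<And>k. 0 < r k" "\<And>k. r k \<le> (1/2) ^ k"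
    "\<And>j k. j \<noteq> k \<Longrightarrow> ball (e j) (r j) \<inter> ball (e k) (r k) = {}" "\<And>k::nat. norm (e k - z) \<le> (1/2) ^ k / 4"
proof -
  have near: "\<exists>x\<in>E. x \<noteq> z \<and> dist x z < d" if "d > 0" for d
    using assms that by (auto simp: islimpt_approachable)
  \<comment> \<open>The factor 4 between successive distances to \<open>z\<close> makes the balls of
    a quarter of the distance disjoint; the bound \<open>(1/2) ^ n / 4\<close> supplies the rate of
    convergence and the bound on the radii.\<close>
  have "\<exists>e. \<forall>n. (e n \<in> E \<and> e n \<noteq> z \<and> dist (e n) z \<le> (1/2) ^ n / 4) \<and> dist (e (Suc n)) z < dist (e n) z / 4"
  proof (rule dependent_nat_choice)
    show "\<exists>x. x \<in> E \<and> x \<noteq> z \<and> dist x z \<le> (1/2) ^ 0 / 4" using near[of "1/4"] by force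
    fix x and n :: nat assume x: "x \<in> E \<and> x \<noteq> z \<and> dist x z \<le> (1/2) ^ n / 4"
    then obtain y where "y \<in> E" "y \<noteq> z" "dist y z < dist x z / 4" using near[of "dist x z / 4"] by auto
    moreover have "dist y z \<le> (1/2) ^ Suc n / 4"
      using x \<open>dist y z < dist x z / 4\<close> zero_le_dist[of x z] unfolding power_Suc by linarith
    ultimately show "\<exists>y. (y \<in> E \<and> y \<noteq> z \<and> dist y z \<le> (1/2) ^ Suc n / 4) \<and> dist y z < dist x z / 4" by blast
  qed
  then obtain e where e: "\<And>n. e n \<in> E" "\<And>n. e n \<noteq> z" "\<And>n. dist (e n) z \<le> (1/2) ^ n / 4"
    "\<And>n. dist (e (Suc n)) z < dist (e n) z / 4" by blast
  define d where "d = (\<lambda>n. dist (e n) z)"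
  have d0: "d n > 0" for n using e(2) by (simp add: d_def)
  have dS: "d (Suc n) < d n / 4" for n using e(4) by (simp add: d_def)
  have dlt: "d k < d j / 4" if "j < k" for j k
    using that
  proof (induction k)
    case (Suc k)
    show ?case
    proof (cases "j = k")
      case False
      then have "d k < d j / 4" using Suc by simp
      then show ?thesis using dS[of k] d0[of k] by linarith
    qed (use dS in simp)
  qed simp
  have dj: "ball (e j) (d j / 4) \<inter> ball (e k) (d k / 4) = {}" if "j < k" for j k
  proof (rule ccontr)
    assume "\<not> ?thesis"
    then obtain x where "dist (e j) x < d j / 4" "dist (e k) x < d k / 4" by auto
    \<comment> \<open>As \<open>d k < d j / 4\<close>, the right-hand side is below
      \<open>9 / 16 * d j\<close>.\<close>
    then have "d j < d j / 4 + d k / 4 + d k"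
      using dist_triangle[of "e j" z x] dist_triangle[of x z "e k"] by (simp add: d_def dist_commute)
    then show False using dlt[OF that] d0[of j] by linarith
  qed
  show ?thesis
  proof (rule that[of e "\<lambda>k. d k / 4"])
    show "ball (e j) (d j / 4) \<inter> ball (e k) (d k / 4) = {}" if "j \<noteq> k" for j k
      using that dj[of j k] dj[of k j] by (cases "j < k") auto
    show "d k / 4 \<le> (1 / 2) ^ k" for k using e(3)[of k] zero_le_power[of "1/2::real" k] unfolding d_def by linarith
  qed (use e d0 in \<open>auto simp: d_def dist_norm\<close>)
qed

lemma separated_sequence_unbounded:
  fixes E :: "'a::euclidean_space set"
  assumes "\<not> bounded E"
  obtains e r where "\<And>k. e k \<in> E" "\<And>k. 0 < r k" "\<And>k. r k \<le> (1/2) ^ k"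
    "\<And>j k. j \<noteq> k \<Longrightarrow> ball (e j) (r j) \<inter> ball (e k) (r k) = {}" "\<And>k::nat. norm (e k) \<ge> 2 ^ k"
proof -
  have far: "\<exists>x\<in>E. norm x > d" for d using assms by (auto simp: bounded_iff not_le)
  \<comment> \<open>Doubling the norm keeps the growth \<open>2 ^ n\<close>, and the added 2 leaves
    gaps in which balls of radius at most 1 are disjoint.\<close>
  have "\<exists>e. \<forall>n. (e n \<in> E \<and> norm (e n) \<ge> 2 ^ n) \<and> norm (e (Suc n)) \<ge> 2 * norm (e n) + 2"
  proof (rule dependent_nat_choice)
    show "\<exists>x. x \<in> E \<and> norm x \<ge> 2 ^ 0" using far[of 1] by force
    fix x and n :: nat assume x: "x \<in> E \<and> norm x \<ge> 2 ^ n"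
    obtain y where "y \<in> E" "norm y > 2 * norm x + 2" using far by blast
    then show "\<exists>y. (y \<in> E \<and> norm y \<ge> 2 ^ Suc n) \<and> norm y \<ge> 2 * norm x + 2" using x by (intro exI[of _ y]) auto
  qed
  then obtain e where e: "\<And>n. e n \<in> E" "\<And>n. norm (e n) \<ge> 2 ^ n" "\<And>n. norm (e (Suc n)) \<ge> 2 * norm (e n) + 2" by blast
  have lt: "norm (e k) \<ge> norm (e j) + 2" if "j < k" for j k
    using that
  proof (induction k)
    case (Suc k)
    show ?case
    proof (cases "j = k")
      case True
      have "norm (e (Suc k)) \<ge> 2 * norm (e k) + 2" by (rule e(3))
      then show ?thesis unfolding True using norm_ge_zero[of "e k"] by linarith
    next
      case False
      then have "norm (e k) \<ge> norm (e j) + 2" using Suc by simp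
      then show ?thesis using e(3)[of k] norm_ge_zero[of "e k"] by linarith
    qed
  qed simp
  have r1: "(1/2::real) ^ k \<le> 1" for k by (simp add: power_le_one)
  have dj: "ball (e j) ((1/2) ^ j) \<inter> ball (e k) ((1/2) ^ k) = {}" if "j < k" for j k
  proof (rule ccontr)
    assume "\<not> ?thesis"
    then obtain x where "dist (e j) x < (1/2) ^ j" "dist (e k) x < (1/2) ^ k" by auto
    then have "dist (e j) (e k) < 2"
      using dist_triangle[of "e j" "e k" x] r1[of j] r1[of k] by (simp add: dist_commute)
    then show False using lt[OF that] norm_triangle_ineq2[of "e k" "e j"] by (simp add: dist_norm norm_minus_commute)
  qed
  show ?thesis
  proof (rule that[of e "\<lambda>k. (1/2) ^ k"])
    show "ball (e j) ((1/2) ^ j) \<inter> ball (e k) ((1/2) ^ k) = {}" if "j \<noteq> k" for j k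
      using that dj[of j k] dj[of k j] by (cases "j < k") auto
  qed (use e in auto)
qed

lemma reflections_near_extreme_points:
  fixes \<Omega> :: "'a::euclidean_space set"
  assumes "open \<Omega>" "convex \<Omega>"
    and e: "\<And>k. e k extreme_point_of (closure \<Omega>)" and r: "\<And>k. 0 < r k" "\<And>k. r k \<le> (1/2) ^ k"
    and dj: "\<And>j k. j \<noteq> k \<Longrightarrow> ball (e j) (r j) \<inter> ball (e k) (r k) = {}"
  shows "\<exists>p. (\<forall>k::nat. p k \<in> \<Omega> \<and> dist (p k) (e k) \<le> (1/2) ^ k / 4) \<and>
    (\<forall>j k x. j \<noteq> k \<longrightarrow> x \<in> \<Omega> \<longrightarrow> 2 *\<^sub>R p j - x \<in> \<Omega> \<longrightarrow> 2 *\<^sub>R p k - x \<notin> \<Omega>) \<and>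
    emeasure lborel (\<Union>k. {x \<in> \<Omega>. 2 *\<^sub>R p k - x \<in> \<Omega>}) < \<infinity>"
proof -
  have "\<exists>d>0. \<forall>x\<in>closure \<Omega>. \<forall>y\<in>closure \<Omega>. dist (x + y) (2 *\<^sub>R e k) < d \<longrightarrow> dist x (e k) < r k" for k
    using extreme_point_midpoint_stability[OF closed_closure convex_closure[OF assms(2)] e r(1)] by metis
  then obtain d where d: "\<And>k. d k > 0"
    "\<And>k x y. x \<in> closure \<Omega> \<Longrightarrow> y \<in> closure \<Omega> \<Longrightarrow> dist (x + y) (2 *\<^sub>R e k) < d k \<Longrightarrow> dist x (e k) < r k" by metis
  \<comment> \<open>Two demands on \<open>p k\<close>. Points of \<open>\<Omega>\<close> with sum
    \<open>2 *\<^sub>R p k\<close> must satisfy the stability condition at \<open>e k\<close>, whose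
    defect is twice the distance: hence \<open>d k / 2\<close>. The other entry makes the terms of
    the symbol small.\<close>
  have "\<exists>p\<in>\<Omega>. dist p (e k) < min (d k / 2) ((1/2) ^ k / 4)" for k
  proof -
    have "e k \<in> closure \<Omega>" using e by (auto simp: extreme_point_of_def)
    then have approach: "\<forall>\<epsilon>>0. \<exists>y\<in>\<Omega>. dist y (e k) < \<epsilon>" by (simp only: closure_approachable)
    have "min (d k / 2) ((1/2) ^ k / 4) > 0" using d(1)[of k] by simp
    then show ?thesis by (rule approach[rule_format])
  qed
  then obtain p where p: "\<And>k. p k \<in> \<Omega>" "\<And>k. dist (p k) (e k) < min (d k / 2) ((1/2) ^ k / 4)" by metis
  have W: "x \<in> ball (e k) (r k)" if "x \<in> \<Omega>" "2 *\<^sub>R p k - x \<in> \<Omega>" for x k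
  proof -
    have "dist (x + (2 *\<^sub>R p k - x)) (2 *\<^sub>R e k) = 2 * dist (p k) (e k)"
      by (simp add: dist_norm flip: scaleR_diff_right)
    then have "dist (x + (2 *\<^sub>R p k - x)) (2 *\<^sub>R e k) < d k" using p(2)[of k] by simp
    then have "dist x (e k) < r k" using d(2) that closure_subset by blast
    then show ?thesis by (simp add: dist_commute)
  qed
  show ?thesis
  proof (intro exI[of _ p] conjI allI impI)
    show "p k \<in> \<Omega>" for k by (rule p)
    show "dist (p k) (e k) \<le> (1/2) ^ k / 4" for k using p(2)[of k] by simp
    show "2 *\<^sub>R p k - x \<notin> \<Omega>" if "j \<noteq> k" "x \<in> \<Omega>" "2 *\<^sub>R p j - x \<in> \<Omega>" for j k x
      using W that dj[OF that(1)] by blast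
    have "emeasure lborel (\<Union>k. {x \<in> \<Omega>. 2 *\<^sub>R p k - x \<in> \<Omega>}) \<le> emeasure lborel (\<Union>k. ball (e k) (r k))"
      using W by (intro emeasure_mono) auto
    also have "\<dots> \<le> (\<Sum>k. emeasure lborel (ball (e k) (r k)))" by (rule emeasure_subadditive_countably) auto
    also have "\<dots> \<le> (\<Sum>k. ennreal (unit_ball_vol DIM('a) * (1/2) ^ k))"
    proof (intro suminf_le summableI)
      fix k
      \<comment> \<open>Radii at most 1 have \<open>r k ^ DIM('a) \<le> r k\<close>, so the volumes
        are dominated by a geometric series in every dimension.\<close>
      have "r k \<le> 1" using r(2)[of k] power_le_one[of "1/2::real" k] by simp
      then have "r k ^ DIM('a) \<le> r k ^ 1" using r(1)[of k] by (intro power_decreasing) (auto simp: Suc_leI)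
      then have "r k ^ DIM('a) \<le> (1/2) ^ k" using r(2)[of k] by simp
      then show "emeasure lborel (ball (e k) (r k)) \<le> ennreal (unit_ball_vol DIM('a) * (1/2) ^ k)"
        using r(1)[of k] by (subst emeasure_ball) (auto intro!: ennreal_leI mult_left_mono unit_ball_vol_nonneg)
    qed
    also have "\<dots> < \<infinity>"
      by (subst suminf_ennreal2) (auto intro!: summable_mult unit_ball_vol_nonneg)
    finally show "emeasure lborel (\<Union>k. {x \<in> \<Omega>. 2 *\<^sub>R p k - x \<in> \<Omega>}) < \<infinity>" .
  qed
qed

section \<open>Bounded and unbounded sets of extreme points\<close>

theorem nehari_fails_if_infinite_extreme_points:
  fixes \<Omega> :: "'a::euclidean_space set"
  assumes "open \<Omega>" "convex \<Omega>" and inf: "infinite {x. x extreme_point_of closure \<Omega>}"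
  shows "\<not> nehari_theorem_true \<Omega>"
proof -
  let ?E = "{x. x extreme_point_of closure \<Omega>}"
  \<comment> \<open>This provides a point \<open>q\<close> outside \<open>2\<Omega>\<close> in both
    cases. An extreme point can be interior only if the closed set is a single point, which
    infinitely many extreme points exclude.\<close>
  have E_out: "?E \<subseteq> - \<Omega>"
  proof
    fix x assume "x \<in> ?E"
    then have x: "x extreme_point_of closure \<Omega>" by simp
    have "?E \<subseteq> closure \<Omega>" by (auto simp: extreme_point_of_def)
    then have "closure \<Omega> \<noteq> {x}" using inf finite_subset[of ?E "{x}"] by auto
    then have "x \<notin> interior (closure \<Omega>)" using extreme_point_not_in_interior[OF x] by simp
    then show "x \<in> - \<Omega>" using interior_maximal[OF closure_subset assms(1)] by auto
  qed
  show ?thesis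
  proof (cases "bounded ?E")
    case True
    then have "compact (closure ?E)" by simp
    from Heine_Borel_imp_Bolzano_Weierstrass[OF this inf closure_subset]
    obtain z where z: "z islimpt ?E" by auto
    have "z islimpt - \<Omega>" using z E_out by (rule islimpt_subset)
    moreover have "closed (- \<Omega>)" using assms(1) by (simp only: closed_Compl)
    ultimately have "z \<in> - \<Omega>" by (simp add: closed_limpt)
    obtain e r where e: "\<And>k. e k \<in> ?E" "\<And>k. 0 < r k" "\<And>k. r k \<le> (1/2) ^ k"
      "\<And>j k. j \<noteq> k \<Longrightarrow> ball (e j) (r j) \<inter> ball (e k) (r k) = {}" "\<And>k::nat. norm (e k - z) \<le> (1/2) ^ k / 4"
      by (rule separated_sequence_limit_point[OF z]) blast
    have ex: "e k extreme_point_of closure \<Omega>" for k using e(1)[of k] by simp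
    obtain p where pk: "\<forall>k. p k \<in> \<Omega> \<and> dist (p k) (e k) \<le> (1/2) ^ k / 4"
      and p: "\<forall>j k x. j \<noteq> k \<longrightarrow> x \<in> \<Omega> \<longrightarrow> 2 *\<^sub>R p j - x \<in> \<Omega> \<longrightarrow> 2 *\<^sub>R p k - x \<notin> \<Omega>"
      "emeasure lborel (\<Union>k. {x \<in> \<Omega>. 2 *\<^sub>R p k - x \<in> \<Omega>}) < \<infinity>"
      using reflections_near_extreme_points[OF assms(1,2) ex e(2-4)] by blast
    let ?c = "2 * pi * integral\<^sup>L lborel (decay :: 'a \<Rightarrow> real)"
    have c0: "?c \<ge> 0" by (intro mult_nonneg_nonneg integral_decay_nonneg) auto
    \<comment> \<open>Here \<open>p k\<close> is within \<open>(1/2) ^ k / 4\<close> of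
      \<open>e k\<close>, and \<open>e k\<close> within the same distance of \<open>z\<close>, so
      the two frequencies in the k-th term differ by at most \<open>(1/2) ^ k\<close>.
      \<open>z\<close> itself is outside \<open>\<Omega>\<close> as a limit of points of the closed
      complement.\<close>
    interpret reflections \<Omega> p "2 *\<^sub>R z" 1 ?c "2 * DIM('a) + 1"
    proof
      show "2 *\<^sub>R z \<notin> (\<lambda>x. 2 *\<^sub>R x) ` \<Omega>" using \<open>z \<in> - \<Omega>\<close> by auto
      fix u :: "'a \<Rightarrow> complex" and k assume u: "u \<in> schwartz"
      have S0: "seminorm_sum (2 * DIM('a) + 1) u \<ge> 0" by (rule seminorm_sum_nonneg[OF u])
      have "norm (2 *\<^sub>R p k - 2 *\<^sub>R z) = 2 * dist (p k) z" by (simp add: dist_norm flip: scaleR_diff_right)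
      also have "\<dots> \<le> (1/2) ^ k" using dist_triangle[of "p k" z "e k"] pk[rule_format, of k] e(5)[of k] by (simp add: dist_norm)
      finally have "norm (2 *\<^sub>R p k - 2 *\<^sub>R z) \<le> (1/2) ^ k" .
      then have le: "norm (2 *\<^sub>R p k - 2 *\<^sub>R z) * (?c * seminorm_sum (2 * DIM('a) + 1) u) \<le> (1/2) ^ k * (?c * seminorm_sum (2 * DIM('a) + 1) u)"
        by (rule mult_right_mono[OF _ mult_nonneg_nonneg[OF c0 S0]])
      show "norm (\<integral>t. u t * (ee (t \<bullet> (2 *\<^sub>R p k)) - 1 * ee (t \<bullet> (2 *\<^sub>R z))) \<partial>lborel) \<le> (1/2) ^ k * (?c * seminorm_sum (2 * DIM('a) + 1) u)"
        unfolding mult_1 by (rule order.trans[OF exp_difference_bound[OF u] le])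
    qed (use assms pk p in auto)
    show ?thesis by (rule nehari_fails)
  next
    case False
    obtain e r where e: "\<And>k. e k \<in> ?E" "\<And>k. 0 < r k" "\<And>k. r k \<le> (1/2) ^ k"
      "\<And>j k. j \<noteq> k \<Longrightarrow> ball (e j) (r j) \<inter> ball (e k) (r k) = {}" "\<And>k::nat. norm (e k) \<ge> 2 ^ k"
      by (rule separated_sequence_unbounded[OF False]) blast
    have ex: "e k extreme_point_of closure \<Omega>" for k using e(1)[of k] by simp
    obtain p where pk: "\<forall>k. p k \<in> \<Omega> \<and> dist (p k) (e k) \<le> (1/2) ^ k / 4"
      and p: "\<forall>j k x. j \<noteq> k \<longrightarrow> x \<in> \<Omega> \<longrightarrow> 2 *\<^sub>R p j - x \<in> \<Omega> \<longrightarrow> 2 *\<^sub>R p k - x \<notin> \<Omega>"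
      "emeasure lborel (\<Union>k. {x \<in> \<Omega>. 2 *\<^sub>R p k - x \<in> \<Omega>}) < \<infinity>"
      using reflections_near_extreme_points[OF assms(1,2) ex e(2-4)] by blast
    let ?c = "2 ^ (2 * DIM('a)) * DIM('a) * integral\<^sup>L lborel (decay :: 'a \<Rightarrow> real)"
    have c0: "?c \<ge> 0" by (intro mult_nonneg_nonneg integral_decay_nonneg) auto
    \<comment> \<open>The terms decay by themselves, so \<open>\<sigma> = 0\<close>; the point
      \<open>2 *\<^sub>R e 0\<close> is a witness outside \<open>2\<Omega>\<close> for
      \<open>q\<close>.\<close>
    interpret reflections \<Omega> p "2 *\<^sub>R e 0" 0 ?c "2 * DIM('a) + 1"
    proof
      show "2 *\<^sub>R e 0 \<notin> (\<lambda>x. 2 *\<^sub>R x) ` \<Omega>" using e(1)[of 0] E_out by auto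
      fix u :: "'a \<Rightarrow> complex" and k assume u: "u \<in> schwartz"
      have S0: "seminorm_sum (2 * DIM('a) + 1) u \<ge> 0" by (rule seminorm_sum_nonneg[OF u])
      \<comment> \<open>\<open>p k\<close> is within 1/4 of \<open>e k\<close>, so twice its norm is
        at least \<open>2 * 2 ^ k - 1 / 2\<close>, which exceeds \<open>2 ^ k\<close>. In particular
        it is at least 1, as \<open>exp_decay_bound\<close> requires.\<close>
      have "norm (e k) \<le> norm (p k) + dist (p k) (e k)"
        using norm_triangle_ineq4[of "p k" "p k - e k"] by (simp add: dist_norm)
      moreover have "(1/2::real) ^ k \<le> 1" by (simp add: power_le_one)
      moreover have "(1::real) \<le> 2 ^ k" by simp
      moreover have "norm (2 *\<^sub>R p k) = 2 * norm (p k)" by simp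
      ultimately have n: "norm (2 *\<^sub>R p k) \<ge> 2 ^ k"
        using pk[rule_format, of k] e(5)[of k] by linarith
      then have "inverse (norm (2 *\<^sub>R p k)) \<le> inverse (2 ^ k)" by (intro le_imp_inverse_le) auto
      then have "inverse (norm (2 *\<^sub>R p k)) \<le> (1/2) ^ k" by (simp add: power_divide inverse_eq_divide)
      then have le: "inverse (norm (2 *\<^sub>R p k)) * (?c * seminorm_sum (2 * DIM('a) + 1) u) \<le> (1/2) ^ k * (?c * seminorm_sum (2 * DIM('a) + 1) u)"
        by (rule mult_right_mono[OF _ mult_nonneg_nonneg[OF c0 S0]])
      have "norm (2 *\<^sub>R p k) \<ge> 1" using n \<open>1 \<le> 2 ^ k\<close> by linarith
      then show "norm (\<integral>t. u t * (ee (t \<bullet> (2 *\<^sub>R p k)) - 0 * ee (t \<bullet> (2 *\<^sub>R e 0))) \<partial>lborel) \<le> (1/2) ^ k * (?c * seminorm_sum (2 * DIM('a) + 1) u)"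
        unfolding mult_zero_left diff_0_right by (rule order.trans[OF exp_decay_bound[OF u] le])
    qed (use assms pk p in auto)
    show ?thesis by (rule nehari_fails)
  qed
qed

theorem corollary8:
  fixes \<Omega> :: "(real ^ 2) set"
  assumes "\<Omega> \<noteq> {}" and "open \<Omega>" and "convex \<Omega>"
    and "\<not> polyhedron (closure \<Omega>)"
  shows "\<not> nehari_theorem_true \<Omega>"
proof -
  have "infinite {x. x extreme_point_of closure \<Omega>}"
    using polyhedron_if_finite_extreme_points[OF closed_closure convex_closure[OF assms(3)]] assms(4) by blast
  then show ?thesis using nehari_fails_if_infinite_extreme_points assms(2,3) by blast
qed

end
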